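(* Let $(p_n)$ be a sequence of positive integers diverging to $\infty$ as $n\to\infty$ and let $\kappa_n=\tau_np_n^{3/4}/\sqrt n$, where the positive sequence $(\tau_n)$ is $O(1)$ but not $o(1)$. Then, as $n\to\infty$ under $\mathrm{P}^{(n)}_0$, $$ \log\frac{d\mathrm{P}^{(n)T_n}_{\kappa_n,f_{\rm FvML}}}{d\mathrm{P}^{(n)}_0}=\tau_n^2\Delta^{(n)T_n}-\frac{\tau_n^4}{4}+o_{\mathrm{P}}(1), $$ where $\Delta^{(n)T_n}:=R_n^{\rm St}/\sqrt2$ is asymptotically normal with mean zero and variance $1/2$.
   Context: $\mathcal{S}^{p-1}=\{x\in\mathbb{R}^p:\|x\|=1\}$. $\mathrm{P}^{(n)}_0$ denotes the hypothesis under which $X_{n1},\ldots,X_{nn}$ are i.i.d. uniform over $\mathcal{S}^{p_n-1}$. $f_{\rm FvML}(\cdot)=\exp(\cdot)$. For $\theta\in\mathcal{S}^{p_n-1}$ and $\kappa>0$, $\mathrm{P}^{(n)}_{\theta,\kappa,f_{\rm FvML}}$ denotes the hypothesis under which $X_{n1},\ldots,X_{nn}$ are i.i.d. with density on $\mathcal{S}^{p_n-1}$, with respect to the surface area measure, proportional to $x\mapsto\exp(\kappa\,x'\theta)$. Consider the group of rotations $(x_1,\ldots,x_n)\mapsto(Ox_1,\ldots,Ox_n)$, $O\in SO(p_n)$ (the $p_n\times p_n$ orthogonal matrices with determinant one), acting on $(\mathcal{S}^{p_n-1})^n$, and let $T_n$ be a maximal invariant for this group. $\mathrm{P}^{(n)T_n}_{\kappa,f_{\rm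 FvML}}$ denotes the image by $T_n$ of $\mathrm{P}^{(n)}_{\theta,\kappa,f_{\rm FvML}}$ (it does not depend on $\theta$), and the likelihood ratio of the images by $T_n$, with respect to the null of uniformity, is $$ \frac{d\mathrm{P}^{(n)T_n}_{\kappa,f_{\rm FvML}}}{d\mathrm{P}^{(n)}_0}=\frac{c_{p_n,\kappa}^n\,\mathrm{E}\big[\prod_{i=1}^n\exp(\kappa X_{ni}'U)\,\big|\,X_{n1},\ldots,X_{nn}\big]}{c_{p_n}^n}, $$ where $U$ is uniformly distributed over $\mathcal{S}^{p_n-1}$ and independent of the $X_{ni}$'s, $c_{p,\kappa}=1/\int_{-1}^1(1-t^2)^{(p-3)/2}e^{\kappa t}\,dt$ and $c_p=1/\int_{-1}^1(1-t^2)^{(p-3)/2}\,dt$. The standardized Rayleigh statistic is $R_n^{\rm St}:=\frac{R_n-p_n}{\sqrt{2p_n}}=\frac{\sqrt{2p_n}}{n}\sum_{1\le i<j\le n}X_{ni}'X_{nj}$, where $R_n:=np_n\|\bar X_n\|^2$ and $\bar X_n:=\frac1n\sum_{i=1}^nX_{ni}$. *)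

theory Defs
  imports
    "HOL-Probability.Probability"
    "HOL-Library.Landau_Symbols"
    "Jordan_Normal_Form.Determinant"
begin

text \<open>
  The dimension depends on the sample size, so a vector of \<open>\<real>\<^sup>p\<close> is an extensional function on
  \<open>{..<p}\<close>, and a sample of size \<open>n\<close> is an extensional function on \<open>{1..n}\<close> with such values.
\<close>

section \<open>Spherical distributions\<close>

definition euclid :: "nat \<Rightarrow> (nat \<Rightarrow> real) measure" where
  "euclid p = (\<Pi>\<^sub>M j\<in>{..<p}. lborel)"

definition inner_prod :: "nat \<Rightarrow> (nat \<Rightarrow> real) \<Rightarrow> (nat \<Rightarrow> real) \<Rightarrow> real" where
  "inner_prod p x y = (\<Sum>j<p. x j * y j)"

definition norm_vec :: "nat \<Rightarrow> (nat \<Rightarrow> real) \<Rightarrow> real" where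
  "norm_vec p x = L2_set x {..<p}"

definition unit_sphere :: "nat \<Rightarrow> (nat \<Rightarrow> real) set" where
  "unit_sphere p = {x \<in> space (euclid p). norm_vec p x = 1}"

text \<open>
  Surface area measure: the area of a Borel set \<open>A\<close> of the sphere is \<open>p\<close> times the volume of the
  cone \<open>{x. 0 < \<parallel>x\<parallel> \<le> 1 \<and> x / \<parallel>x\<parallel> \<in> A}\<close> over it. The target of \<open>distr\<close>
  only supplies the Borel sets of the sphere; its (zero) measure is not used.
\<close>
definition surface_measure :: "nat \<Rightarrow> (nat \<Rightarrow> real) measure" where
  "surface_measure p =
     scale_measure (of_nat p)
       (distr (restrict_space (euclid p) {x. 0 < norm_vec p x \<and> norm_vec p x \<le> 1})
              (restrict_space (euclid p) (unit_sphere p))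
              (\<lambda>x. \<lambda>j\<in>{..<p}. x j / norm_vec p x))"

definition sphere_unif :: "nat \<Rightarrow> (nat \<Rightarrow> real) measure" where
  "sphere_unif p = uniform_measure (surface_measure p) (unit_sphere p)"

definition fvml :: "nat \<Rightarrow> (nat \<Rightarrow> real) \<Rightarrow> real \<Rightarrow> (nat \<Rightarrow> real) measure" where
  "fvml p \<theta> \<kappa> =
     density (surface_measure p)
       (\<lambda>x. ennreal (exp (\<kappa> * inner_prod p x \<theta>) /
                      (\<integral>y. exp (\<kappa> * inner_prod p y \<theta>) \<partial>surface_measure p)))"

definition P_null :: "nat \<Rightarrow> nat \<Rightarrow> (nat \<Rightarrow> nat \<Rightarrow> real) measure" where
  "P_null n p = (\<Pi>\<^sub>M i\<in>{1..n}. sphere_unif p)"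

definition P_fvml :: "nat \<Rightarrow> nat \<Rightarrow> (nat \<Rightarrow> real) \<Rightarrow> real \<Rightarrow> (nat \<Rightarrow> nat \<Rightarrow> real) measure" where
  "P_fvml n p \<theta> \<kappa> = (\<Pi>\<^sub>M i\<in>{1..n}. fvml p \<theta> \<kappa>)"

section \<open>Rotations and maximal invariants\<close>

definition SO :: "nat \<Rightarrow> real mat set" where
  "SO p = {A \<in> carrier_mat p p. A * transpose_mat A = 1\<^sub>m p \<and> Determinant.det A = 1}"

definition rotate_vec :: "nat \<Rightarrow> real mat \<Rightarrow> (nat \<Rightarrow> real) \<Rightarrow> (nat \<Rightarrow> real)" where
  "rotate_vec p A x = (\<lambda>i\<in>{..<p}. \<Sum>j<p. A $$ (i, j) * x j)"

definition rotate_sample ::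
    "nat \<Rightarrow> nat \<Rightarrow> real mat \<Rightarrow> (nat \<Rightarrow> nat \<Rightarrow> real) \<Rightarrow> (nat \<Rightarrow> nat \<Rightarrow> real)" where
  "rotate_sample n p A x = (\<lambda>i\<in>{1..n}. rotate_vec p A (x i))"

definition maximal_invariant :: "'g set \<Rightarrow> ('g \<Rightarrow> 'x \<Rightarrow> 'x) \<Rightarrow> 'x set \<Rightarrow> ('x \<Rightarrow> 't) \<Rightarrow> bool" where
  "maximal_invariant G act S T \<longleftrightarrow>
     (\<forall>x\<in>S. \<forall>g\<in>G. T (act g x) = T x) \<and>
     (\<forall>x\<in>S. \<forall>y\<in>S. T x = T y \<longrightarrow> (\<exists>g\<in>G. y = act g x))"

text \<open>
  The usual convention for statistics: the range of \<open>T\<close> carries all sets whose preimage under \<open>T\<close>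
  is measurable. For a maximal invariant these preimages are exactly the measurable invariant sets,
  so the likelihood ratio below does not depend on which maximal invariant is chosen.
\<close>
definition statistic_space :: "'x measure \<Rightarrow> ('x \<Rightarrow> 't) \<Rightarrow> 't measure" where
  "statistic_space M T =
     sigma (T ` space M) {B. B \<subseteq> T ` space M \<and> T -` B \<inter> space M \<in> sets M}"

definition image_law :: "'x measure \<Rightarrow> ('x \<Rightarrow> 't) \<Rightarrow> 't measure" where
  "image_law M T = distr M (statistic_space M T) T"

definition likelihood_ratio :: "'x measure \<Rightarrow> 'x measure \<Rightarrow> ('x \<Rightarrow> 't) \<Rightarrow> 'x \<Rightarrow> real" where
  "likelihood_ratio M N T x = enn2real (RN_deriv (image_law M T) (image_law N T) (T x))"

section \<open>Rayleigh statistic\<close>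

definition sample_mean :: "nat \<Rightarrow> nat \<Rightarrow> (nat \<Rightarrow> nat \<Rightarrow> real) \<Rightarrow> (nat \<Rightarrow> real)" where
  "sample_mean n p x = (\<lambda>j\<in>{..<p}. (\<Sum>i=1..n. x i j) / real n)"

definition rayleigh :: "nat \<Rightarrow> nat \<Rightarrow> (nat \<Rightarrow> nat \<Rightarrow> real) \<Rightarrow> real" where
  "rayleigh n p x = real n * real p * (norm_vec p (sample_mean n p x))\<^sup>2"

definition rayleigh_std :: "nat \<Rightarrow> nat \<Rightarrow> (nat \<Rightarrow> nat \<Rightarrow> real) \<Rightarrow> real" where
  "rayleigh_std n p x = (rayleigh n p x - real p) / sqrt (2 * real p)"

definition Delta :: "nat \<Rightarrow> nat \<Rightarrow> (nat \<Rightarrow> nat \<Rightarrow> real) \<Rightarrow> real" where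
  "Delta n p x = rayleigh_std n p x / sqrt 2"

section \<open>Stochastic order\<close>

text \<open>\<open>Y n = o\<^sub>P(1)\<close> under the laws \<open>M n\<close>.\<close>
definition small_o_P :: "(nat \<Rightarrow> 'x measure) \<Rightarrow> (nat \<Rightarrow> 'x \<Rightarrow> real) \<Rightarrow> bool" where
  "small_o_P M Y \<longleftrightarrow>
     (\<forall>n. Y n \<in> borel_measurable (M n)) \<and>
     (\<forall>\<epsilon>>0. (\<lambda>n. measure (M n) {x \<in> space (M n). \<bar>Y n x\<bar> > \<epsilon>}) \<longlonglongrightarrow> 0)"

end

theory Submission
  imports Defs
begin

text \<open>
  The likelihood ratio of the maximal invariant is obtained by averaging the tilt over the
  direction \<open>\<theta>\<close>. Put \<open>\<rho> = \<parallel>\<Sum>X\<^sub>i\<parallel>\<^sup>2\<close> and \<open>G y = \<Sum>\<^sub>k y\<^sup>k / (k! \<Prod>\<^sub>j\<^sub><\<^sub>k (1 + 2j/p))\<close>,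
  so that \<open>\<integral> exp (u\<bullet>x)\<close> over the uniform law on the sphere is \<open>G (\<parallel>u\<parallel>\<^sup>2/(2p))\<close>. The ratio is then
  \<open>G (\<kappa>\<^sup>2\<rho>/(2p)) / G (\<kappa>\<^sup>2/(2p))\<^sup>n\<close>. From \<open>G = G' + (2/p) y G''\<close> one gets
  \<open>ln (G y) = y - y\<^sup>2/p + O((y\<^sup>2 + y\<^sup>3)/p\<^sup>2)\<close>. For the given \<open>\<kappa>\<close> the linear terms add up to
  \<open>\<tau>\<^sup>2\<Delta>\<close>, the quadratic ones to \<open>-\<tau>\<^sup>4/4\<close> because \<open>\<rho>/n\<close> concentrates at 1, and the rest vanishes.

  For the normal limit, conditionally on \<open>X\<^sub>1,\<dots>,X\<^sub>m\<close> the increment of \<open>\<rho>\<close> has mean 1, a law symmetric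
  about it and variance \<open>4\<rho>/p\<close>, and \<open>\<rho>\<close> is close to \<open>m\<close> in mean. Replacing the conditional
  characteristic functions by deterministic Gaussian factors one at a time costs a total error
  \<open>O(1/n + 1/\<surd>p)\<close>.
\<close>

text \<open>The scaling decides how far \<open>ln G\<close> must be expanded. With
  \<open>\<kappa>^2 = \<tau>^2 * p^(3/2) / n\<close> the argument
  \<open>\<kappa>^2 * \<rho> / (2 * p)\<close> is of order \<open>\<tau>^2 * sqrt p\<close>: its
  square over \<open>p\<close> stays bounded, its cube over \<open>p^2\<close> is
  \<open>O(1 / sqrt p)\<close>. The first power diverges and is controlled only after subtracting
  the \<open>n\<close> copies of \<open>\<kappa>^2 / (2 * p)\<close>, so its coefficient must be
  exact. Two-sided bounds explicit in \<open>n\<close> and \<open>p\<close> are used throughout;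
  hence no relation between the two rates of growth enters.

  A maximal invariant is an arbitrary function, so its range carries the largest sigma-algebra that
  makes it measurable. Preimages of its sets are rotation invariant, which is what averaging over
  \<open>\<theta>\<close> requires.

  The variance 1/2 comes from a sum: the increment of \<open>\<rho>\<close> at size \<open>m\<close>
  has conditional variance close to \<open>4 * m / p\<close>, these add up to about
  \<open>2 * n^2 / p\<close>, and \<open>Delta\<close> is the centred \<open>\<rho>\<close> times
  \<open>sqrt p / (2 * n)\<close>.\<close>

section \<open>Logarithm of the normalising function\<close>

text \<open>Taylor coefficients of the \<open>m\<close>-th derivative of \<open>bessel p 0\<close>, which is the hypergeometric
  function \<open>\<^sub>0F\<^sub>1(; p/2; p y/2)\<close>.\<close>
definition bessel_coeff :: "nat \<Rightarrow> nat \<Rightarrow> nat \<Rightarrow> real" where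
  "bessel_coeff p m k = 1 / (fact k * (\<Prod>j<k+m. 1 + 2 * real j / real p))"

definition bessel :: "nat \<Rightarrow> nat \<Rightarrow> real \<Rightarrow> real" where
  "bessel p m y = (\<Sum>k. bessel_coeff p m k * y ^ k)"

lemma bessel_prod_ge_1: "(\<Prod>j<k. 1 + 2 * real j / real p) \<ge> 1"
  by (rule prod_ge_1) simp

lemma bessel_coeff_pos: "bessel_coeff p m k > 0"
  using bessel_prod_ge_1[of p "k + m"] by (simp add: bessel_coeff_def zero_less_mult_iff)

lemma bessel_coeff_le: "bessel_coeff p m k \<le> 1 / fact k"
  unfolding bessel_coeff_def using bessel_prod_ge_1[of p "k + m"]
  by (intro divide_left_mono) (auto simp: mult_le_cancel_left1)

text \<open>The factor is the last one, \<open>j = k + m\<close>, of the longer product. Being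
  affine in \<open>k\<close>, it turns into a differential equation once the series is
  summed.\<close>

lemma bessel_coeff_Suc: "bessel_coeff p m k = (1 + 2 * real (k + m) / real p) * bessel_coeff p (Suc m) k"
proof -
  have "1 + 2 * real (k + m) / real p \<noteq> 0"
    using divide_nonneg_nonneg[of "2 * real (k + m)" "real p"] by linarith
  thus ?thesis by (simp add: bessel_coeff_def)
qed

lemma bessel_coeff_antimono: "bessel_coeff p (Suc m) k \<le> bessel_coeff p m k"
  unfolding bessel_coeff_Suc[of p m] using bessel_coeff_pos[of p "Suc m" k]
  by (simp add: mult_le_cancel_right1)

lemma diffs_bessel_coeff: "diffs (bessel_coeff p m) = bessel_coeff p (Suc m)"
  by (auto simp: diffs_def bessel_coeff_def fun_eq_iff)

lemma summable_bessel: "summable (\<lambda>k. bessel_coeff p m k * y ^ k)"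
proof (rule summable_comparison_test)
  show "summable (\<lambda>k. inverse (fact k) * \<bar>y\<bar> ^ k)"
    by (rule summable_exp)
  have "norm (bessel_coeff p m k * y ^ k) \<le> inverse (fact k) * \<bar>y\<bar> ^ k" for k
    using bessel_coeff_pos[of p m k] mult_right_mono[OF bessel_coeff_le[of p m k], of "\<bar>y\<bar> ^ k"]
    by (simp add: abs_mult power_abs inverse_eq_divide)
  thus "\<exists>N. \<forall>n\<ge>N. norm (bessel_coeff p m n * y ^ n) \<le> inverse (fact n) * \<bar>y\<bar> ^ n"
    by blast
qed

lemma DERIV_bessel: "(bessel p m has_real_derivative bessel p (Suc m) y) (at y)"
  unfolding bessel_def diffs_bessel_coeff[symmetric]
  by (rule termdiffs_strong_converges_everywhere) (rule summable_bessel)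

lemma bessel_at_0: "bessel p 0 0 = 1"
  unfolding bessel_def powser_zero by (simp add: bessel_coeff_def)

lemma bessel_antimono: "y \<ge> 0 \<Longrightarrow> bessel p (Suc m) y \<le> bessel p m y"
  unfolding bessel_def
  by (intro suminf_le summable_bessel mult_right_mono bessel_coeff_antimono) auto

lemma bessel_pos: "y \<ge> 0 \<Longrightarrow> bessel p m y > 0"
proof -
  assume y: "y \<ge> 0"
  have "bessel_coeff p m 0 = (\<Sum>k<1. bessel_coeff p m k * y ^ k)" by simp
  also have "\<dots> \<le> bessel p m y"
    unfolding bessel_def using y less_imp_le[OF bessel_coeff_pos]
    by (intro sum_le_suminf summable_bessel) (auto intro!: mult_nonneg_nonneg)
  finally show ?thesis using bessel_coeff_pos[of p m 0] by linarith
qed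

text \<open>Sum \<open>bessel_coeff_Suc\<close> against \<open>y ^ k\<close>: the part
  \<open>2 * k / p\<close> of the factor produces \<open>y\<close> times the next derivative. The
  cases \<open>m = 0\<close> and \<open>m = 1\<close> are the ones needed.\<close>

lemma bessel_ode:
  "bessel p m y = (1 + 2 * real m / real p) * bessel p (Suc m) y + 2 / real p * y * bessel p (Suc (Suc m)) y"
proof -
  let ?c = "bessel_coeff p (Suc m)"
  have "(\<lambda>k. bessel_coeff p (Suc (Suc m)) k * y ^ k * y) sums (bessel p (Suc (Suc m)) y * y)"
    unfolding bessel_def by (intro sums_mult2 summable_sums summable_bessel)
  also have "(\<lambda>k. bessel_coeff p (Suc (Suc m)) k * y ^ k * y) = (\<lambda>k. real (Suc k) * ?c (Suc k) * y ^ Suc k)"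
    by (auto simp: diffs_bessel_coeff[symmetric] diffs_def)
  \<comment> \<open>The shifted series may start at index 0 because its term \<open>k = 0\<close>
    vanishes.\<close>
  finally have s2: "(\<lambda>k. real k * ?c k * y ^ k) sums (bessel p (Suc (Suc m)) y * y)"
    by (subst (asm) sums_Suc_iff) simp
  have s1: "(\<lambda>k. ?c k * y ^ k) sums bessel p (Suc m) y"
    unfolding bessel_def by (intro summable_sums summable_bessel)
  have "(\<lambda>k. bessel_coeff p m k * y ^ k) =
      (\<lambda>k. (1 + 2 * real m / real p) * (?c k * y ^ k) + 2 / real p * (real k * ?c k * y ^ k))"
    by (auto simp: fun_eq_iff bessel_coeff_Suc[of p m] algebra_simps add_divide_distrib)
  also have "\<dots> sums ((1 + 2 * real m / real p) * bessel p (Suc m) y + 2 / real p * (bessel p (Suc (Suc m)) y * y))"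
    by (intro sums_add sums_mult s1 s2)
  finally show ?thesis
    unfolding bessel_def[of p m] by (simp add: sums_iff mult_ac)
qed

text \<open>Write \<open>G\<close> for \<open>bessel p 0\<close> and \<open>q = 2 / p\<close>. The
  equation reads \<open>G' = G - q y G''\<close>, and \<open>G'' \<le> G\<close> gives the lower
  bound. For the upper bound, \<open>G - G''\<close> is itself small: the equations for
  \<open>m = 0\<close> and \<open>m = 1\<close> together bound it by \<open>q (1 + 2 y) G\<close>,
  and feeding this back gains a second factor \<open>q\<close>.\<close>

lemma bessel_log_derivative_bounds:
  assumes y: "y \<ge> 0"
  shows "1 - 2 / real p * y \<le> bessel p 1 y / bessel p 0 y"
    and "bessel p 1 y / bessel p 0 y \<le> 1 - 2 / real p * y + 4 / (real p)\<^sup>2 * (y + 2 * y\<^sup>2)"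
proof -
  let ?g = "\<lambda>m. bessel p m y"
  define q where "q = 2 / real p"
  have q: "q \<ge> 0" by (simp add: q_def)
  have ode0: "?g 1 = ?g 0 - q * y * ?g 2"
    using bessel_ode[of p 0 y] by (simp add: q_def numeral_2_eq_2)
  have ode1: "?g 1 = ?g 2 + q * (?g 2 + y * ?g 3)"
    using bessel_ode[of p 1 y] by (simp add: q_def numeral_2_eq_2 numeral_3_eq_3 algebra_simps)
  have g20: "?g 2 \<le> ?g 0" and g30: "?g 3 \<le> ?g 0"
    using bessel_antimono[OF y, of p 0] bessel_antimono[OF y, of p 1] bessel_antimono[OF y, of p 2]
    by (simp_all add: numeral_2_eq_2 numeral_3_eq_3)
  have pos: "?g 0 > 0" by (rule bessel_pos[OF y])
  have "?g 1 \<ge> (1 - q * y) * ?g 0"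
    unfolding ode0 using mult_left_mono[OF g20, of "q * y"] q y by (simp add: algebra_simps)
  thus "1 - 2 / real p * y \<le> ?g 1 / ?g 0"
    using pos by (simp add: q_def[symmetric] pos_le_divide_eq)
  have "?g 0 - ?g 2 \<le> q * y * ?g 0 + q * (?g 0 + y * ?g 0)"
  proof -
    have "?g 0 - ?g 2 = q * y * ?g 2 + q * (?g 2 + y * ?g 3)" using ode0 ode1 by linarith
    also have "\<dots> \<le> q * y * ?g 0 + q * (?g 0 + y * ?g 0)"
      using q y g20 g30 by (intro add_mono mult_left_mono) auto
    finally show ?thesis .
  qed
  hence "q * y * (?g 0 - ?g 2) \<le> q * y * (q * y * ?g 0 + q * (?g 0 + y * ?g 0))"
    using q y by (intro mult_left_mono) auto
  hence "?g 1 \<le> (1 - q * y + q\<^sup>2 * (y + 2 * y\<^sup>2)) * ?g 0"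
    unfolding ode0 by (simp add: algebra_simps power2_eq_square)
  moreover have "q\<^sup>2 = 4 / (real p)\<^sup>2" by (simp add: q_def power_divide)
  ultimately show "?g 1 / ?g 0 \<le> 1 - 2 / real p * y + 4 / (real p)\<^sup>2 * (y + 2 * y\<^sup>2)"
    using pos by (simp add: q_def[symmetric] pos_divide_le_eq)
qed

lemma DERIV_ln_bessel:
  "y \<ge> 0 \<Longrightarrow> ((\<lambda>y. ln (bessel p 0 y)) has_real_derivative bessel p 1 y / bessel p 0 y) (at y)"
  using DERIV_chain2[OF DERIV_ln_divide[OF bessel_pos] DERIV_bessel[of p 0]] by simp

text \<open>Integrates the lower bound for the logarithmic derivative from 0, where
  \<open>ln (bessel p 0 0) = 0\<close>. The integration is phrased as monotonicity of the difference
  \<open>F\<close>.\<close>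

lemma ln_bessel_lower:
  assumes y: "y \<ge> 0" and p: "p > 0"
  shows "y - y\<^sup>2 / real p \<le> ln (bessel p 0 y)"
proof -
  define F where "F x = ln (bessel p 0 x) - (x - x\<^sup>2 / real p)" for x
  have "F 0 \<le> F y"
  proof (rule DERIV_nonneg_imp_nondecreasing[OF y])
    fix x assume x: "0 \<le> x" "x \<le> y"
    have "((\<lambda>x. x - x\<^sup>2 / real p) has_real_derivative (1 - 2 / real p * x)) (at x)"
      using p by (auto intro!: derivative_eq_intros simp: power2_eq_square field_simps)
    from DERIV_diff[OF DERIV_ln_bessel[OF x(1)] this]
    have "(F has_real_derivative (bessel p 1 x / bessel p 0 x - (1 - 2 / real p * x))) (at x)"
      unfolding F_def by simp
    thus "\<exists>d. (F has_real_derivative d) (at x) \<and> 0 \<le> d"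
      using bessel_log_derivative_bounds(1)[OF x(1), of p] by (intro exI conjI) auto
  qed
  thus ?thesis by (simp add: F_def bessel_at_0)
qed

lemma ln_bessel_upper:
  assumes y: "y \<ge> 0" and p: "p > 0"
  shows "ln (bessel p 0 y) \<le> y - y\<^sup>2 / real p + (2 * y\<^sup>2 + 3 * y ^ 3) / (real p)\<^sup>2"
proof -
  define F where "F x = (x - x\<^sup>2 / real p + 4 / (real p)\<^sup>2 * (x\<^sup>2 / 2 + 2 * x ^ 3 / 3)) - ln (bessel p 0 x)" for x
  have "F 0 \<le> F y"
  proof (rule DERIV_nonneg_imp_nondecreasing[OF y])
    fix x assume x: "0 \<le> x" "x \<le> y"
    have "((\<lambda>x. x - x\<^sup>2 / real p + 4 / (real p)\<^sup>2 * (x\<^sup>2 / 2 + 2 * x ^ 3 / 3))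
        has_real_derivative (1 - 2 / real p * x + 4 / (real p)\<^sup>2 * (x + 2 * x\<^sup>2))) (at x)"
      using p by (auto intro!: derivative_eq_intros simp: power2_eq_square field_simps)
    from DERIV_diff[OF this DERIV_ln_bessel[OF x(1)]]
    have "(F has_real_derivative ((1 - 2 / real p * x + 4 / (real p)\<^sup>2 * (x + 2 * x\<^sup>2)) - bessel p 1 x / bessel p 0 x)) (at x)"
      unfolding F_def by simp
    thus "\<exists>d. (F has_real_derivative d) (at x) \<and> 0 \<le> d"
      using bessel_log_derivative_bounds(2)[OF x(1), of p] by (intro exI conjI) auto
  qed
  hence "ln (bessel p 0 y) \<le> y - y\<^sup>2 / real p + 4 / (real p)\<^sup>2 * (y\<^sup>2 / 2 + 2 * y ^ 3 / 3)"
    by (simp add: F_def bessel_at_0)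
  \<comment> \<open>The exact coefficient \<open>8 / 3\<close> of the cubic term is rounded up to
    3.\<close>
  also have "4 / (real p)\<^sup>2 * (y\<^sup>2 / 2 + 2 * y ^ 3 / 3) \<le> (2 * y\<^sup>2 + 3 * y ^ 3) / (real p)\<^sup>2"
  proof -
    have "4 * (y\<^sup>2 / 2 + 2 * y ^ 3 / 3) \<le> 2 * y\<^sup>2 + 3 * y ^ 3" using y by simp
    thus ?thesis by (simp add: divide_right_mono)
  qed
  finally show ?thesis by simp
qed

section \<open>Rotations preserving Lebesgue measure\<close>

interpretation lborel_product: product_sigma_finite "\<lambda>_::nat. lborel :: real measure"
  by standard

lemma sets_euclid [measurable_cong]: "sets (euclid p) = sets (\<Pi>\<^sub>M j\<in>{..<p}. (borel :: real measure))"
  unfolding euclid_def by (intro sets_PiM_cong) auto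

lemma space_euclid: "space (euclid p) = {..<p} \<rightarrow>\<^sub>E UNIV"
  unfolding euclid_def by (simp add: space_PiM)

lemma measurable_rotate_vec [measurable]: "rotate_vec p A \<in> euclid p \<rightarrow>\<^sub>M euclid p"
  unfolding rotate_vec_def by measurable

lemma rotate_vec_extensional: "rotate_vec p A x \<in> {..<p} \<rightarrow>\<^sub>E UNIV"
  unfolding rotate_vec_def by auto

lemma addrow_mat_carrier [simp]: "addrow_mat p a k l \<in> carrier_mat p p"
  by (simp add: addrow_mat_def)

lemmas mult_carrier_square [simp] = mult_carrier_mat[of _ n n _ n for n]

section \<open>Shears and Lebesgue measure\<close>

lemma rotate_vec_addrow_mat:
  assumes "x \<in> {..<p} \<rightarrow>\<^sub>E UNIV" "k < p" "l < p" "k \<noteq> l"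
  shows "rotate_vec p (addrow_mat p a k l) x = x(k := x k + a * x l)"
proof
  fix i
  have *: "(if k = i \<and> l = j then (+) a else id) (if i = j then 1 else 0) * x j
      = (if j = i then x j else 0) + (if j = l then (if i = k then a * x j else 0) else 0)" for j
    using assms(4) by auto
  show "rotate_vec p (addrow_mat p a k l) x i = (x(k := x k + a * x l)) i"
    using assms PiE_arb[OF assms(1), of i] by (cases "i < p") (auto simp: rotate_vec_def addrow_mat_def * sum.distrib)
qed

text \<open>Fubini with coordinate \<open>k\<close> innermost: since \<open>l \<noteq> k\<close>,
  the added amount \<open>a * x l\<close> is constant in the inner integral.\<close>

lemma nn_integral_rotate_addrow_mat:
  assumes [measurable]: "f \<in> borel_measurable (euclid p)" and "k < p" "l < p" "k \<noteq> l"
  shows "(\<integral>\<^sup>+x. f (rotate_vec p (addrow_mat p a k l) x) \<partial>euclid p) = (\<integral>\<^sup>+x. f x \<partial>euclid p)"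
proof -
  define I where "I = {..<p} - {k}"
  have I: "finite I" "k \<notin> I" "insert k I = {..<p}" and lI: "l \<in> I"
    using assms by (auto simp: I_def)
  have e: "euclid p = Pi\<^sub>M (insert k I) (\<lambda>_. lborel)"
    unfolding I euclid_def ..
  have fm: "g \<in> borel_measurable (Pi\<^sub>M (insert k I) (\<lambda>_. lborel))" if "g \<in> borel_measurable (euclid p)" for g :: "_ \<Rightarrow> ennreal"
    using that by (simp add: e)
  have "(\<integral>\<^sup>+x. f (rotate_vec p (addrow_mat p a k l) x) \<partial>euclid p)
      = (\<integral>\<^sup>+x. \<integral>\<^sup>+y. f (rotate_vec p (addrow_mat p a k l) (x(k := y))) \<partial>lborel \<partial>Pi\<^sub>M I (\<lambda>_. lborel))"
    unfolding e by (rule lborel_product.product_nn_integral_insert[OF I(1,2)], rule fm) measurable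
  also have "\<dots> = (\<integral>\<^sup>+x. \<integral>\<^sup>+y. f (x(k := y)) \<partial>lborel \<partial>Pi\<^sub>M I (\<lambda>_. lborel))"
  proof (rule nn_integral_cong)
    fix x assume x: "x \<in> space (Pi\<^sub>M I (\<lambda>_. lborel :: real measure))"
    have xy: "x(k := y) \<in> {..<p} \<rightarrow>\<^sub>E UNIV" for y
      using x unfolding I(3)[symmetric] by (auto simp: space_PiM PiE_def extensional_def)
    have "(\<lambda>y. x(k := y)) \<in> lborel \<rightarrow>\<^sub>M Pi\<^sub>M (insert k I) (\<lambda>_. lborel)"
      using x I by (intro measurable_fun_upd[where J = I]) auto
    hence [measurable]: "(\<lambda>y. f (x(k := y))) \<in> borel_measurable borel"
      using assms(1) unfolding e by measurable
    have "rotate_vec p (addrow_mat p a k l) (x(k := y)) = x(k := a * x l + 1 * y)" for y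
      using assms by (subst rotate_vec_addrow_mat[OF xy]) auto
    thus "(\<integral>\<^sup>+y. f (rotate_vec p (addrow_mat p a k l) (x(k := y))) \<partial>lborel) = (\<integral>\<^sup>+y. f (x(k := y)) \<partial>lborel)"
      by (subst nn_integral_real_affine[of "\<lambda>y. f (x(k := y))" 1 "a * x l"]) auto
  qed
  also have "\<dots> = (\<integral>\<^sup>+x. f x \<partial>euclid p)"
    unfolding e by (rule lborel_product.product_nn_integral_insert[OF I(1,2), symmetric], rule fm) measurable
  finally show ?thesis .
qed

section \<open>The linear action of matrices and the group \<open>SO p\<close>\<close>

lemma rotate_vec_mult:
  assumes "A \<in> carrier_mat p p" "B \<in> carrier_mat p p"
  shows "rotate_vec p (A * B) x = rotate_vec p A (rotate_vec p B x)"
proof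
  fix i
  show "rotate_vec p (A * B) x i = rotate_vec p A (rotate_vec p B x) i"
  proof (cases "i < p")
    case True
    have "(\<Sum>j<p. (A * B) $$ (i, j) * x j) = (\<Sum>j<p. \<Sum>k<p. A $$ (i, k) * B $$ (k, j) * x j)"
      using assms True
      by (intro sum.cong refl) (auto simp: scalar_prod_def sum_distrib_right atLeast0LessThan)
    also have "\<dots> = (\<Sum>k<p. \<Sum>j<p. A $$ (i, k) * B $$ (k, j) * x j)"
      by (rule sum.swap)
    finally show ?thesis
      using True by (simp add: rotate_vec_def sum_distrib_left mult.assoc)
  qed (simp add: rotate_vec_def)
qed

lemma rotate_vec_one: "rotate_vec p (1\<^sub>m p) x = restrict x {..<p}"
proof
  fix i
  have "(if i = j then 1 else 0) * x j = (if j = i then x j else 0)" for j by auto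
  thus "rotate_vec p (1\<^sub>m p) x i = restrict x {..<p} i"
    by (auto simp: rotate_vec_def)
qed

text \<open>Test on the unit vectors. Matrix identities below are thereby reduced to following a
  vector through coordinate updates instead of computing entries of products.\<close>

lemma mat_eqI_rotate_vec:
  assumes "A \<in> carrier_mat p p" "B \<in> carrier_mat p p"
    and "\<And>x. x \<in> {..<p} \<rightarrow>\<^sub>E UNIV \<Longrightarrow> rotate_vec p A x = rotate_vec p B x"
  shows "A = B"
proof (rule eq_matI)
  fix i j assume "i < dim_row B" "j < dim_col B"
  hence ij: "i < p" "j < p" using assms by auto
  have *: "C $$ (i, k) * (if k = j then 1 else 0) = (if k = j then C $$ (i, k) else 0)" for C :: "real mat" and k
    by auto
  have "rotate_vec p A (\<lambda>k\<in>{..<p}. if k = j then 1 else 0) i = rotate_vec p B (\<lambda>k\<in>{..<p}. if k = j then 1 else 0) i"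
    by (rule fun_cong[OF assms(3)]) auto
  thus "A $$ (i, j) = B $$ (i, j)"
    using ij by (simp add: rotate_vec_def *)
qed (use assms in auto)

lemma inner_prod_rotate_transpose:
  assumes "A \<in> carrier_mat p p"
  shows "inner_prod p (rotate_vec p A x) y = inner_prod p x (rotate_vec p (transpose_mat A) y)"
proof -
  have "inner_prod p (rotate_vec p A x) y = (\<Sum>i<p. \<Sum>j<p. A $$ (i, j) * x j * y i)"
    by (simp add: inner_prod_def rotate_vec_def sum_distrib_right)
  also have "\<dots> = (\<Sum>j<p. \<Sum>i<p. A $$ (i, j) * x j * y i)"
    by (rule sum.swap)
  also have "\<dots> = inner_prod p x (rotate_vec p (transpose_mat A) y)"
    using assms by (simp add: inner_prod_def rotate_vec_def sum_distrib_left mult_ac)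
  finally show ?thesis .
qed

lemma inner_prod_restrict [simp]:
  "inner_prod p x (restrict y {..<p}) = inner_prod p x y"
  "inner_prod p (restrict x {..<p}) y = inner_prod p x y"
  by (simp_all add: inner_prod_def)

lemma SO_D:
  assumes "A \<in> SO p"
  shows "A \<in> carrier_mat p p" "A * transpose_mat A = 1\<^sub>m p" "transpose_mat A * A = 1\<^sub>m p" "Determinant.det A = 1"
  using assms mat_mult_left_right_inverse[of A p "transpose_mat A"] by (auto simp: SO_def)

lemma SO_mult: "A \<in> SO p \<Longrightarrow> B \<in> SO p \<Longrightarrow> A * B \<in> SO p"
proof -
  assume AB: "A \<in> SO p" "B \<in> SO p"
  note [simp] = SO_D(1)[OF AB(1)] SO_D(1)[OF AB(2)]
  have "A * B * transpose_mat (A * B) = A * B * (transpose_mat B * transpose_mat A)"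
    by (simp add: transpose_mult[of A p p B p])
  also have "\<dots> = A * (B * transpose_mat B) * transpose_mat A"
  proof -
    have t: "transpose_mat A \<in> carrier_mat p p" "transpose_mat B \<in> carrier_mat p p"
      "B * transpose_mat B \<in> carrier_mat p p"
      by (auto intro!: mult_carrier_mat[of _ _ p])
    have "A * B * (transpose_mat B * transpose_mat A) = A * (B * (transpose_mat B * transpose_mat A))"
      using t by (intro assoc_mult_mat[of A p p B p _ p]) auto
    also have "B * (transpose_mat B * transpose_mat A) = B * transpose_mat B * transpose_mat A"
      using t by (intro assoc_mult_mat[of B p p _ p _ p, symmetric]) auto
    also have "A * (B * transpose_mat B * transpose_mat A) = A * (B * transpose_mat B) * transpose_mat A"
      using t by (intro assoc_mult_mat[of A p p _ p _ p, symmetric]) auto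
    finally show ?thesis .
  qed
  also have "\<dots> = 1\<^sub>m p"
    using AB by (simp add: SO_D(2) right_mult_one_mat[of A p p])
  finally show ?thesis
    using AB by (auto simp: SO_def det_mult[of A p B])
qed

lemma SO_transpose: "A \<in> SO p \<Longrightarrow> transpose_mat A \<in> SO p"
  by (frule SO_D(3), frule SO_D(1)) (simp add: SO_def det_transpose)

lemma inner_prod_rotate:
  assumes "A \<in> SO p"
  shows "inner_prod p (rotate_vec p A x) (rotate_vec p A y) = inner_prod p x y"
  using SO_D[OF assms]
  by (simp add: inner_prod_rotate_transpose rotate_vec_mult[symmetric] rotate_vec_one)


text \<open>A rotation of the plane of coordinates 0 and \<open>j\<close> as soon as
  \<open>c^2 + s^2 = 1\<close>, which is imposed only where used. Coordinate 0 always takes part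
  because vectors are going to be rotated onto that axis.\<close>

definition givens :: "nat \<Rightarrow> nat \<Rightarrow> real \<Rightarrow> real \<Rightarrow> real mat" where
  "givens p j c s = mat p p (\<lambda>(r, q).
     if r = q then (if r = 0 \<or> r = j then c else 1)
     else if r = 0 \<and> q = j then s else if r = j \<and> q = 0 then - s else 0)"

lemma givens_carrier [simp]: "givens p j c s \<in> carrier_mat p p"
  by (simp add: givens_def)

lemma transpose_givens: "j < p \<Longrightarrow> 0 < j \<Longrightarrow> transpose_mat (givens p j c s) = givens p j c (- s)"
  by (rule eq_matI) (auto simp: givens_def)

lemma rotate_vec_givens:
  assumes "x \<in> {..<p} \<rightarrow>\<^sub>E UNIV" "0 < j" "j < p"
  shows "rotate_vec p (givens p j c s) x = x(0 := c * x 0 + s * x j, j := c * x j - s * x 0)"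
proof
  fix i
  define y :: "nat \<Rightarrow> real" where "y q = (if q = i then (if i = 0 \<or> i = j then c else 1) * x q else 0)" for q
  define z :: "nat \<Rightarrow> real" where "z q = (if q = j then (if i = 0 then s * x j else 0) else 0)" for q
  define w :: "nat \<Rightarrow> real" where "w q = (if q = 0 then (if i = j then - s * x 0 else 0) else 0)" for q
  have *: "(if i = q then (if i = 0 \<or> i = j then c else 1)
     else if i = 0 \<and> q = j then s else if i = j \<and> q = 0 then - s else 0) * x q = y q + z q + w q" for q
    using assms(2) by (auto simp: y_def z_def w_def)
  have sums: "i < p \<Longrightarrow> sum y {..<p} = (if i = 0 \<or> i = j then c else 1) * x i"
    "sum z {..<p} = (if i = 0 then s * x j else 0)" "sum w {..<p} = (if i = j then - s * x 0 else 0)"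
    using assms(2,3) by (auto simp: y_def z_def w_def)
  show "rotate_vec p (givens p j c s) x i = (x(0 := c * x 0 + s * x j, j := c * x j - s * x 0)) i"
  proof (cases "i < p")
    case True
    hence "rotate_vec p (givens p j c s) x i = (\<Sum>q<p. y q + z q + w q)"
      unfolding *[symmetric] by (auto simp: rotate_vec_def givens_def intro!: sum.cong)
    also have "\<dots> = sum y {..<p} + sum z {..<p} + sum w {..<p}"
      by (simp add: sum.distrib)
    finally show ?thesis
      using assms(2) True by (auto simp: sums)
  next
    case False
    thus ?thesis using assms PiE_arb[OF assms(1), of i] by (auto simp: rotate_vec_def)
  qed
qed

text \<open>All of \<open>SO p\<close>, but the argument only needs the subgroup generated by plane rotations, which
  already acts transitively on the sphere.\<close>
definition lebesgue_rotations :: "nat \<Rightarrow> real mat set" where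
  "lebesgue_rotations p = {A \<in> SO p. \<forall>f \<in> borel_measurable (euclid p).
     (\<integral>\<^sup>+x. f (rotate_vec p A x) \<partial>euclid p) = (\<integral>\<^sup>+x. f x \<partial>euclid p)}"

lemma lebesgue_rotations_SO: "A \<in> lebesgue_rotations p \<Longrightarrow> A \<in> SO p"
  by (simp add: lebesgue_rotations_def)

lemma nn_integral_lebesgue_rotation:
  "A \<in> lebesgue_rotations p \<Longrightarrow> f \<in> borel_measurable (euclid p) \<Longrightarrow>
   (\<integral>\<^sup>+x. f (rotate_vec p A x) \<partial>euclid p) = (\<integral>\<^sup>+x. f x \<partial>euclid p)"
  by (simp add: lebesgue_rotations_def)

lemma lebesgue_rotations_mult:
  assumes "A \<in> lebesgue_rotations p" "B \<in> lebesgue_rotations p"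
  shows "A * B \<in> lebesgue_rotations p"
proof -
  note S = assms[THEN lebesgue_rotations_SO]
  have "(\<integral>\<^sup>+x. f (rotate_vec p (A * B) x) \<partial>euclid p) = (\<integral>\<^sup>+x. f x \<partial>euclid p)"
    if [measurable]: "f \<in> borel_measurable (euclid p)" for f
  proof -
    have "(\<integral>\<^sup>+x. f (rotate_vec p (A * B) x) \<partial>euclid p)
        = (\<integral>\<^sup>+x. (\<lambda>y. f (rotate_vec p A y)) (rotate_vec p B x) \<partial>euclid p)"
      using S by (simp add: rotate_vec_mult SO_D)
    also have "\<dots> = (\<integral>\<^sup>+x. f (rotate_vec p A x) \<partial>euclid p)"
      by (rule nn_integral_lebesgue_rotation[OF assms(2)]) measurable
    finally show ?thesis
      by (simp add: nn_integral_lebesgue_rotation[OF assms(1)])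
  qed
  thus ?thesis
    using SO_mult[OF S] by (simp add: lebesgue_rotations_def)
qed

lemma lebesgue_rotations_one: "1\<^sub>m p \<in> lebesgue_rotations p"
  by (auto simp: lebesgue_rotations_def SO_def rotate_vec_one space_euclid intro!: nn_integral_cong)

lemma lebesgue_rotations_transpose:
  assumes "A \<in> lebesgue_rotations p"
  shows "transpose_mat A \<in> lebesgue_rotations p"
proof -
  note S = assms[THEN lebesgue_rotations_SO]
  have "(\<integral>\<^sup>+x. f (rotate_vec p (transpose_mat A) x) \<partial>euclid p) = (\<integral>\<^sup>+x. f x \<partial>euclid p)"
    if [measurable]: "f \<in> borel_measurable (euclid p)" for f
  proof -
    have "(\<integral>\<^sup>+x. f (rotate_vec p (transpose_mat A) x) \<partial>euclid p)
        = (\<integral>\<^sup>+x. f (rotate_vec p (transpose_mat A) (rotate_vec p A x)) \<partial>euclid p)"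
      by (rule nn_integral_lebesgue_rotation[OF assms, symmetric]) measurable
    also have "\<dots> = (\<integral>\<^sup>+x. f x \<partial>euclid p)"
      using S by (intro nn_integral_cong) (auto simp: rotate_vec_mult[symmetric] SO_D rotate_vec_one space_euclid)
    finally show ?thesis .
  qed
  thus ?thesis
    using SO_transpose[OF S] by (simp add: lebesgue_rotations_def)
qed

text \<open>Shears preserve Lebesgue measure by translation invariance in a single coordinate; writing plane
  rotations as products of shears transfers this to rotations. The angle \<open>\<pi>\<close> is excluded here.\<close>
lemma givens_shears:
  assumes "c\<^sup>2 + s\<^sup>2 = 1" "c \<noteq> -1" "0 < j" "j < p" and t1: "t * (1 + c) = s"
  shows "givens p j c s = addrow_mat p t 0 j * (addrow_mat p (- s) j 0 * addrow_mat p t 0 j)"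
proof (rule mat_eqI_rotate_vec[of _ p])
  fix x :: "nat \<Rightarrow> real" assume x: "x \<in> {..<p} \<rightarrow>\<^sub>E UNIV"
  have c: "1 + c \<noteq> 0" using assms by auto
  \<comment> \<open>\<open>t\<close> is the tangent of half the angle, and \<open>t2\<close> is the
    identity \<open>1 - sin a * tan (a/2) = cos a\<close>, proved after multiplication by the
    nonzero \<open>1 + c\<close>.\<close>
  have t2: "1 - s * t = c"
  proof -
    have "(1 + c) * (1 - s * t) = (1 + c) - s * (t * (1 + c))" by (simp add: algebra_simps)
    also have "\<dots> = (1 + c) * c" unfolding t1 using assms(1) by (simp add: power2_eq_square algebra_simps)
    finally show ?thesis using c by simp
  qed
  define y where "y = x(0 := x 0 + t * x j)"
  define z where "z = y(j := y j - s * y 0)"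
  have y: "y \<in> {..<p} \<rightarrow>\<^sub>E UNIV" and z: "z \<in> {..<p} \<rightarrow>\<^sub>E UNIV"
    using x assms by (auto simp: y_def z_def PiE_def extensional_def)
  have "rotate_vec p (addrow_mat p t 0 j * (addrow_mat p (- s) j 0 * addrow_mat p t 0 j)) x
      = z(0 := z 0 + t * z j)"
    using assms(3,4) x y z by (simp add: rotate_vec_mult[of _ p]
      rotate_vec_addrow_mat y_def[symmetric] z_def[symmetric])
  also have "\<dots> = x(0 := c * x 0 + s * x j, j := c * x j - s * x 0)"
  proof -
    have zj: "z j = c * x j - s * x 0"
      using assms(3) unfolding z_def y_def t2[symmetric] by (simp add: algebra_simps)
    have "z 0 + t * z j = (1 - s * t) * x 0 + (t * (1 + c)) * x j"
      unfolding zj using assms(3) by (simp add: z_def y_def algebra_simps)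
    hence "z 0 + t * z j = c * x 0 + s * x j" unfolding t1 t2 .
    thus ?thesis using zj assms(3) by (auto simp: z_def y_def fun_eq_iff)
  qed
  finally show "rotate_vec p (givens p j c s) x
      = rotate_vec p (addrow_mat p t 0 j * (addrow_mat p (- s) j 0 * addrow_mat p t 0 j)) x"
    using assms x by (simp add: rotate_vec_givens)
qed auto

text \<open>The determinant appears as a premise because it is most easily read off from the
  factorisation into shears, each of determinant one. Orthogonality holds since the transpose is the
  plane rotation by the opposite angle.\<close>

lemma givens_SO:
  assumes "c\<^sup>2 + s\<^sup>2 = 1" "0 < j" "j < p" "Determinant.det (givens p j c s) = 1"
  shows "givens p j c s \<in> SO p"
proof -
  have "givens p j c s * transpose_mat (givens p j c s) = 1\<^sub>m p"
  proof (rule mat_eqI_rotate_vec[of _ p])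
    fix x :: "nat \<Rightarrow> real" assume x: "x \<in> {..<p} \<rightarrow>\<^sub>E UNIV"
    define y where "y = x(0 := c * x 0 - s * x j, j := c * x j + s * x 0)"
    have y: "y \<in> {..<p} \<rightarrow>\<^sub>E UNIV"
      using x assms by (auto simp: y_def PiE_def extensional_def)
    have y1: "rotate_vec p (givens p j c (- s)) x = y"
      using assms x by (subst rotate_vec_givens) (auto simp: y_def)
    have "c * y 0 + s * y j = (c\<^sup>2 + s\<^sup>2) * x 0" "c * y j - s * y 0 = (c\<^sup>2 + s\<^sup>2) * x j"
      using assms(2) by (auto simp: y_def power2_eq_square algebra_simps)
    thus "rotate_vec p (givens p j c s * transpose_mat (givens p j c s)) x = rotate_vec p (1\<^sub>m p) x"
      using assms x y by (auto simp: transpose_givens rotate_vec_mult[of _ p] y1 rotate_vec_givens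
          rotate_vec_one fun_eq_iff y_def PiE_restrict)
  qed auto
  thus ?thesis using assms by (auto simp: SO_def)
qed

lemma givens_lebesgue_rotation:
  assumes "c\<^sup>2 + s\<^sup>2 = 1" "0 < j" "j < p"
  shows "givens p j c s \<in> lebesgue_rotations p"
proof -
  have main: "givens p j c s \<in> lebesgue_rotations p" if c: "c\<^sup>2 + s\<^sup>2 = 1" "c \<noteq> -1" for c s
  proof -
    define t where "t = s / (1 + c)"
    have e: "givens p j c s = addrow_mat p t 0 j * (addrow_mat p (- s) j 0 * addrow_mat p t 0 j)"
      by (rule givens_shears) (use c assms in \<open>auto simp: t_def add_eq_0_iff\<close>)
    have "Determinant.det (givens p j c s) = 1"
      unfolding e using assms by (simp add: det_mult[of _ p] det_addrow_mat)
    hence SO: "givens p j c s \<in> SO p"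
      using givens_SO c assms by auto
    have "(\<integral>\<^sup>+x. f (rotate_vec p (givens p j c s) x) \<partial>euclid p) = (\<integral>\<^sup>+x. f x \<partial>euclid p)"
      if [measurable]: "f \<in> borel_measurable (euclid p)" for f
    proof -
      define g where "g x = f (rotate_vec p (addrow_mat p t 0 j) x)" for x
      define h where "h x = g (rotate_vec p (addrow_mat p (- s) j 0) x)" for x
      have g [measurable]: "g \<in> borel_measurable (euclid p)" unfolding g_def by measurable
      have h [measurable]: "h \<in> borel_measurable (euclid p)" unfolding h_def by measurable
      have "(\<integral>\<^sup>+x. f (rotate_vec p (givens p j c s) x) \<partial>euclid p)
          = (\<integral>\<^sup>+x. h (rotate_vec p (addrow_mat p t 0 j) x) \<partial>euclid p)"
        unfolding e h_def g_def by (simp add: rotate_vec_mult[of _ p])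
      also have "\<dots> = (\<integral>\<^sup>+x. h x \<partial>euclid p)"
        using assms by (intro nn_integral_rotate_addrow_mat h) auto
      also have "\<dots> = (\<integral>\<^sup>+x. g x \<partial>euclid p)"
        unfolding h_def using assms by (intro nn_integral_rotate_addrow_mat g) auto
      also have "\<dots> = (\<integral>\<^sup>+x. f x \<partial>euclid p)"
        unfolding g_def using assms by (intro nn_integral_rotate_addrow_mat that) auto
      finally show ?thesis .
    qed
    thus ?thesis using SO by (simp add: lebesgue_rotations_def)
  qed
  show ?thesis
  proof (cases "c = -1")
    case True
    hence s: "s = 0" using assms by (simp add: power2_eq_square)
    \<comment> \<open>At angle \<open>\<pi>\<close> the half-angle tangent is infinite. The half
      turn is the square of the quarter turn \<open>c = 0\<close>, \<open>s = 1\<close>, to which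
      \<open>main\<close> applies.\<close>
    have "givens p j c s = givens p j 0 1 * givens p j 0 1"
    proof (rule mat_eqI_rotate_vec[of _ p])
      fix x :: "nat \<Rightarrow> real" assume x: "x \<in> {..<p} \<rightarrow>\<^sub>E UNIV"
      have y: "x(0 := x j, j := - x 0) \<in> {..<p} \<rightarrow>\<^sub>E UNIV"
        using x assms by (auto simp: PiE_def extensional_def)
      show "rotate_vec p (givens p j c s) x = rotate_vec p (givens p j 0 1 * givens p j 0 1) x"
        using assms x y True s by (auto simp: rotate_vec_mult[of _ p] rotate_vec_givens fun_eq_iff)
    qed auto
    thus ?thesis using main[of 0 1] lebesgue_rotations_mult by auto
  qed (use main assms in auto)
qed

text \<open>Coordinates are cleared one at a time: a rotation of the plane of 0 and
  \<open>k + 1\<close> moves the content of coordinate \<open>k + 1\<close> into coordinate 0 and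
  leaves the zeros already produced alone. Invariance of the norm then identifies the surviving
  coordinate up to sign, and its sign is part of the induction.\<close>

lemma exists_rotation_to_axis:
  assumes p: "p \<ge> 2" and x: "x \<in> {..<p} \<rightarrow>\<^sub>E UNIV"
  shows "\<exists>A \<in> lebesgue_rotations p. rotate_vec p A x = (\<lambda>i\<in>{..<p}. if i = 0 then sqrt (inner_prod p x x) else 0)"
proof -
  \<comment> \<open>The sign condition is void at \<open>k = 0\<close>, where the witness is the
    identity; \<open>p \<ge> 2\<close> makes the final index \<open>p - 1\<close> positive, so the
    condition is available at the end.\<close>
  have ind: "k < p \<Longrightarrow> \<exists>A \<in> lebesgue_rotations p.
      (\<forall>j. 0 < j \<and> j \<le> k \<longrightarrow> rotate_vec p A x j = 0) \<and> (0 < k \<longrightarrow> rotate_vec p A x 0 \<ge> 0)" for k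
  proof (induction k)
    case 0
    thus ?case by (intro bexI[OF _ lebesgue_rotations_one]) auto
  next
    case (Suc k)
    then obtain A where A: "A \<in> lebesgue_rotations p" "\<And>j. 0 < j \<Longrightarrow> j \<le> k \<Longrightarrow> rotate_vec p A x j = 0"
      by auto
    define y where "y = rotate_vec p A x"
    have y: "y \<in> {..<p} \<rightarrow>\<^sub>E UNIV" unfolding y_def by (rule rotate_vec_extensional)
    define r where "r = sqrt ((y 0)\<^sup>2 + (y (Suc k))\<^sup>2)"
    \<comment> \<open>When \<open>r = 0\<close> both coordinates already vanish, and
      \<open>c = 1\<close>, \<open>s = 0\<close> is the identity rotation.\<close>
    define c where "c = (if r = 0 then 1 else y 0 / r)"
    define s where "s = (if r = 0 then 0 else y (Suc k) / r)"
    have r2: "r\<^sup>2 = (y 0)\<^sup>2 + (y (Suc k))\<^sup>2" by (simp add: r_def)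
    have cs: "c\<^sup>2 + s\<^sup>2 = 1"
    proof (cases "r = 0")
      case False
      hence "c\<^sup>2 + s\<^sup>2 = ((y 0)\<^sup>2 + (y (Suc k))\<^sup>2) / r\<^sup>2" by (simp add: c_def s_def power_divide add_divide_distrib)
      thus ?thesis using False by (simp add: r2[symmetric])
    qed (simp add: c_def s_def)
    have z: "c * y (Suc k) - s * y 0 = 0"
    proof (cases "r = 0")
      case True
      hence "y (Suc k) = 0" using r2 by (simp add: sum_power2_eq_zero_iff)
      thus ?thesis using True by (simp add: c_def s_def)
    qed (simp add: c_def s_def)
    have pos: "c * y 0 + s * y (Suc k) \<ge> 0"
    proof (cases "r = 0")
      case True
      hence "y 0 = 0" using r2 by (simp add: sum_power2_eq_zero_iff)
      thus ?thesis using True by (simp add: c_def s_def)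
    next
      case False
      moreover have "r \<ge> 0" by (simp add: r_def)
      ultimately show ?thesis by (auto simp: c_def s_def intro!: divide_nonneg_nonneg add_nonneg_nonneg)
    qed
    define B where "B = givens p (Suc k) c s"
    have B: "B \<in> lebesgue_rotations p" unfolding B_def using cs Suc by (intro givens_lebesgue_rotation) auto
    have "rotate_vec p (B * A) x = y(0 := c * y 0 + s * y (Suc k), Suc k := c * y (Suc k) - s * y 0)"
      using Suc y SO_D(1)[OF lebesgue_rotations_SO[OF A(1)]]
      by (simp add: rotate_vec_mult[of _ p] B_def y_def[symmetric] rotate_vec_givens)
    moreover have "y j = 0" if "0 < j" "j \<le> k" for j
      using A(2)[OF that] by (simp add: y_def)
    ultimately show ?case
      using pos z by (intro bexI[OF _ lebesgue_rotations_mult[OF B A(1)]]) auto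
  qed
  obtain A where A: "A \<in> lebesgue_rotations p" "\<And>j. 0 < j \<Longrightarrow> j < p \<Longrightarrow> rotate_vec p A x j = 0" "rotate_vec p A x 0 \<ge> 0"
    using ind[of "p - 1"] p by (auto simp: less_eq_Suc_le)
  have "inner_prod p x x = inner_prod p (rotate_vec p A x) (rotate_vec p A x)"
    using inner_prod_rotate[OF lebesgue_rotations_SO[OF A(1)]] by simp
  also have "\<dots> = (\<Sum>j<p. if j = 0 then (rotate_vec p A x 0)\<^sup>2 else 0)"
    unfolding inner_prod_def using A(2) by (intro sum.cong) (auto simp: power2_eq_square)
  also have "\<dots> = (rotate_vec p A x 0)\<^sup>2" using p by simp
  finally have "rotate_vec p A x 0 = sqrt (inner_prod p x x)"
    using A(3) by simp
  thus ?thesis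
    using A(2) PiE_arb[OF rotate_vec_extensional, of _ p A x]
    by (intro bexI[OF _ A(1)]) (auto simp: fun_eq_iff)
qed

text \<open>Vectors of equal length are carried to the same point of the axis; one rotation followed
  by the inverse of the other connects them.\<close>

lemma exists_rotation:
  assumes "p \<ge> 2" "x \<in> {..<p} \<rightarrow>\<^sub>E UNIV" "y \<in> {..<p} \<rightarrow>\<^sub>E UNIV" "inner_prod p x x = inner_prod p y y"
  shows "\<exists>A \<in> lebesgue_rotations p. rotate_vec p A x = y"
proof -
  obtain A where A: "A \<in> lebesgue_rotations p" "rotate_vec p A x = (\<lambda>i\<in>{..<p}. if i = 0 then sqrt (inner_prod p x x) else 0)"
    using exists_rotation_to_axis assms by blast
  obtain B where B: "B \<in> lebesgue_rotations p" "rotate_vec p B y = (\<lambda>i\<in>{..<p}. if i = 0 then sqrt (inner_prod p y y) else 0)"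
    using exists_rotation_to_axis assms by blast
  note S = SO_D[OF lebesgue_rotations_SO[OF A(1)]] SO_D[OF lebesgue_rotations_SO[OF B(1)]]
  have "rotate_vec p (transpose_mat B * A) x = rotate_vec p (transpose_mat B) (rotate_vec p B y)"
    using S by (simp only: rotate_vec_mult[of _ p] transpose_carrier_mat A(2) B(2) assms(4))
  also have "\<dots> = rotate_vec p (transpose_mat B * B) y"
    by (rule rotate_vec_mult[symmetric]) (use S in auto)
  also have "\<dots> = y" using S assms(3) by (simp add: rotate_vec_one)
  finally show ?thesis
    using lebesgue_rotations_mult[OF lebesgue_rotations_transpose[OF B(1)] A(1)] by blast
qed

section \<open>The uniform law on the sphere\<close>

lemma norm_vec_eq: "norm_vec p x = sqrt (inner_prod p x x)"
  by (simp add: norm_vec_def L2_set_def inner_prod_def power2_eq_square)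

lemma inner_prod_self_nonneg: "inner_prod p x x \<ge> 0"
  by (simp add: inner_prod_def sum_nonneg)

lemma norm_vec_square: "(norm_vec p x)\<^sup>2 = inner_prod p x x"
  by (simp add: norm_vec_eq inner_prod_self_nonneg)

lemma inner_prod_commute: "inner_prod p x y = inner_prod p y x"
  by (simp add: inner_prod_def mult.commute)

lemma norm_vec_scale: "norm_vec p (\<lambda>j\<in>{..<p}. b * x j) = \<bar>b\<bar> * norm_vec p x"
proof -
  have "inner_prod p (\<lambda>j\<in>{..<p}. b * x j) (\<lambda>j\<in>{..<p}. b * x j) = b\<^sup>2 * inner_prod p x x"
    by (simp add: inner_prod_def sum_distrib_left power2_eq_square mult_ac)
  thus ?thesis by (simp add: norm_vec_eq real_sqrt_mult)
qed

lemma measurable_euclid_component: "j < p \<Longrightarrow> (\<lambda>x. x j) \<in> borel_measurable (euclid p)"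
  unfolding euclid_def by measurable

lemma measurable_inner_prod [measurable]: "(\<lambda>x. inner_prod p x y) \<in> borel_measurable (euclid p)"
  unfolding inner_prod_def by measurable

lemma measurable_norm_vec [measurable]: "norm_vec p \<in> borel_measurable (euclid p)"
  unfolding norm_vec_eq inner_prod_def by measurable

lemma sets_unit_sphere [measurable]: "unit_sphere p \<in> sets (euclid p)"
  unfolding unit_sphere_def by measurable

section \<open>Radial projection and integration over the cone\<close>

definition unit_dir :: "nat \<Rightarrow> (nat \<Rightarrow> real) \<Rightarrow> nat \<Rightarrow> real" where
  "unit_dir p x = (\<lambda>j\<in>{..<p}. x j / norm_vec p x)"

definition punctured_ball :: "nat \<Rightarrow> (nat \<Rightarrow> real) set" where
  "punctured_ball p = {x \<in> space (euclid p). 0 < norm_vec p x \<and> norm_vec p x \<le> 1}"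

lemma sets_punctured_ball [measurable]: "punctured_ball p \<in> sets (euclid p)"
  unfolding punctured_ball_def by measurable

lemma measurable_unit_dir [measurable]: "unit_dir p \<in> euclid p \<rightarrow>\<^sub>M euclid p"
  unfolding unit_dir_def by measurable

lemma unit_dir_scaled: "unit_dir p x = (\<lambda>j\<in>{..<p}. inverse (norm_vec p x) * x j)"
  by (simp add: unit_dir_def divide_inverse mult.commute)

lemma unit_dir_in_sphere: "0 < norm_vec p x \<Longrightarrow> unit_dir p x \<in> unit_sphere p"
  by (auto simp: unit_sphere_def unit_dir_scaled norm_vec_scale space_euclid)

lemma space_surface_measure [simp]: "space (surface_measure p) = unit_sphere p"
  using sets.sets_into_space[OF sets_unit_sphere, of p]
  by (simp add: surface_measure_def space_scale_measure space_restrict_space Int_absorb2)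

lemma sets_surface_measure [measurable_cong]:
  "sets (surface_measure p) = sets (restrict_space (euclid p) (unit_sphere p))"
  by (simp add: surface_measure_def)

lemma space_sphere_unif [simp]: "space (sphere_unif p) = unit_sphere p"
  by (simp add: sphere_unif_def)

lemma sets_sphere_unif [measurable_cong]:
  "sets (sphere_unif p) = sets (restrict_space (euclid p) (unit_sphere p))"
  by (simp add: sphere_unif_def sets_surface_measure)

lemma measurable_unit_dir_sphere:
  "unit_dir p \<in> restrict_space (euclid p) {x. 0 < norm_vec p x \<and> norm_vec p x \<le> 1}
     \<rightarrow>\<^sub>M restrict_space (euclid p) (unit_sphere p)"
  by (rule measurable_restrict_space3) (auto intro: unit_dir_in_sphere)

text \<open>A function known only on the sphere can be composed with \<open>unit_dir\<close> only
  away from the origin, where the quotient has length one; the indicator extends the composite by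
  zero.\<close>

lemma measurable_comp_unit_dir:
  assumes "f \<in> borel_measurable (restrict_space (euclid p) (unit_sphere p))"
    and "B \<in> sets (euclid p)" "\<And>x. x \<in> B \<Longrightarrow> 0 < norm_vec p x"
  shows "(\<lambda>x. f (unit_dir p x) * indicator B x :: ennreal) \<in> borel_measurable (euclid p)"
proof -
  have "unit_dir p \<in> restrict_space (euclid p) B \<rightarrow>\<^sub>M restrict_space (euclid p) (unit_sphere p)"
    using assms(3) by (intro measurable_restrict_space3) (auto intro: unit_dir_in_sphere)
  hence "(\<lambda>x. f (unit_dir p x)) \<in> borel_measurable (restrict_space (euclid p) B)"
    using assms(1) by (rule measurable_compose)
  thus ?thesis
    using assms(2) by (subst (asm) borel_measurable_restrict_space_iff_ennreal) auto
qed

lemma nn_integral_surface: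
  assumes f: "f \<in> borel_measurable (restrict_space (euclid p) (unit_sphere p))"
  shows "(\<integral>\<^sup>+x. f x \<partial>surface_measure p)
    = of_nat p * (\<integral>\<^sup>+x. f (unit_dir p x) * indicator (punctured_ball p) x \<partial>euclid p)"
proof -
  have "(\<integral>\<^sup>+x. f x \<partial>surface_measure p)
      = of_nat p * (\<integral>\<^sup>+x. f (unit_dir p x) \<partial>restrict_space (euclid p) {x. 0 < norm_vec p x \<and> norm_vec p x \<le> 1})"
    unfolding surface_measure_def unit_dir_def[symmetric] using f
    by (subst nn_integral_scale_measure) (auto simp: nn_integral_distr measurable_unit_dir_sphere)
  also have "(\<integral>\<^sup>+x. f (unit_dir p x) \<partial>restrict_space (euclid p) {x. 0 < norm_vec p x \<and> norm_vec p x \<le> 1})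
      = (\<integral>\<^sup>+x. f (unit_dir p x) * indicator (punctured_ball p) x \<partial>euclid p)"
  proof (subst nn_integral_restrict_space)
    have "{x. 0 < norm_vec p x \<and> norm_vec p x \<le> 1} \<inter> space (euclid p) = punctured_ball p"
      by (auto simp: punctured_ball_def)
    thus "{x. 0 < norm_vec p x \<and> norm_vec p x \<le> 1} \<inter> space (euclid p) \<in> sets (euclid p)"
      by simp
  qed (auto intro!: nn_integral_cong simp: punctured_ball_def indicator_def)
  finally show ?thesis .
qed

lemma component_le_norm_vec: "j < p \<Longrightarrow> \<bar>x j\<bar> \<le> norm_vec p x"
  unfolding norm_vec_def using member_le_L2_set[of "{..<p}" j "\<lambda>j. \<bar>x j\<bar>"] by (simp add: L2_set_def)

lemma emeasure_punctured_ball_finite: "emeasure (euclid p) (punctured_ball p) < \<infinity>"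
proof -
  have "punctured_ball p \<subseteq> (\<Pi>\<^sub>E j\<in>{..<p}. {-1..1})"
  proof
    fix x assume x: "x \<in> punctured_ball p"
    have "x j \<in> {-1..1}" if "j < p" for j
      using component_le_norm_vec[OF that, of x] x by (auto simp: punctured_ball_def)
    thus "x \<in> (\<Pi>\<^sub>E j\<in>{..<p}. {-1..1})"
      using x by (auto simp: punctured_ball_def space_euclid PiE_def)
  qed
  hence "emeasure (euclid p) (punctured_ball p) \<le> emeasure (euclid p) (\<Pi>\<^sub>E j\<in>{..<p}. {-1..1})"
    unfolding euclid_def by (intro emeasure_mono sets_PiM_I_finite) auto
  also have "\<dots> = 2 ^ p"
    unfolding euclid_def by (subst lborel_product.emeasure_PiM) auto
  also have "\<dots> < \<infinity>" by (simp add: power_less_top_ennreal)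
  finally show ?thesis .
qed

lemma emeasure_punctured_ball_pos:
  assumes "p > 0"
  shows "emeasure (euclid p) (punctured_ball p) > 0"
proof -
  \<comment> \<open>A box of positive volume inside the ball: coordinates of at most
    \<open>1 / p\<close> have sum at most 1, which dominates the norm, and positivity keeps the
    origin out.\<close>
  have "x \<in> punctured_ball p" if x: "x \<in> (\<Pi>\<^sub>E j\<in>{..<p}. {1 / (2 * real p)..1 / real p})" for x
  proof -
    have xj: "0 < x j" "x j \<le> 1 / real p" if "j < p" for j
    proof -
      have "1 / (2 * real p) \<le> x j" "x j \<le> 1 / real p" using x that by (auto simp: PiE_iff)
      moreover have "1 / (2 * real p) > 0" using assms by simp
      ultimately show "0 < x j" "x j \<le> 1 / real p" by linarith+
    qed
    have "norm_vec p x \<le> (\<Sum>j<p. \<bar>x j\<bar>)" unfolding norm_vec_def by (rule L2_set_le_sum_abs)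
    also have "\<dots> \<le> (\<Sum>j<p. 1 / real p)" using xj by (intro sum_mono) (simp add: abs_of_pos)
    also have "\<dots> = 1" using assms by simp
    finally have "norm_vec p x \<le> 1" .
    moreover have "0 < norm_vec p x"
      using component_le_norm_vec[OF assms, of x] xj[OF assms] by linarith
    ultimately show ?thesis using x by (auto simp: punctured_ball_def space_euclid PiE_def)
  qed
  hence sub: "(\<Pi>\<^sub>E j\<in>{..<p}. {1 / (2 * real p)..1 / real p}) \<subseteq> punctured_ball p" by auto
  have "0 < ennreal (1 / real p - 1 / (2 * real p)) ^ p"
    using assms by (auto simp: ennreal_power field_simps)
  also have "\<dots> = emeasure (euclid p) (\<Pi>\<^sub>E j\<in>{..<p}. {1 / (2 * real p)..1 / real p})"
    unfolding euclid_def using assms by (subst lborel_product.emeasure_PiM) (auto simp: field_simps)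
  also have "\<dots> \<le> emeasure (euclid p) (punctured_ball p)"
    by (intro emeasure_mono sub) auto
  finally show ?thesis .
qed

lemma emeasure_surface: "emeasure (surface_measure p) (unit_sphere p) = of_nat p * emeasure (euclid p) (punctured_ball p)"
proof -
  have "emeasure (surface_measure p) (unit_sphere p) = (\<integral>\<^sup>+x. 1 \<partial>surface_measure p)"
    by simp
  also have "\<dots> = of_nat p * emeasure (euclid p) (punctured_ball p)"
    by (subst nn_integral_surface) auto
  finally show ?thesis .
qed

lemma emeasure_surface_nontrivial:
  assumes "p > 0"
  shows "emeasure (surface_measure p) (unit_sphere p) \<noteq> 0" "emeasure (surface_measure p) (unit_sphere p) \<noteq> \<infinity>"
  using emeasure_punctured_ball_pos[OF assms] emeasure_punctured_ball_finite[of p] assms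
  by (auto simp: emeasure_surface ennreal_mult_eq_top_iff)

lemma prob_space_sphere_unif: "p > 0 \<Longrightarrow> prob_space (sphere_unif p)"
  unfolding sphere_unif_def by (intro prob_space_uniform_measure emeasure_surface_nontrivial)

text \<open>The uniform law is the radial image of normalised Lebesgue measure on the ball; the
  factor \<open>p\<close> of the surface measure cancels. The product form avoids division in
  \<open>ennreal\<close>.\<close>

lemma nn_integral_sphere_unif:
  assumes f: "f \<in> borel_measurable (sphere_unif p)" and p: "p > 0"
  shows "emeasure (euclid p) (punctured_ball p) * (\<integral>\<^sup>+x. f x \<partial>sphere_unif p)
    = (\<integral>\<^sup>+x. f (unit_dir p x) * indicator (punctured_ball p) x \<partial>euclid p)"
proof -
  define I where "I = (\<integral>\<^sup>+x. f (unit_dir p x) * indicator (punctured_ball p) x \<partial>euclid p)"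
  define V where "V = emeasure (euclid p) (punctured_ball p)"
  have V: "V \<noteq> 0" "V \<noteq> \<infinity>"
    using emeasure_punctured_ball_pos[OF p] emeasure_punctured_ball_finite[of p] by (auto simp: V_def)
  have f': "f \<in> borel_measurable (restrict_space (euclid p) (unit_sphere p))"
    using f measurable_cong_sets[OF sets_sphere_unif refl] by blast
  have f'': "f \<in> borel_measurable (surface_measure p)"
    using f measurable_cong_sets[OF sets_sphere_unif refl] measurable_cong_sets[OF sets_surface_measure refl] by blast
  have "(\<integral>\<^sup>+x. f x \<partial>sphere_unif p) = (\<integral>\<^sup>+x. f x * indicator (unit_sphere p) x \<partial>surface_measure p) / (of_nat p * V)"
    unfolding sphere_unif_def V_def emeasure_surface[symmetric]
    by (rule nn_integral_uniform_measure) (use f'' sets.top[of "surface_measure p"] in auto)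
  also have "(\<integral>\<^sup>+x. f x * indicator (unit_sphere p) x \<partial>surface_measure p) = (\<integral>\<^sup>+x. f x \<partial>surface_measure p)"
    by (intro nn_integral_cong) auto
  also have "\<dots> = of_nat p * I"
    using nn_integral_surface[OF f'] by (simp add: I_def)
  finally have *: "(\<integral>\<^sup>+x. f x \<partial>sphere_unif p) = (I * of_nat p) / (of_nat p * V)"
    by (simp add: mult.commute)
  have pV: "of_nat p * V \<noteq> 0" "of_nat p * V \<noteq> \<infinity>"
    using V p by (auto simp: ennreal_mult_eq_top_iff)
  have "of_nat p * (V * (\<integral>\<^sup>+x. f x \<partial>sphere_unif p)) = of_nat p * I"
    unfolding * using mult_divide_eq_ennreal[OF pV(1), of "I * of_nat p"] pV
    by (metis (no_types, lifting) ennreal_times_divide infinity_ennreal_def mult.assoc mult.commute)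
  thus ?thesis
    using p by (simp add: I_def[symmetric] V_def[symmetric] ennreal_mult_cancel_left)
qed

lemma norm_vec_rotate: "A \<in> SO p \<Longrightarrow> norm_vec p (rotate_vec p A x) = norm_vec p x"
  by (simp add: norm_vec_eq inner_prod_rotate)

lemma unit_dir_rotate:
  assumes "A \<in> SO p"
  shows "unit_dir p (rotate_vec p A x) = rotate_vec p A (unit_dir p x)"
  by (auto simp: fun_eq_iff unit_dir_def norm_vec_rotate[OF assms])
     (auto simp: rotate_vec_def sum_divide_distrib)

lemma rotate_vec_unit_sphere: "A \<in> SO p \<Longrightarrow> x \<in> unit_sphere p \<Longrightarrow> rotate_vec p A x \<in> unit_sphere p"
  using rotate_vec_extensional[of p A x] by (auto simp: unit_sphere_def norm_vec_rotate space_euclid)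

lemma measurable_rotate_vec_sphere:
  assumes "A \<in> SO p"
  shows "rotate_vec p A \<in> sphere_unif p \<rightarrow>\<^sub>M sphere_unif p"
proof -
  have "rotate_vec p A \<in> restrict_space (euclid p) (unit_sphere p) \<rightarrow>\<^sub>M restrict_space (euclid p) (unit_sphere p)"
    using rotate_vec_unit_sphere[OF assms] by (intro measurable_restrict_space3) auto
  thus ?thesis
    unfolding measurable_cong_sets[OF sets_sphere_unif sets_sphere_unif] .
qed

lemma ennreal_mult_left_cancel_finite:
  fixes a b c :: ennreal
  assumes "a * b = a * c" "a \<noteq> 0" "a < \<infinity>"
  shows "b = c"
  using assms by (auto simp: ennreal_mult_cancel_left)

text \<open>Rotations commute with radial projection and preserve the ball, so invariance of
  Lebesgue measure passes to the sphere.\<close>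

lemma nn_integral_sphere_rotate:
  assumes A: "A \<in> lebesgue_rotations p" and f [measurable]: "f \<in> borel_measurable (sphere_unif p)" and p: "p > 0"
  shows "(\<integral>\<^sup>+x. f (rotate_vec p A x) \<partial>sphere_unif p) = (\<integral>\<^sup>+x. f x \<partial>sphere_unif p)"
proof (rule ennreal_mult_left_cancel_finite)
  note S = lebesgue_rotations_SO[OF A]
  note [measurable] = measurable_rotate_vec_sphere[OF S]
  have f': "f \<in> borel_measurable (restrict_space (euclid p) (unit_sphere p))"
    using f measurable_cong_sets[OF sets_sphere_unif refl] by blast
  define g where "g x = f (unit_dir p x) * indicator (punctured_ball p) x" for x
  have g: "g \<in> borel_measurable (euclid p)"
    unfolding g_def by (rule measurable_comp_unit_dir[OF f']) (auto simp: punctured_ball_def)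
  have "emeasure (euclid p) (punctured_ball p) * (\<integral>\<^sup>+x. f (rotate_vec p A x) \<partial>sphere_unif p)
      = (\<integral>\<^sup>+x. f (rotate_vec p A (unit_dir p x)) * indicator (punctured_ball p) x \<partial>euclid p)"
    by (rule nn_integral_sphere_unif[OF _ p]) measurable
  also have "\<dots> = (\<integral>\<^sup>+x. g (rotate_vec p A x) \<partial>euclid p)"
    using rotate_vec_extensional[of p A]
    by (intro nn_integral_cong)
       (auto simp: g_def unit_dir_rotate[OF S] punctured_ball_def norm_vec_rotate[OF S] indicator_def space_euclid)
  also have "\<dots> = (\<integral>\<^sup>+x. g x \<partial>euclid p)"
    by (rule nn_integral_lebesgue_rotation[OF A g])
  also have "\<dots> = emeasure (euclid p) (punctured_ball p) * (\<integral>\<^sup>+x. f x \<partial>sphere_unif p)"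
    unfolding g_def by (rule nn_integral_sphere_unif[OF f p, symmetric])
  finally show "emeasure (euclid p) (punctured_ball p) * (\<integral>\<^sup>+x. f (rotate_vec p A x) \<partial>sphere_unif p)
      = emeasure (euclid p) (punctured_ball p) * (\<integral>\<^sup>+x. f x \<partial>sphere_unif p)" .
qed (use emeasure_punctured_ball_finite[of p] emeasure_punctured_ball_pos[OF p] in auto)

lemma distr_sphere_rotate:
  assumes A: "A \<in> lebesgue_rotations p" and p: "p > 0"
  shows "distr (sphere_unif p) (sphere_unif p) (rotate_vec p A) = sphere_unif p"
proof (rule measure_eqI)
  note S = lebesgue_rotations_SO[OF A]
  fix B assume "B \<in> sets (distr (sphere_unif p) (sphere_unif p) (rotate_vec p A))"
  hence [measurable]: "B \<in> sets (sphere_unif p)" by simp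
  note [measurable] = measurable_rotate_vec_sphere[OF S]
  have "emeasure (distr (sphere_unif p) (sphere_unif p) (rotate_vec p A)) B
      = (\<integral>\<^sup>+x. indicator B x \<partial>distr (sphere_unif p) (sphere_unif p) (rotate_vec p A))"
    by simp
  also have "\<dots> = (\<integral>\<^sup>+x. indicator B (rotate_vec p A x) \<partial>sphere_unif p)"
    by (rule nn_integral_distr) measurable
  also have "\<dots> = emeasure (sphere_unif p) B"
    by (subst nn_integral_sphere_rotate[OF A _ p]) auto
  finally show "emeasure (distr (sphere_unif p) (sphere_unif p) (rotate_vec p A)) B = emeasure (sphere_unif p) B" .
qed simp

lemma measurable_inner_prod_sphere [measurable]: "(\<lambda>x. inner_prod p x y) \<in> borel_measurable (sphere_unif p)"
proof -
  have "(\<lambda>x. inner_prod p x y) \<in> borel_measurable (restrict_space (euclid p) (unit_sphere p))"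
    by (intro measurable_restrict_space1 measurable_inner_prod)
  thus ?thesis unfolding measurable_cong_sets[OF sets_sphere_unif refl] .
qed

text \<open>The law of \<open>inner_prod p x u\<close> depends on \<open>u\<close> only through its
  length: some rotation carries \<open>v\<close> to \<open>u\<close>, and it can be moved onto
  \<open>x\<close>.\<close>

lemma nn_integral_sphere_inner_cong:
  assumes "p \<ge> 2" and [measurable]: "f \<in> borel_measurable borel" and "inner_prod p u u = inner_prod p v v"
  shows "(\<integral>\<^sup>+x. f (inner_prod p x u) \<partial>sphere_unif p) = (\<integral>\<^sup>+x. f (inner_prod p x v) \<partial>sphere_unif p)"
proof -
  \<comment> \<open>\<open>inner_prod\<close> reads only coordinates below \<open>p\<close>, whereas
    \<open>exists_rotation\<close> needs extensional vectors.\<close>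
  define u' v' where "u' = restrict u {..<p}" and "v' = restrict v {..<p}"
  have "\<exists>A \<in> lebesgue_rotations p. rotate_vec p A v' = u'"
    using assms by (intro exists_rotation) (auto simp: u'_def v'_def)
  then obtain A where A: "A \<in> lebesgue_rotations p" "rotate_vec p A v' = u'" by blast
  have "inner_prod p x v = inner_prod p (rotate_vec p A x) u" for x
  proof -
    have "inner_prod p x v = inner_prod p x v'" by (simp add: v'_def)
    also have "\<dots> = inner_prod p (rotate_vec p A x) (rotate_vec p A v')"
      by (simp add: inner_prod_rotate[OF lebesgue_rotations_SO[OF A(1)]])
    also have "\<dots> = inner_prod p (rotate_vec p A x) u" unfolding A(2) by (simp add: u'_def)
    finally show ?thesis .
  qed
  thus ?thesis
    using assms(1) nn_integral_sphere_rotate[OF A(1), of "\<lambda>x. f (inner_prod p x u)"] by simp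
qed

text \<open>The image of Lebesgue measure under scaling, reweighted by \<open>b ^ p\<close>, agrees
  with Lebesgue measure on boxes, one factor \<open>b\<close> per coordinate; uniqueness of the
  product measure does the rest.\<close>

lemma nn_integral_euclid_scale:
  assumes b: "b > 0" and [measurable]: "f \<in> borel_measurable (euclid p)"
  shows "(\<integral>\<^sup>+x. f x \<partial>euclid p) = ennreal (b ^ p) * (\<integral>\<^sup>+x. f (\<lambda>j\<in>{..<p}. b * x j) \<partial>euclid p)"
proof -
  have m [measurable]: "(\<lambda>x. \<lambda>j\<in>{..<p}. b * x j) \<in> euclid p \<rightarrow>\<^sub>M euclid p"
    by measurable
  define P where "P = density (distr (euclid p) (euclid p) (\<lambda>x. \<lambda>j\<in>{..<p}. b * x j)) (\<lambda>_. ennreal (b ^ p))"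
  have "P = Pi\<^sub>M {..<p} (\<lambda>_. lborel)"
  proof (rule lborel_product.PiM_eqI)
    fix A :: "nat \<Rightarrow> real set" assume A: "\<And>i. i \<in> {..<p} \<Longrightarrow> A i \<in> sets lborel"
    have mA: "Pi\<^sub>E {..<p} A \<in> sets (euclid p)"
      unfolding euclid_def using A by (intro sets_PiM_I_finite) auto
    have mB: "(*) b -` A i \<in> sets borel" if "i < p" for i
      using measurable_sets[of "(*) b" borel borel "A i"] A[of i] that by auto
    have vi: "(\<lambda>x. \<lambda>j\<in>{..<p}. b * x j) -` Pi\<^sub>E {..<p} A \<inter> space (euclid p) = Pi\<^sub>E {..<p} (\<lambda>i. (*) b -` A i)"
      by (auto simp: space_euclid PiE_iff)
    have one: "ennreal b * emeasure lborel ((*) b -` A i) = emeasure lborel (A i)" if i: "i < p" for i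
    proof -
      have Ai: "A i \<in> sets borel" using A i by auto
      have "emeasure lborel (A i) = (\<integral>\<^sup>+x. indicator (A i) x \<partial>lborel)" using Ai by simp
      also have "\<dots> = ennreal b * (\<integral>\<^sup>+x. indicator (A i) (0 + b * x) \<partial>lborel)"
        using b Ai by (subst nn_integral_real_affine[where c = b and t = 0]) auto
      also have "(\<integral>\<^sup>+x. indicator (A i) (0 + b * x) \<partial>lborel) = (\<integral>\<^sup>+x. indicator ((*) b -` A i) x \<partial>lborel)"
        by (intro nn_integral_cong) (auto simp: indicator_def)
      also have "\<dots> = emeasure lborel ((*) b -` A i)" using mB[OF i] by simp
      finally show ?thesis by simp
    qed
    have "emeasure P (Pi\<^sub>E {..<p} A) = ennreal (b ^ p) * emeasure (euclid p) (Pi\<^sub>E {..<p} (\<lambda>i. (*) b -` A i))"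
      unfolding P_def using mA by (simp add: emeasure_density nn_integral_cmult emeasure_distr vi)
    also have "\<dots> = (\<Prod>i<p. ennreal b * emeasure lborel ((*) b -` A i))"
      using b mB unfolding euclid_def
      by (subst lborel_product.emeasure_PiM) (auto simp: prod.distrib ennreal_power)
    also have "\<dots> = (\<Prod>i<p. emeasure lborel (A i))"
      by (intro prod.cong one refl) auto
    finally show "emeasure P (Pi\<^sub>E {..<p} A) = (\<Prod>i\<in>{..<p}. emeasure lborel (A i))" .
  qed (auto simp: P_def euclid_def)
  hence P: "P = euclid p" by (simp add: euclid_def)
  have "(\<integral>\<^sup>+x. f x \<partial>euclid p) = (\<integral>\<^sup>+x. f x \<partial>P)" by (simp add: P)
  also have "\<dots> = ennreal (b ^ p) * (\<integral>\<^sup>+x. f (\<lambda>j\<in>{..<p}. b * x j) \<partial>euclid p)"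
    unfolding P_def by (subst nn_integral_density) (auto simp: nn_integral_cmult nn_integral_distr)
  finally show ?thesis .
qed

text \<open>The law of the radius under \<open>h (x / \<bar>x\<bar>) dx\<close>, from the scaling of Lebesgue measure.\<close>
lemma nn_integral_polar:
  assumes h: "h \<in> borel_measurable (sphere_unif p)" and p: "p > 0"
    and fin: "(\<integral>\<^sup>+x. h x \<partial>sphere_unif p) < \<infinity>"
    and \<phi> [measurable]: "\<phi> \<in> borel_measurable borel"
  shows "(\<integral>\<^sup>+x. \<phi> (norm_vec p x) * h (unit_dir p x) * indicator {x. 0 < norm_vec p x} x \<partial>euclid p)
    = emeasure (euclid p) (punctured_ball p) * (\<integral>\<^sup>+x. h x \<partial>sphere_unif p)
      * (\<integral>\<^sup>+r. \<phi> r * ennreal (real p * r ^ (p - 1)) * indicator {0<..} r \<partial>lborel)"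
proof -
  define A where "A = emeasure (euclid p) (punctured_ball p) * (\<integral>\<^sup>+x. h x \<partial>sphere_unif p)"
  have A: "A < \<infinity>"
    using fin emeasure_punctured_ball_finite[of p] by (auto simp: A_def ennreal_mult_less_top)
  have h': "h \<in> borel_measurable (restrict_space (euclid p) (unit_sphere p))"
    using h measurable_cong_sets[OF sets_sphere_unif refl] by blast
  define g where "g x = h (unit_dir p x) * indicator {x \<in> space (euclid p). 0 < norm_vec p x} x" for x
  have g [measurable]: "g \<in> borel_measurable (euclid p)"
    unfolding g_def by (rule measurable_comp_unit_dir[OF h']) auto
  \<comment> \<open>\<open>M\<close> is the law of the radius under the weight \<open>g\<close>, and
    \<open>N\<close> its claimed form, with the derivative of \<open>r ^ p\<close> as
    density.\<close>
  define M where "M = distr (density (euclid p) g) borel (norm_vec p)"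
  define N where "N = density lborel (\<lambda>r. A * (ennreal (real p * r ^ (p - 1)) * indicator {0<..} r))"
  have M_at: "emeasure M {..b} = (\<integral>\<^sup>+x. g x * indicator {x. norm_vec p x \<le> b} x \<partial>euclid p)" for b
  proof -
    have "emeasure M {..b} = (\<integral>\<^sup>+x. g x * indicator (norm_vec p -` {..b} \<inter> space (euclid p)) x \<partial>euclid p)"
      unfolding M_def by (subst emeasure_distr) (auto simp: emeasure_density)
    also have "\<dots> = (\<integral>\<^sup>+x. g x * indicator {x. norm_vec p x \<le> b} x \<partial>euclid p)"
      by (intro nn_integral_cong) (auto simp: indicator_def)
    finally show ?thesis .
  qed
  have ball: "(\<integral>\<^sup>+x. g x * indicator {x. norm_vec p x \<le> 1} x \<partial>euclid p) = A"
  proof -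
    have "A = (\<integral>\<^sup>+x. h (unit_dir p x) * indicator (punctured_ball p) x \<partial>euclid p)"
      unfolding A_def by (rule nn_integral_sphere_unif[OF h p])
    also have "\<dots> = (\<integral>\<^sup>+x. g x * indicator {x. norm_vec p x \<le> 1} x \<partial>euclid p)"
      by (intro nn_integral_cong) (auto simp: indicator_def g_def punctured_ball_def)
    finally show ?thesis ..
  qed
  have M_pos: "emeasure M {..b} = A * ennreal (b ^ p)" if b: "b > 0" for b
  proof -
    have e: "g (\<lambda>j\<in>{..<p}. b * x j) * indicator {x. norm_vec p x \<le> b} (\<lambda>j\<in>{..<p}. b * x j)
        = g x * indicator {x. norm_vec p x \<le> 1} x" if x: "x \<in> space (euclid p)" for x
    proof -
      have n: "norm_vec p (\<lambda>j\<in>{..<p}. b * x j) = b * norm_vec p x" using b by (simp add: norm_vec_scale)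
      have "unit_dir p (\<lambda>j\<in>{..<p}. b * x j) = unit_dir p x"
        using b by (auto simp: unit_dir_def n fun_eq_iff)
      thus ?thesis using b x unfolding g_def n
        by (auto simp: indicator_def n space_euclid zero_less_mult_iff)
    qed
    have "emeasure M {..b} = ennreal (b ^ p) * (\<integral>\<^sup>+x. g (\<lambda>j\<in>{..<p}. b * x j) * indicator {x. norm_vec p x \<le> b} (\<lambda>j\<in>{..<p}. b * x j) \<partial>euclid p)"
      unfolding M_at by (rule nn_integral_euclid_scale[OF b]) measurable
    also have "(\<integral>\<^sup>+x. g (\<lambda>j\<in>{..<p}. b * x j) * indicator {x. norm_vec p x \<le> b} (\<lambda>j\<in>{..<p}. b * x j) \<partial>euclid p) = A"
      unfolding ball[symmetric] by (intro nn_integral_cong e)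
    finally show ?thesis by (simp add: mult.commute)
  qed
  have M_neg: "emeasure M {..b} = 0" if b: "b \<le> 0" for b
  proof -
    have "emeasure M {..b} = (\<integral>\<^sup>+x. 0 \<partial>euclid p)"
      unfolding M_at using b by (intro nn_integral_cong) (auto simp: g_def indicator_def)
    thus ?thesis by simp
  qed
  have N_at: "emeasure N {..b} = A * (\<integral>\<^sup>+r. ennreal (real p * r ^ (p - 1)) * indicator {0<..b} r \<partial>lborel)" for b
  proof -
    have "emeasure N {..b} = (\<integral>\<^sup>+r. A * (ennreal (real p * r ^ (p - 1)) * indicator {0<..b} r) \<partial>lborel)"
      unfolding N_def by (subst emeasure_density) (auto intro!: nn_integral_cong simp: indicator_def)
    thus ?thesis by (simp add: nn_integral_cmult)
  qed
  have N_pos: "emeasure N {..b} = A * ennreal (b ^ p)" if b: "b > 0" for b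
  proof -
    have "(\<integral>\<^sup>+r. ennreal (real p * r ^ (p - 1)) * indicator {0<..b} r \<partial>lborel)
        = (\<integral>\<^sup>+r. ennreal (real p * r ^ (p - 1)) * indicator {0..b} r \<partial>lborel)"
      by (rule nn_integral_cong_AE) (use AE_lborel_singleton[of 0] in eventually_elim, auto simp: indicator_def)
    also have "\<dots> = ennreal (b ^ p - 0 ^ p)"
      using b by (intro nn_integral_FTC_Icc) (auto intro!: derivative_eq_intros simp: has_real_derivative_iff_has_vector_derivative[symmetric])
    finally show ?thesis using p by (simp add: N_at zero_power)
  qed
  have N_neg: "emeasure N {..b} = 0" if b: "b \<le> 0" for b
    using b by (simp add: N_at)
  \<comment> \<open>Half-lines suffice: both measures give mass \<open>A * b ^ p\<close> to radii up
    to \<open>b > 0\<close>, by scaling on one side and the fundamental theorem on the other.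
    Finiteness of \<open>A\<close> is what the uniqueness theorem requires.\<close>
  have "M = N"
  proof (rule measure_eqI_generator_eq[where \<Omega> = UNIV and E = "range (\<lambda>b::real. {..b})" and A = "\<lambda>i::nat. {..real i}"])
    show "Int_stable (range (\<lambda>b::real. {..b}))"
      by (auto simp: Int_stable_def)
    show "emeasure M X = emeasure N X" if X: "X \<in> range (\<lambda>b::real. {..b})" for X
    proof -
      from X obtain b where "X = {..b}" by auto
      thus ?thesis using M_pos[of b] N_pos[of b] M_neg[of b] N_neg[of b] by (cases "b > 0") auto
    qed
    show "sets M = sigma_sets UNIV (range (\<lambda>b::real. {..b}))" "sets N = sigma_sets UNIV (range (\<lambda>b::real. {..b}))"
      by (auto simp: M_def N_def borel_eq_atMost)
    show "(\<Union>i. {..real i}) = UNIV"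
      by (auto intro: real_arch_simple)
    show "emeasure M {..real i} \<noteq> \<infinity>" for i
      using A M_pos[of "real i"] M_neg[of "real i"] by (cases "i = 0") (auto simp: ennreal_mult_eq_top_iff)
  qed auto
  have "(\<integral>\<^sup>+x. \<phi> (norm_vec p x) * h (unit_dir p x) * indicator {x. 0 < norm_vec p x} x \<partial>euclid p)
      = (\<integral>\<^sup>+x. g x * \<phi> (norm_vec p x) \<partial>euclid p)"
    by (intro nn_integral_cong) (auto simp: g_def indicator_def mult.commute)
  also have "\<dots> = (\<integral>\<^sup>+r. \<phi> r \<partial>M)"
    unfolding M_def by (simp add: nn_integral_distr nn_integral_density)
  also have "\<dots> = (\<integral>\<^sup>+r. A * (\<phi> r * ennreal (real p * r ^ (p - 1)) * indicator {0<..} r) \<partial>lborel)"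
    unfolding \<open>M = N\<close> N_def by (subst nn_integral_density) (auto intro!: nn_integral_cong simp: mult_ac)
  also have "\<dots> = A * (\<integral>\<^sup>+r. \<phi> r * ennreal (real p * r ^ (p - 1)) * indicator {0<..} r \<partial>lborel)"
    by (rule nn_integral_cmult) measurable
  finally show ?thesis unfolding A_def .
qed

section \<open>Moments of the uniform law\<close>

text \<open>The integral of \<open>exp (- x^2) * x ^ q\<close> over the positive half-line, that is,
  half the Gamma function at \<open>(q + 1) / 2\<close>, in closed form for either parity.\<close>

definition half_gaussian_moment :: "nat \<Rightarrow> real" where
  "half_gaussian_moment q = (if even q then sqrt pi / 2 * (fact q / (2 ^ q * fact (q div 2))) else fact (q div 2) / 2)"

lemma half_gaussian_moment_pos: "half_gaussian_moment q > 0"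
  by (simp add: half_gaussian_moment_def)

text \<open>The functional equation of the Gamma function. It makes the ratio of consecutive sphere
  moments rational, whatever the parity of the dimension.\<close>

lemma half_gaussian_moment_rec:
  "half_gaussian_moment (q + 2) = (real q + 1) / 2 * half_gaussian_moment q"
proof (cases "even q")
  case True
  then obtain k where k: "q = 2 * k" by auto
  have "(fact (2 * k + 2) :: real) / (2 ^ (2 * k + 2) * fact (k + 1))
      = ((2 * real k + 1) / 2) * (fact (2 * k) / (2 ^ (2 * k) * fact k))"
    unfolding times_divide_times_eq
  proof (subst frac_eq_eq)
    show "(2::real) ^ (2 * k + 2) * fact (k + 1) \<noteq> 0" "(2::real) * (2 ^ (2 * k) * fact k) \<noteq> 0"
      by simp_all
  qed (simp add: algebra_simps)
  thus ?thesis by (simp add: half_gaussian_moment_def k del: fact_Suc power_Suc)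
next
  case False
  then obtain k where "q = 2 * k + 1" by (auto elim: oddE)
  thus ?thesis by (simp add: half_gaussian_moment_def field_simps)
qed

lemma has_bochner_integral_half_gaussian:
  "has_bochner_integral lborel (\<lambda>x::real. indicator {0..} x *\<^sub>R (exp (- x\<^sup>2) * x ^ q)) (half_gaussian_moment q)"
proof (cases "even q")
  case True
  then obtain k where "q = 2 * k" by auto
  thus ?thesis using gaussian_moment_even_pos[of k] by (simp add: half_gaussian_moment_def)
next
  case False
  then obtain k where "q = 2 * k + 1" by (auto elim: oddE)
  thus ?thesis using gaussian_moment_odd_pos[of k] by (simp add: half_gaussian_moment_def)
qed

lemma nn_integral_half_gaussian:
  "(\<integral>\<^sup>+x. ennreal (exp (- x\<^sup>2) * x ^ q) * indicator {0<..} x \<partial>lborel) = ennreal (half_gaussian_moment q)"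
proof -
  have "(\<integral>\<^sup>+x. ennreal (exp (- x\<^sup>2) * x ^ q) * indicator {0<..} x \<partial>lborel)
      = (\<integral>\<^sup>+x. ennreal (indicator {0..} x *\<^sub>R (exp (- x\<^sup>2) * x ^ q)) \<partial>lborel)"
    by (rule nn_integral_cong_AE) (use AE_lborel_singleton[of 0] in eventually_elim, auto simp: indicator_def)
  also have "\<dots> = ennreal (half_gaussian_moment q)"
    using has_bochner_integral_half_gaussian[of q]
    by (subst nn_integral_eq_integral) (auto simp: has_bochner_integral_iff indicator_def intro!: AE_I2)
  finally show ?thesis .
qed

lemma nn_integral_gaussian_even:
  "(\<integral>\<^sup>+x. ennreal (exp (- x\<^sup>2) * x ^ (2 * k)) \<partial>lborel) = ennreal (2 * half_gaussian_moment (2 * k))"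
proof -
  have "has_bochner_integral lborel (\<lambda>x::real. exp (- x\<^sup>2) * x ^ (2 * k)) (2 *\<^sub>R half_gaussian_moment (2 * k))"
    by (rule has_bochner_integral_even_function[OF has_bochner_integral_half_gaussian]) (simp add: power_mult)
  thus ?thesis
    by (subst nn_integral_eq_integral) (auto simp: has_bochner_integral_iff)
qed

lemma AE_norm_vec_pos:
  assumes "p > 0"
  shows "AE x in euclid p. 0 < norm_vec p x"
proof (rule AE_I)
  have "{x \<in> space (euclid p). \<not> 0 < norm_vec p x} \<subseteq> (\<Pi>\<^sub>E j\<in>{..<p}. {0})"
  proof
    fix x assume "x \<in> {x \<in> space (euclid p). \<not> 0 < norm_vec p x}"
    moreover from this have "x j = 0" if "j < p" for j
      using component_le_norm_vec[OF that, of x] by auto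
    ultimately show "x \<in> (\<Pi>\<^sub>E j\<in>{..<p}. {0})"
      by (auto simp: space_euclid PiE_def Pi_def fun_eq_iff extensional_def)
  qed
  thus "{x \<in> space (euclid p). \<not> 0 < norm_vec p x} \<subseteq> (\<Pi>\<^sub>E j\<in>{..<p}. {0})" .
  show "emeasure (euclid p) (\<Pi>\<^sub>E j\<in>{..<p}. {0}) = 0"
    unfolding euclid_def using assms by (subst lborel_product.emeasure_PiM) (auto simp: power_0_left)
  show "(\<Pi>\<^sub>E j\<in>{..<p}. {0}) \<in> sets (euclid p)"
    unfolding euclid_def by (intro sets_PiM_I_finite) auto
qed

lemma sphere_component_le: "x \<in> unit_sphere p \<Longrightarrow> j < p \<Longrightarrow> \<bar>x j\<bar> \<le> 1"
  using component_le_norm_vec[of j p x] by (auto simp: unit_sphere_def)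

text \<open>One Gaussian integral, of \<open>exp (- |x|^2) * (x 0) ^ (2 * k)\<close>, evaluated
  twice: in polar form, where the unknown sphere moment appears, and as a product over the
  coordinates.\<close>

lemma gaussian_sphere_relation:
  assumes p: "p > 0"
  shows "emeasure (euclid p) (punctured_ball p) * (\<integral>\<^sup>+x. ennreal ((x 0) ^ (2 * k)) \<partial>sphere_unif p)
      * ennreal (real p * half_gaussian_moment (2 * k + (p - 1)))
    = ennreal (2 * half_gaussian_moment (2 * k) * (2 * half_gaussian_moment 0) ^ (p - 1))"
proof -
  \<comment> \<open>Splits the Gaussian integrand into radial part \<open>\<phi>\<close> and angular
    part \<open>h\<close>; the factor \<open>r ^ (2 * k)\<close> undoes the normalisation of the
    first coordinate. \<open>f\<close> is the same integrand factored by coordinates.\<close>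
  define h where "h x = ennreal ((x 0) ^ (2 * k))" for x :: "nat \<Rightarrow> real"
  define \<phi> where "\<phi> r = ennreal (exp (- r\<^sup>2) * r ^ (2 * k))" for r :: real
  define f where "f j t = ennreal (exp (- t\<^sup>2) * t ^ (if j = 0 then 2 * k else 0))" for j :: nat and t :: real
  interpret prob_space "sphere_unif p" by (rule prob_space_sphere_unif[OF p])
  have h: "h \<in> borel_measurable (sphere_unif p)"
  proof -
    have "h \<in> borel_measurable (restrict_space (euclid p) (unit_sphere p))"
      unfolding h_def using p by (intro measurable_restrict_space1) measurable
    thus ?thesis unfolding measurable_cong_sets[OF sets_sphere_unif refl] .
  qed
  have "(\<integral>\<^sup>+x. h x \<partial>sphere_unif p) \<le> (\<integral>\<^sup>+x. 1 \<partial>sphere_unif p)"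
  proof (rule nn_integral_mono)
    fix x assume "x \<in> space (sphere_unif p)"
    hence "((x 0)\<^sup>2) ^ k \<le> 1"
      using p by (subst power_le_one) (auto simp: abs_square_le_1 sphere_component_le)
    thus "h x \<le> 1" by (simp add: h_def power_mult)
  qed
  also have "\<dots> < \<infinity>" by (simp add: emeasure_space_1[simplified])
  finally have fin: "(\<integral>\<^sup>+x. h x \<partial>sphere_unif p) < \<infinity>" .
  have \<phi>: "\<phi> \<in> borel_measurable borel" unfolding \<phi>_def by measurable
  have "(\<integral>\<^sup>+x. \<phi> (norm_vec p x) * h (unit_dir p x) * indicator {x. 0 < norm_vec p x} x \<partial>euclid p)
      = (\<integral>\<^sup>+x. (\<Prod>j<p. f j (x j)) \<partial>euclid p)"
  proof (rule nn_integral_cong_AE, use AE_norm_vec_pos[OF p] in eventually_elim)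
    fix x :: "nat \<Rightarrow> real" assume x: "0 < norm_vec p x"
    have "\<phi> (norm_vec p x) * h (unit_dir p x) * indicator {x. 0 < norm_vec p x} x
        = ennreal (exp (- inner_prod p x x) * ((norm_vec p x) ^ (2 * k) * (x 0 / norm_vec p x) ^ (2 * k)))"
      using x p by (simp add: \<phi>_def h_def unit_dir_def ennreal_mult[symmetric] norm_vec_square mult.assoc)
    also have "(norm_vec p x) ^ (2 * k) * (x 0 / norm_vec p x) ^ (2 * k) = (x 0) ^ (2 * k)"
      using x by (simp add: power_mult_distrib[symmetric])
    also have "exp (- inner_prod p x x) * (x 0) ^ (2 * k) = (\<Prod>j<p. exp (- (x j)\<^sup>2) * x j ^ (if j = 0 then 2 * k else 0))"
    proof -
      have "(\<Prod>j<p. x j ^ (if j = 0 then 2 * k else 0)) = (\<Prod>j<p. if j = 0 then x 0 ^ (2 * k) else 1)"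
        by (intro prod.cong) auto
      also have "\<dots> = (x 0) ^ (2 * k)" using p by simp
      finally show ?thesis
        by (simp add: prod.distrib exp_sum[symmetric] inner_prod_def power2_eq_square sum_negf)
    qed
    also have "ennreal \<dots> = (\<Prod>j<p. f j (x j))"
      unfolding f_def by (rule prod_ennreal[symmetric]) (auto simp: power_mult)
    finally show "\<phi> (norm_vec p x) * h (unit_dir p x) * indicator {x. 0 < norm_vec p x} x = (\<Prod>j<p. f j (x j))" .
  qed
  also have "\<dots> = (\<Prod>j<p. integral\<^sup>N lborel (f j))"
    unfolding euclid_def by (rule lborel_product.product_nn_integral_prod) (auto simp: f_def)
  also have "\<dots> = (\<Prod>j<p. ennreal (if j = 0 then 2 * half_gaussian_moment (2 * k) else 2 * half_gaussian_moment 0))"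
    using nn_integral_gaussian_even[of k] nn_integral_gaussian_even[of 0]
    by (intro prod.cong) (auto simp: f_def[abs_def])
  also have "\<dots> = ennreal (2 * half_gaussian_moment (2 * k) * (2 * half_gaussian_moment 0) ^ (p - 1))"
  proof -
    have "{..<p} = insert 0 {1..<p}" using p by auto
    thus ?thesis
      using half_gaussian_moment_pos by (subst prod_ennreal) (auto intro: less_imp_le)
  qed
  finally have L: "(\<integral>\<^sup>+x. \<phi> (norm_vec p x) * h (unit_dir p x) * indicator {x. 0 < norm_vec p x} x \<partial>euclid p)
      = ennreal (2 * half_gaussian_moment (2 * k) * (2 * half_gaussian_moment 0) ^ (p - 1))" .
  have "(\<integral>\<^sup>+r. \<phi> r * ennreal (real p * r ^ (p - 1)) * indicator {0<..} r \<partial>lborel)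
      = (\<integral>\<^sup>+r. ennreal (real p) * (ennreal (exp (- r\<^sup>2) * r ^ (2 * k + (p - 1))) * indicator {0<..} r) \<partial>lborel)"
    by (intro nn_integral_cong)
       (auto simp: \<phi>_def indicator_def ennreal_mult[symmetric] power_add mult_ac)
  also have "\<dots> = ennreal (real p * half_gaussian_moment (2 * k + (p - 1)))"
    by (subst nn_integral_cmult) (auto simp: nn_integral_half_gaussian ennreal_mult less_imp_le[OF half_gaussian_moment_pos])
  finally have R: "(\<integral>\<^sup>+r. \<phi> r * ennreal (real p * r ^ (p - 1)) * indicator {0<..} r \<partial>lborel)
      = ennreal (real p * half_gaussian_moment (2 * k + (p - 1)))" .
  show ?thesis
    using nn_integral_polar[OF h p fin \<phi>] unfolding L R unfolding h_def ..
qed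

text \<open>The classical value \<open>(2k-1)!! / (p (p+2) ... (p+2k-2))\<close> of the moment of
  order \<open>2 * k\<close> of one coordinate.\<close>

definition sphere_moment :: "nat \<Rightarrow> nat \<Rightarrow> real" where
  "sphere_moment p k = (\<Prod>j<k. real (2 * j + 1) / real (p + 2 * j))"

lemma sphere_moment_nonneg: "sphere_moment p k \<ge> 0"
  by (simp add: sphere_moment_def prod_nonneg)

lemma nn_integral_sphere_component:
  assumes p: "p > 0"
  shows "(\<integral>\<^sup>+x. ennreal ((x 0) ^ (2 * k)) \<partial>sphere_unif p) = ennreal (sphere_moment p k)"
proof (induction k)
  case 0
  interpret prob_space "sphere_unif p" by (rule prob_space_sphere_unif[OF p])
  show ?case by (simp add: sphere_moment_def emeasure_space_1[simplified])
next
  case (Suc k)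
  let ?V = "emeasure (euclid p) (punctured_ball p)" and ?c = half_gaussian_moment
  let ?M = "\<lambda>k. \<integral>\<^sup>+x. ennreal ((x 0) ^ (2 * k)) \<partial>sphere_unif p"
  define C where "C = (2 * ?c 0) ^ (p - 1)"
  have c1: "?c (2 * Suc k) = (2 * real k + 1) / 2 * ?c (2 * k)"
    using half_gaussian_moment_rec[of "2 * k"] by simp
  have c2: "?c (2 * Suc k + (p - 1)) = (2 * real k + real p) / 2 * ?c (2 * k + (p - 1))"
    using half_gaussian_moment_rec[of "2 * k + (p - 1)"] p by (simp add: of_nat_diff)
  have nn: "?c q \<ge> 0" "C \<ge> 0" for q using half_gaussian_moment_pos by (auto simp: C_def less_imp_le)
  \<comment> \<open>Dividing the Gaussian relation at \<open>Suc k\<close> by that at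
    \<open>k\<close> removes the volume and all Gaussian constants and leaves the ratio
    \<open>(2k + 1) / (2k + p)\<close>, here cross-multiplied.\<close>
  have step: "?M (Suc k) * ennreal ((2 * real k + real p) / 2) = ?M k * ennreal ((2 * real k + 1) / 2)"
  proof (rule ennreal_mult_left_cancel_finite)
    have "?V * ennreal (real p * ?c (2 * k + (p - 1))) * (?M (Suc k) * ennreal ((2 * real k + real p) / 2))
        = ?V * ?M (Suc k) * ennreal (real p * ?c (2 * Suc k + (p - 1)))"
    proof -
      have "ennreal (real p * ?c (2 * Suc k + (p - 1)))
          = ennreal (real p * ?c (2 * k + (p - 1))) * ennreal ((2 * real k + real p) / 2)"
        unfolding c2 using nn by (subst ennreal_mult[symmetric]) (auto simp: mult_ac)
      thus ?thesis by (simp only: mult_ac)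
    qed
    also have "\<dots> = ennreal (2 * ?c (2 * k) * C) * ennreal ((2 * real k + 1) / 2)"
      unfolding gaussian_sphere_relation[OF p] c1 C_def[symmetric] using nn
      by (subst ennreal_mult[symmetric]) (auto simp: mult_ac)
    also have "\<dots> = ?V * ?M k * ennreal (real p * ?c (2 * k + (p - 1))) * ennreal ((2 * real k + 1) / 2)"
      unfolding C_def gaussian_sphere_relation[OF p] ..
    also have "\<dots> = ?V * ennreal (real p * ?c (2 * k + (p - 1))) * (?M k * ennreal ((2 * real k + 1) / 2))"
      by (simp only: mult_ac)
    finally show "?V * ennreal (real p * ?c (2 * k + (p - 1))) * (?M (Suc k) * ennreal ((2 * real k + real p) / 2))
      = ?V * ennreal (real p * ?c (2 * k + (p - 1))) * (?M k * ennreal ((2 * real k + 1) / 2))" .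
    show "?V * ennreal (real p * ?c (2 * k + (p - 1))) \<noteq> 0"
      using emeasure_punctured_ball_pos[OF p] p half_gaussian_moment_pos[of "2 * k + (p - 1)"]
      by (auto simp: mult_le_0_iff not_le)
    show "?V * ennreal (real p * ?c (2 * k + (p - 1))) < \<infinity>"
      using emeasure_punctured_ball_finite[of p] by (auto simp: ennreal_mult_less_top)
  qed
  have d: "(2 * real k + real p) / 2 > 0" using p by simp
  have m: "sphere_moment p (Suc k) = sphere_moment p k * ((2 * real k + 1) / 2) / ((2 * real k + real p) / 2)"
    using p by (simp add: sphere_moment_def divide_simps) (simp add: algebra_simps)
  define D where "D = (2 * real k + real p) / 2"
  have "ennreal D * ?M (Suc k) = ennreal (sphere_moment p k * ((2 * real k + 1) / 2))"
    using step sphere_moment_nonneg[of p k] unfolding Suc.IH D_def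
    by (simp add: mult.commute ennreal_mult[symmetric])
  also have "sphere_moment p k * ((2 * real k + 1) / 2) = D * sphere_moment p (Suc k)"
    unfolding m D_def[symmetric] using d by (simp add: D_def[symmetric])
  also have "ennreal \<dots> = ennreal D * ennreal (sphere_moment p (Suc k))"
    using d sphere_moment_nonneg[of p "Suc k"] by (intro ennreal_mult) (auto simp: D_def)
  finally show ?case
    by (rule ennreal_mult_left_cancel_finite) (use d in \<open>auto simp: D_def\<close>)
qed

section \<open>Moments and Laplace transform of a linear functional\<close>

lemma distr_sphere_inner_cong:
  assumes "p \<ge> 2" and "inner_prod p u u = inner_prod p v v"
  shows "distr (sphere_unif p) borel (\<lambda>x. inner_prod p x u) = distr (sphere_unif p) borel (\<lambda>x. inner_prod p x v)"
proof (rule measure_eqI)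
  fix B assume "B \<in> sets (distr (sphere_unif p) borel (\<lambda>x. inner_prod p x u))"
  hence [measurable]: "B \<in> sets borel" by simp
  have "emeasure (distr (sphere_unif p) borel (\<lambda>x. inner_prod p x w)) B
      = (\<integral>\<^sup>+x. indicator B (inner_prod p x w) \<partial>sphere_unif p)" for w
    by (subst nn_integral_distr[of _ _ borel, symmetric]) simp_all
  thus "emeasure (distr (sphere_unif p) borel (\<lambda>x. inner_prod p x u)) B
      = emeasure (distr (sphere_unif p) borel (\<lambda>x. inner_prod p x v)) B"
    using nn_integral_sphere_inner_cong[OF assms(1) _ assms(2), of "indicator B"] by simp
qed simp

text \<open>Signed and vector-valued integrands are reached through the image law on the line, which
  the nonnegative version has shown to be the same for \<open>u\<close> and
  \<open>v\<close>.\<close>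

lemma integral_sphere_inner_cong:
  fixes f :: "real \<Rightarrow> 'b :: {banach, second_countable_topology}"
  assumes "p \<ge> 2" and [measurable]: "f \<in> borel_measurable borel" and "inner_prod p u u = inner_prod p v v"
  shows "(\<integral>x. f (inner_prod p x u) \<partial>sphere_unif p) = (\<integral>x. f (inner_prod p x v) \<partial>sphere_unif p)"
proof -
  have "(\<integral>x. f (inner_prod p x w) \<partial>sphere_unif p) = (\<integral>t. f t \<partial>distr (sphere_unif p) borel (\<lambda>x. inner_prod p x w))" for w
    by (rule integral_distr[symmetric]) measurable
  thus ?thesis by (simp add: distr_sphere_inner_cong[OF assms(1,3)])
qed

lemma nn_integral_sphere_even_power:
  assumes "p \<ge> 2"
  shows "(\<integral>\<^sup>+x. ennreal ((inner_prod p x u) ^ (2 * k)) \<partial>sphere_unif p)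
    = ennreal ((inner_prod p u u) ^ k * sphere_moment p k)"
proof -
  define r where "r = sqrt (inner_prod p u u)"
  have r: "r\<^sup>2 = inner_prod p u u" by (simp add: r_def inner_prod_self_nonneg)
  \<comment> \<open>The vector on the first axis with the length of \<open>u\<close>, which reduces
    the claim to moments of a single coordinate.\<close>
  define v where "v = (\<lambda>j::nat. if j = 0 then r else 0)"
  have xv: "inner_prod p x v = r * x 0" for x
  proof -
    have "inner_prod p x v = (\<Sum>j<p. if j = 0 then r * x 0 else 0)"
      unfolding inner_prod_def v_def by (intro sum.cong) auto
    thus ?thesis using assms by simp
  qed
  have "(\<integral>\<^sup>+x. ennreal ((inner_prod p x u) ^ (2 * k)) \<partial>sphere_unif p)
      = (\<integral>\<^sup>+x. ennreal ((inner_prod p x v) ^ (2 * k)) \<partial>sphere_unif p)"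
    using xv[of v] r by (intro nn_integral_sphere_inner_cong[OF assms, of "\<lambda>t. ennreal (t ^ (2 * k))"])
      (auto simp: v_def power2_eq_square)
  also have "\<dots> = (\<integral>\<^sup>+x. ennreal (inner_prod p u u ^ k) * ennreal ((x 0) ^ (2 * k)) \<partial>sphere_unif p)"
    unfolding xv by (intro nn_integral_cong)
      (simp add: power_mult_distrib power_mult r ennreal_mult inner_prod_self_nonneg)
  also have "\<dots> = ennreal (inner_prod p u u ^ k) * (\<integral>\<^sup>+x. ennreal ((x 0) ^ (2 * k)) \<partial>sphere_unif p)"
  proof (rule nn_integral_cmult)
    have "(\<lambda>x. x 0) \<in> borel_measurable (restrict_space (euclid p) (unit_sphere p))"
      using assms by (intro measurable_restrict_space1 measurable_euclid_component) auto
    hence [measurable]: "(\<lambda>x. x 0) \<in> borel_measurable (sphere_unif p)"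
      unfolding measurable_cong_sets[OF sets_sphere_unif refl] .
    show "(\<lambda>x. ennreal ((x 0) ^ (2 * k))) \<in> borel_measurable (sphere_unif p)" by measurable
  qed
  also have "\<dots> = ennreal ((inner_prod p u u) ^ k * sphere_moment p k)"
    using assms by (subst nn_integral_sphere_component) (auto simp: ennreal_mult inner_prod_self_nonneg sphere_moment_nonneg)
  finally show ?thesis .
qed

lemma integral_sphere_even_power:
  assumes "p \<ge> 2"
  shows "has_bochner_integral (sphere_unif p) (\<lambda>x. (inner_prod p x u) ^ (2 * k)) ((inner_prod p u u) ^ k * sphere_moment p k)"
  using nn_integral_sphere_even_power[OF assms, of u k]
  by (intro has_bochner_integral_nn_integral)
     (auto simp: inner_prod_self_nonneg sphere_moment_nonneg power_mult)

lemma inner_prod_uminus: "inner_prod p x (\<lambda>j. - u j) = - inner_prod p x u"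
  by (simp add: inner_prod_def sum_negf)

text \<open>\<open>u\<close> and \<open>- u\<close> have the same length, so the integral equals its
  own negative.\<close>

lemma integral_sphere_inner:
  assumes "p \<ge> 2"
  shows "(\<integral>x. inner_prod p x u \<partial>sphere_unif p) = 0"
proof -
  have "(\<integral>x. inner_prod p x u \<partial>sphere_unif p) = (\<integral>x. inner_prod p x (\<lambda>j. - u j) \<partial>sphere_unif p)"
    by (rule integral_sphere_inner_cong[OF assms, of "\<lambda>t. t"]) (auto simp: inner_prod_def)
  thus ?thesis by (simp add: inner_prod_uminus)
qed

lemma sums_cosh_even: "(\<lambda>k. t ^ (2 * k) / fact (2 * k)) sums cosh (t::real)"
proof -
  have "(\<lambda>n. if even n then t ^ n /\<^sub>R fact n else 0) sums cosh t"
    by (rule cosh_converges)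
  hence "(\<lambda>k. (\<lambda>n. if even n then t ^ n /\<^sub>R fact n else 0) (2 * k)) sums cosh t"
    by (subst sums_mono_reindex) (auto simp: strict_mono_def elim!: evenE)
  thus ?thesis by (simp add: divide_inverse mult.commute)
qed

text \<open>Both sides have the same consecutive ratios: the odd factors of
  \<open>fact (2 * k)\<close> cancel the numerators of \<open>sphere_moment\<close>, and the even
  ones leave \<open>fact k\<close> and a power of 2.\<close>

lemma bessel_coeff_eq_sphere_moment:
  assumes "p > 0"
  shows "bessel_coeff p 0 k = (2 * real p) ^ k * sphere_moment p k / fact (2 * k)"
proof (induction k)
  case (Suc k)
  have c: "bessel_coeff p 0 (Suc k) = bessel_coeff p 0 k / ((real k + 1) * (1 + 2 * real k / real p))"
    by (simp add: bessel_coeff_def mult_ac)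
  have f: "(fact (2 * Suc k) :: real) = (2 * real k + 2) * ((2 * real k + 1) * fact (2 * k))"
    by (simp add: algebra_simps)
  have m: "sphere_moment p (Suc k) = sphere_moment p k * ((2 * real k + 1) / (real p + 2 * real k))"
    by (simp add: sphere_moment_def algebra_simps)
  have nz: "real p \<noteq> 0" "real p + 2 * real k \<noteq> 0" "2 * real k + 1 \<noteq> 0" "real k + 1 \<noteq> 0" using assms by linarith+
  have e: "(real k + 1) * (1 + 2 * real k / real p) = (real k + 1) * (real p + 2 * real k) / real p"
    using nz by (simp add: field_simps)
  have "2 * real p * ((2 * real k + 1) / (real p + 2 * real k)) / ((2 * real k + 2) * (2 * real k + 1))
      = 1 / ((real k + 1) * (real p + 2 * real k) / real p)"
  proof -
    have "2 * a * (b / c) / (2 * d * b) = 1 / (d * c / a)" if "a \<noteq> 0" "b \<noteq> 0" "c \<noteq> 0" "d \<noteq> 0" for a b c d :: real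
      using that by (simp add: field_simps)
    from this[OF nz(1,3,2,4)] show ?thesis by simp
  qed
  hence "(2 * real p) ^ k * sphere_moment p k / fact (2 * k)
      * (2 * real p * ((2 * real k + 1) / (real p + 2 * real k)) / ((2 * real k + 2) * (2 * real k + 1)))
      = bessel_coeff p 0 (Suc k)"
    unfolding c Suc.IH e by simp
  moreover have "(2 * real p) ^ Suc k * (a * r) / (b * (c * d)) = (2 * real p) ^ k * a / d * (2 * real p * r / (b * c))"
    for a b c d r :: real
    by (simp add: divide_inverse mult_ac)
  ultimately show ?case unfolding f m by simp
qed (simp add: bessel_coeff_def sphere_moment_def)

lemma sphere_exp_eq_bessel:
  assumes "p \<ge> 2"
  shows "has_bochner_integral (sphere_unif p) (\<lambda>x. exp (inner_prod p x u)) (bessel p 0 (inner_prod p u u / (2 * real p)))"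
proof (rule has_bochner_integral_nn_integral)
  define s where "s = inner_prod p u u"
  have s: "s \<ge> 0" by (simp add: s_def inner_prod_self_nonneg)
  define E where "E = (\<integral>\<^sup>+x. ennreal (exp (inner_prod p x u)) \<partial>sphere_unif p)"
  \<comment> \<open>Symmetrising the exponential into \<open>cosh\<close> removes the odd powers.
    All remaining terms are nonnegative, so sum and integral may be exchanged without an
    integrability argument.\<close>
  have E': "E = (\<integral>\<^sup>+x. ennreal (exp (- inner_prod p x u)) \<partial>sphere_unif p)"
  proof -
    have "E = (\<integral>\<^sup>+x. ennreal (exp (inner_prod p x (\<lambda>j. - u j))) \<partial>sphere_unif p)"
      unfolding E_def by (rule nn_integral_sphere_inner_cong[OF assms, of "\<lambda>t. ennreal (exp t)"])
        (auto simp: inner_prod_def)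
    thus ?thesis by (simp add: inner_prod_uminus)
  qed
  have "2 * E = E + E" by (simp add: mult_2)
  also have "\<dots> = (\<integral>\<^sup>+x. ennreal (exp (inner_prod p x u)) + ennreal (exp (- inner_prod p x u)) \<partial>sphere_unif p)"
    by (subst (2) E', unfold E_def) (rule nn_integral_add[symmetric]; measurable)
  also have "\<dots> = (\<integral>\<^sup>+x. 2 * (\<Sum>k. ennreal ((inner_prod p x u) ^ (2 * k) / fact (2 * k))) \<partial>sphere_unif p)"
  proof (rule nn_integral_cong)
    fix x
    define t where "t = inner_prod p x u"
    have "ennreal (exp t) + ennreal (exp (- t)) = ennreal (2 * cosh t)"
      by (simp add: cosh_def ennreal_plus[symmetric] del: ennreal_plus)
    also have "\<dots> = 2 * ennreal (cosh t)" by (simp add: ennreal_mult)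
    also have "ennreal (cosh t) = (\<Sum>k. ennreal (t ^ (2 * k) / fact (2 * k)))"
      using sums_cosh_even[of t] by (subst suminf_ennreal2) (auto simp: sums_iff power_mult)
    finally show "ennreal (exp (inner_prod p x u)) + ennreal (exp (- inner_prod p x u))
        = 2 * (\<Sum>k. ennreal ((inner_prod p x u) ^ (2 * k) / fact (2 * k)))" by (simp add: t_def)
  qed
  also have "\<dots> = 2 * (\<Sum>k. \<integral>\<^sup>+x. ennreal ((inner_prod p x u) ^ (2 * k) / fact (2 * k)) \<partial>sphere_unif p)"
    by (subst nn_integral_cmult) (auto simp: nn_integral_suminf)
  also have "(\<Sum>k. \<integral>\<^sup>+x. ennreal ((inner_prod p x u) ^ (2 * k) / fact (2 * k)) \<partial>sphere_unif p)
      = (\<Sum>k. ennreal (bessel_coeff p 0 k * (s / (2 * real p)) ^ k))"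
  proof (rule suminf_cong)
    fix k
    have "(\<integral>\<^sup>+x. ennreal ((inner_prod p x u) ^ (2 * k) / fact (2 * k)) \<partial>sphere_unif p)
        = (\<integral>\<^sup>+x. ennreal (1 / fact (2 * k)) * ennreal ((inner_prod p x u) ^ (2 * k)) \<partial>sphere_unif p)"
      by (intro nn_integral_cong) (simp add: ennreal_mult[symmetric] power_mult)
    also have "\<dots> = ennreal (1 / fact (2 * k)) * ennreal (s ^ k * sphere_moment p k)"
      by (subst nn_integral_cmult) (auto simp: nn_integral_sphere_even_power[OF assms] s_def)
    also have "\<dots> = ennreal (bessel_coeff p 0 k * (s / (2 * real p)) ^ k)"
      using assms s sphere_moment_nonneg[of p k]
      by (subst ennreal_mult[symmetric]) (auto simp: bessel_coeff_eq_sphere_moment power_divide)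
    finally show "(\<integral>\<^sup>+x. ennreal ((inner_prod p x u) ^ (2 * k) / fact (2 * k)) \<partial>sphere_unif p)
        = ennreal (bessel_coeff p 0 k * (s / (2 * real p)) ^ k)" .
  qed
  also have "\<dots> = ennreal (bessel p 0 (s / (2 * real p)))"
    unfolding bessel_def using s less_imp_le[OF bessel_coeff_pos]
    by (intro suminf_ennreal2 summable_bessel) auto
  finally have "2 * E = 2 * ennreal (bessel p 0 (s / (2 * real p)))" .
  thus "(\<integral>\<^sup>+x. ennreal (exp (inner_prod p x u)) \<partial>sphere_unif p) = ennreal (bessel p 0 (inner_prod p u u / (2 * real p)))"
    unfolding E_def s_def by (rule ennreal_mult_left_cancel_finite) auto
qed (auto intro!: less_imp_le[OF bessel_pos] divide_nonneg_nonneg simp: inner_prod_self_nonneg)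

section \<open>The resultant of a uniform sample\<close>

definition resultant :: "nat \<Rightarrow> (nat \<Rightarrow> nat \<Rightarrow> real) \<Rightarrow> nat \<Rightarrow> real" where
  "resultant n x = (\<lambda>j. \<Sum>i=1..n. x i j)"

text \<open>The \<open>\<rho>\<close> of the overview.\<close>

definition sq_resultant :: "nat \<Rightarrow> nat \<Rightarrow> (nat \<Rightarrow> nat \<Rightarrow> real) \<Rightarrow> real" where
  "sq_resultant n p x = inner_prod p (resultant n x) (resultant n x)"

lemma sq_resultant_nonneg: "sq_resultant n p x \<ge> 0"
  by (simp add: sq_resultant_def inner_prod_self_nonneg)

lemma inner_prod_sample_mean:
  "inner_prod p (sample_mean n p x) (sample_mean n p x) = sq_resultant n p x / (real n)\<^sup>2"
  by (simp add: inner_prod_def sample_mean_def sq_resultant_def resultant_def power2_eq_square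
      sum_divide_distrib[where A = "{..<p}"] sum_divide_distrib[symmetric, where A = "{Suc 0..n}"])

text \<open>Expresses the statistic by \<open>\<rho> / n\<close>, whose deviation from 1 governs
  both the expansion and the limit law. The 2 is \<open>sqrt 2 * sqrt 2\<close>, from the
  standardisation and from \<open>Delta\<close>.\<close>

lemma Delta_eq:
  assumes "n > 0" "p > 0"
  shows "Delta n p x = sqrt (real p) / 2 * (sq_resultant n p x / real n - 1)"
proof -
  have "rayleigh n p x = real p * (sq_resultant n p x / real n)"
    using assms unfolding rayleigh_def norm_vec_square inner_prod_sample_mean
    by (simp add: power2_eq_square)
  hence "Delta n p x = (real p * (sq_resultant n p x / real n) - real p) / (sqrt (2 * real p) * sqrt 2)"
    by (simp add: Delta_def rayleigh_std_def)
  also have "sqrt (2 * real p) * sqrt 2 = 2 * sqrt (real p)"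
    by (simp add: real_sqrt_mult)
  also have "(real p * (sq_resultant n p x / real n) - real p) / (2 * sqrt (real p))
      = (real p / sqrt (real p)) / 2 * (sq_resultant n p x / real n - 1)"
    by (simp add: algebra_simps diff_divide_distrib)
  also have "real p / sqrt (real p) = sqrt (real p)" by (rule real_div_sqrt) simp
  finally show ?thesis .
qed

lemma inner_prod_resultant: "inner_prod p (resultant n x) v = (\<Sum>i=1..n. inner_prod p (x i) v)"
  unfolding inner_prod_def resultant_def sum_distrib_right by (rule sum.swap)

lemma resultant_Suc: "resultant (Suc n) (x(Suc n := y)) = (\<lambda>j. resultant n x j + y j)"
  by (auto simp: resultant_def fun_eq_iff)

text \<open>Expand the square with \<open>|y| = 1\<close>. Beyond the constant 1 the increment is
  linear in the new vector, hence centred and symmetric given the earlier ones.\<close>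

lemma sq_resultant_Suc:
  assumes "y \<in> unit_sphere p"
  shows "sq_resultant (Suc n) p (x(Suc n := y)) = sq_resultant n p x + 1 + 2 * inner_prod p y (resultant n x)"
proof -
  have "inner_prod p y y = 1"
    using assms norm_vec_square[of p y] by (simp add: unit_sphere_def)
  thus ?thesis
    unfolding sq_resultant_def resultant_Suc
    by (simp add: inner_prod_def algebra_simps sum.distrib sum_distrib_left)
qed

section \<open>Measurability and integrability under the null law\<close>

lemma space_P_null: "space (P_null n p) = {1..n} \<rightarrow>\<^sub>E unit_sphere p"
  by (simp add: P_null_def space_PiM)

lemma prob_space_P_null: "p > 0 \<Longrightarrow> prob_space (P_null n p)"
  unfolding P_null_def by (intro prob_space_PiM prob_space_sphere_unif)

lemma measurable_sphere_component: "j < p \<Longrightarrow> (\<lambda>x. x j) \<in> borel_measurable (sphere_unif p)"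
  unfolding measurable_cong_sets[OF sets_sphere_unif refl]
  by (intro measurable_restrict_space1 measurable_euclid_component)

lemma measurable_P_null_entry: "i \<in> {1..n} \<Longrightarrow> j < p \<Longrightarrow> (\<lambda>x. x i j) \<in> borel_measurable (P_null n p)"
  unfolding P_null_def
  by (rule measurable_compose[where N = "sphere_unif p" and f = "\<lambda>x. x i" and g = "\<lambda>x. x j"])
     (auto intro: measurable_sphere_component)

lemma measurable_resultant: "j < p \<Longrightarrow> (\<lambda>x. resultant n x j) \<in> borel_measurable (P_null n p)"
  unfolding resultant_def by (intro borel_measurable_sum measurable_P_null_entry) auto

lemma measurable_sq_resultant [measurable]: "sq_resultant n p \<in> borel_measurable (P_null n p)"
  unfolding sq_resultant_def[abs_def] inner_prod_def
  by (intro borel_measurable_sum borel_measurable_times measurable_resultant) auto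

lemma measurable_inner_resultant [measurable]: "(\<lambda>x. inner_prod p (resultant n x) v) \<in> borel_measurable (P_null n p)"
  unfolding inner_prod_def
  by (intro borel_measurable_sum borel_measurable_times measurable_resultant) auto

lemma measurable_inner_resultant_pair:
  "(\<lambda>(x, v). inner_prod p (resultant n x) v) \<in> borel_measurable (P_null n p \<Otimes>\<^sub>M sphere_unif p)"
  unfolding inner_prod_def case_prod_beta
  by (intro borel_measurable_sum borel_measurable_times
      measurable_compose[OF measurable_fst measurable_resultant]
      measurable_compose[OF measurable_snd measurable_sphere_component]) auto

lemma measurable_Delta [measurable]: "Delta n p \<in> borel_measurable (P_null n p)"
proof -
  show ?thesis
    unfolding Delta_def[abs_def] rayleigh_std_def rayleigh_def norm_vec_square inner_prod_sample_mean
    by measurable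
qed

text \<open>A crude coordinatewise bound; it serves only to make all moments of
  \<open>sq_resultant\<close> integrable.\<close>

lemma sq_resultant_le:
  assumes "x \<in> space (P_null n p)"
  shows "sq_resultant n p x \<le> real p * (real n)\<^sup>2"
proof -
  have "resultant n x j * resultant n x j \<le> (real n)\<^sup>2" if "j < p" for j
  proof -
    have "\<bar>resultant n x j\<bar> \<le> (\<Sum>i=1..n. \<bar>x i j\<bar>)" unfolding resultant_def by (rule sum_abs)
    also have "\<dots> \<le> (\<Sum>i=1..n. 1)"
      using assms that by (intro sum_mono sphere_component_le[of _ p]) (auto simp: space_P_null)
    finally have "\<bar>resultant n x j\<bar> \<le> \<bar>real n\<bar>" by simp
    thus ?thesis unfolding abs_le_square_iff by (simp add: power2_eq_square)
  qed
  hence "sq_resultant n p x \<le> (\<Sum>j<p. (real n)\<^sup>2)"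
    unfolding sq_resultant_def inner_prod_def by (intro sum_mono) auto
  thus ?thesis by simp
qed

lemma integrable_P_null_bounded:
  fixes f :: "_ \<Rightarrow> 'b :: {banach, second_countable_topology}"
  assumes "p > 0" "f \<in> borel_measurable (P_null n p)" "\<And>x. x \<in> space (P_null n p) \<Longrightarrow> norm (f x) \<le> B"
  shows "integrable (P_null n p) f"
proof -
  interpret prob_space "P_null n p" by (rule prob_space_P_null[OF assms(1)])
  show ?thesis using assms by (intro integrable_const_bound[of _ B]) auto
qed

lemma integrable_sphere_inner:
  assumes "p > 0"
  shows "integrable (sphere_unif p) (\<lambda>y. inner_prod p y u)"
proof -
  interpret prob_space "sphere_unif p" by (rule prob_space_sphere_unif[OF assms])
  have "norm (inner_prod p y u) \<le> (\<Sum>j<p. \<bar>u j\<bar>)" if "y \<in> unit_sphere p" for y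
    unfolding inner_prod_def real_norm_def
    by (rule order_trans[OF sum_abs], intro sum_mono)
       (auto simp: abs_mult intro!: mult_left_le_one_le sphere_component_le[OF that])
  thus ?thesis by (intro integrable_const_bound[of _ "\<Sum>j<p. \<bar>u j\<bar>"]) auto
qed

text \<open>The inner integral plays the role of the conditional expectation given the first
  \<open>n\<close> vectors; every recursion over the sample size below rests on it.\<close>

lemma integral_P_null_Suc:
  fixes f :: "_ \<Rightarrow> 'b :: {banach, second_countable_topology}"
  assumes "p > 0" "integrable (P_null (Suc n) p) f"
  shows "(\<integral>x. f x \<partial>P_null (Suc n) p) = (\<integral>x. \<integral>y. f (x(Suc n := y)) \<partial>sphere_unif p \<partial>P_null n p)"
proof -
  interpret product_sigma_finite "\<lambda>_::nat. sphere_unif p"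
    using prob_space_sphere_unif[OF assms(1)]
    by (auto simp: product_sigma_finite_def prob_space_imp_sigma_finite)
  have e: "{1..Suc n} = insert (Suc n) {1..n}" by auto
  show ?thesis
    using assms(2) unfolding P_null_def e by (intro product_integral_insert) auto
qed

section \<open>Mean and variance of the squared resultant\<close>

lemma integral_sphere_affine:
  assumes "p \<ge> 2"
  shows "(\<integral>y. a + c * inner_prod p y u \<partial>sphere_unif p) = a"
proof -
  interpret prob_space "sphere_unif p" using assms by (intro prob_space_sphere_unif) auto
  show ?thesis
    using assms integrable_sphere_inner[of p u] by (simp add: integral_sphere_inner prob_space[simplified])
qed

lemma integral_sphere_affine_square:
  assumes "p \<ge> 2"
  shows "(\<integral>y. (a + c * inner_prod p y u)\<^sup>2 \<partial>sphere_unif p) = a\<^sup>2 + c\<^sup>2 * inner_prod p u u / real p"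
proof -
  interpret prob_space "sphere_unif p" using assms by (intro prob_space_sphere_unif) auto
  have sq: "has_bochner_integral (sphere_unif p) (\<lambda>y. (inner_prod p y u)\<^sup>2) (inner_prod p u u / real p)"
    using integral_sphere_even_power[OF assms, of u 1] by (simp add: sphere_moment_def)
  have i: "integrable (sphere_unif p) (\<lambda>y. inner_prod p y u)"
    using assms by (intro integrable_sphere_inner) auto
  have "(\<integral>y. (a + c * inner_prod p y u)\<^sup>2 \<partial>sphere_unif p)
      = (\<integral>y. (a\<^sup>2 + (2 * a * c) * inner_prod p y u) + c\<^sup>2 * (inner_prod p y u)\<^sup>2 \<partial>sphere_unif p)"
    by (simp add: power2_eq_square algebra_simps)
  also have "\<dots> = (\<integral>y. a\<^sup>2 + (2 * a * c) * inner_prod p y u \<partial>sphere_unif p) + (\<integral>y. c\<^sup>2 * (inner_prod p y u)\<^sup>2 \<partial>sphere_unif p)"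
    using i sq by (intro Bochner_Integration.integral_add) (auto simp: has_bochner_integral_iff)
  also have "\<dots> = a\<^sup>2 + c\<^sup>2 * inner_prod p u u / real p"
    using sq unfolding integral_sphere_affine[OF assms] by (simp add: has_bochner_integral_iff)
  finally show ?thesis .
qed

lemma sq_resultant_moment_integrable:
  assumes "p > 0"
  shows "integrable (P_null n p) (\<lambda>x. (sq_resultant n p x - c) ^ k)"
proof (rule integrable_P_null_bounded[OF assms])
  fix x assume "x \<in> space (P_null n p)"
  hence "\<bar>sq_resultant n p x - c\<bar> \<le> real p * (real n)\<^sup>2 + \<bar>c\<bar>"
    using sq_resultant_le[of x n p] sq_resultant_nonneg[of n p x] by linarith
  thus "norm ((sq_resultant n p x - c) ^ k) \<le> (real p * (real n)\<^sup>2 + \<bar>c\<bar>) ^ k"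
    by (simp add: power_abs power_mono)
qed measurable

lemma sq_resultant_mean:
  assumes "p \<ge> 2"
  shows "(\<integral>x. sq_resultant n p x - real n \<partial>P_null n p) = 0"
proof (induction n)
  case 0
  show ?case by (simp add: sq_resultant_def resultant_def inner_prod_def)
next
  case (Suc n)
  have p: "p > 0" using assms by simp
  have "(\<integral>x. sq_resultant (Suc n) p x - real (Suc n) \<partial>P_null (Suc n) p)
      = (\<integral>x. \<integral>y. sq_resultant (Suc n) p (x(Suc n := y)) - real (Suc n) \<partial>sphere_unif p \<partial>P_null n p)"
    using sq_resultant_moment_integrable[OF p, of "Suc n" "real (Suc n)" 1]
    by (intro integral_P_null_Suc[OF p]) simp
  also have "\<dots> = (\<integral>x. \<integral>y. (sq_resultant n p x - real n) + 2 * inner_prod p y (resultant n x) \<partial>sphere_unif p \<partial>P_null n p)"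
    by (intro Bochner_Integration.integral_cong refl) (auto simp: sq_resultant_Suc algebra_simps)
  finally show ?case unfolding integral_sphere_affine[OF assms] Suc.IH .
qed

lemma sq_resultant_mean':
  assumes "p \<ge> 2"
  shows "(\<integral>x. sq_resultant n p x \<partial>P_null n p) = real n"
proof -
  have p: "p > 0" using assms by simp
  interpret prob_space "P_null n p" using p by (rule prob_space_P_null)
  show ?thesis
    using sq_resultant_mean[OF assms, of n] sq_resultant_moment_integrable[OF p, of n 0 1]
    by (simp add: prob_space)
qed

text \<open>The increments are conditionally centred, so the cross terms vanish and variances add
  up. Passing from \<open>m\<close> to \<open>m + 1\<close> contributes \<open>4 / p\<close> times
  the mean \<open>m\<close> of \<open>\<rho>\<close>.\<close>

lemma sq_resultant_variance:
  assumes "p \<ge> 2"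
  shows "(\<integral>x. (sq_resultant n p x - real n)\<^sup>2 \<partial>P_null n p) = 2 * real n * (real n - 1) / real p"
proof (induction n)
  case 0
  show ?case by (simp add: sq_resultant_def resultant_def inner_prod_def)
next
  case (Suc n)
  have p: "p > 0" using assms by simp
  have "(\<integral>x. (sq_resultant (Suc n) p x - real (Suc n))\<^sup>2 \<partial>P_null (Suc n) p)
      = (\<integral>x. \<integral>y. (sq_resultant (Suc n) p (x(Suc n := y)) - real (Suc n))\<^sup>2 \<partial>sphere_unif p \<partial>P_null n p)"
    by (intro integral_P_null_Suc[OF p] sq_resultant_moment_integrable[OF p])
  also have "\<dots> = (\<integral>x. \<integral>y. ((sq_resultant n p x - real n) + 2 * inner_prod p y (resultant n x))\<^sup>2 \<partial>sphere_unif p \<partial>P_null n p)"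
    by (intro Bochner_Integration.integral_cong refl) (auto simp: sq_resultant_Suc algebra_simps)
  also have "\<dots> = (\<integral>x. (sq_resultant n p x - real n)\<^sup>2 + 4 / real p * sq_resultant n p x \<partial>P_null n p)"
    unfolding integral_sphere_affine_square[OF assms] sq_resultant_def[symmetric] by simp
  also have "\<dots> = 2 * real n * (real n - 1) / real p + 4 / real p * real n"
    using sq_resultant_moment_integrable[OF p, of n 0 1] sq_resultant_moment_integrable[OF p, of n "real n" 2]
    by (simp add: Suc.IH sq_resultant_mean'[OF assms])
  also have "\<dots> = 2 * real (Suc n) * (real (Suc n) - 1) / real p"
    by (simp add: algebra_simps add_divide_distrib[symmetric] diff_divide_distrib[symmetric])
  finally show ?case .
qed

section \<open>Averaging over the tilting direction\<close>

lemma resultant_rotate: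
  assumes "A \<in> SO p"
  shows "inner_prod p (resultant n (rotate_sample n p A x)) (rotate_vec p A v) = inner_prod p (resultant n x) v"
  unfolding inner_prod_resultant
  by (intro sum.cong refl) (simp add: rotate_sample_def inner_prod_rotate[OF assms])

text \<open>A double sum of inner products of pairs, each of which a rotation preserves.\<close>

lemma sq_resultant_rotate:
  assumes "A \<in> SO p"
  shows "sq_resultant n p (rotate_sample n p A x) = sq_resultant n p x"
proof -
  have e: "sq_resultant n p y = (\<Sum>i=1..n. \<Sum>k=1..n. inner_prod p (y k) (y i))" for y
    by (simp add: sq_resultant_def inner_prod_resultant inner_prod_commute[of p _ "resultant n y"])
  show ?thesis
    unfolding e by (intro sum.cong refl) (simp add: rotate_sample_def inner_prod_rotate[OF assms])
qed

lemma rotate_sample_space: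
  "A \<in> SO p \<Longrightarrow> x \<in> space (P_null n p) \<Longrightarrow> rotate_sample n p A x \<in> space (P_null n p)"
  using rotate_vec_unit_sphere[of A p] by (auto simp: space_P_null rotate_sample_def PiE_iff)

lemma rotate_sample_compose: "rotate_sample n p A = compose {1..n} (rotate_vec p A)"
  by (simp add: rotate_sample_def compose_def fun_eq_iff)

lemma measurable_rotate_sample:
  assumes "A \<in> SO p"
  shows "rotate_sample n p A \<in> P_null n p \<rightarrow>\<^sub>M P_null n p"
  unfolding rotate_sample_def[abs_def] P_null_def
proof (rule measurable_restrict)
  fix i assume "i \<in> {1..n}"
  thus "(\<lambda>x. rotate_vec p A (x i)) \<in> (\<Pi>\<^sub>M i\<in>{1..n}. sphere_unif p) \<rightarrow>\<^sub>M sphere_unif p"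
    using measurable_rotate_vec_sphere[OF assms]
    by (rule measurable_compose[OF measurable_component_singleton])
qed

lemma distr_P_null_rotate:
  assumes A: "A \<in> lebesgue_rotations p" and p: "p > 0"
  shows "distr (P_null n p) (P_null n p) (rotate_sample n p A) = P_null n p"
  unfolding P_null_def rotate_sample_compose
  by (subst distr_PiM_finite_prob_space')
     (auto simp: distr_sphere_rotate[OF A p] prob_space_sphere_unif[OF p]
        measurable_rotate_vec_sphere[OF lebesgue_rotations_SO[OF A]])

lemma nn_integral_P_null_rotate:
  assumes A: "A \<in> lebesgue_rotations p" and p: "p > 0" and f: "f \<in> borel_measurable (P_null n p)"
  shows "(\<integral>\<^sup>+x. f (rotate_sample n p A x) \<partial>P_null n p) = (\<integral>\<^sup>+x. f x \<partial>P_null n p)"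
  using nn_integral_distr[OF measurable_rotate_sample[OF lebesgue_rotations_SO[OF A]], of f n]
    distr_P_null_rotate[OF A p] f by simp

lemma unit_sphere_inner: "x \<in> unit_sphere p \<Longrightarrow> inner_prod p x x = 1"
  using norm_vec_square[of p x] by (simp add: unit_sphere_def)

lemma unit_sphere_PiE: "x \<in> unit_sphere p \<Longrightarrow> x \<in> {..<p} \<rightarrow>\<^sub>E UNIV"
  by (simp add: unit_sphere_def space_euclid)

lemma inner_prod_cmult_right: "inner_prod p x (\<lambda>j. c * y j) = c * inner_prod p x y"
  by (simp add: inner_prod_def sum_distrib_left mult_ac)

lemma inner_prod_cmult_left: "inner_prod p (\<lambda>j. c * x j) y = c * inner_prod p x y"
  by (simp add: inner_prod_def sum_distrib_left mult.assoc)

text \<open>By transitivity of the rotations the left-hand side does not depend on \<open>\<theta>\<close>, so \<open>\<theta>\<close> may be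
  averaged over the sphere.\<close>
lemma nn_integral_invariant_tilt:
  assumes p: "p \<ge> 2" and D: "D \<in> sets (P_null n p)" and \<theta>: "\<theta> \<in> unit_sphere p"
    and inv: "\<And>A x. A \<in> SO p \<Longrightarrow> x \<in> space (P_null n p) \<Longrightarrow> rotate_sample n p A x \<in> D \<longleftrightarrow> x \<in> D"
  shows "(\<integral>\<^sup>+x. ennreal (exp (\<kappa> * inner_prod p (resultant n x) \<theta>)) * indicator D x \<partial>P_null n p)
    = (\<integral>\<^sup>+x. ennreal (bessel p 0 (\<kappa>\<^sup>2 * sq_resultant n p x / (2 * real p))) * indicator D x \<partial>P_null n p)"
proof -
  have p0: "p > 0" using p by simp
  interpret \<sigma>: prob_space "sphere_unif p" by (rule prob_space_sphere_unif[OF p0])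
  interpret P: prob_space "P_null n p" by (rule prob_space_P_null[OF p0])
  interpret pair_sigma_finite "P_null n p" "sphere_unif p" ..
  note [measurable] = D
  define F where "F v = (\<integral>\<^sup>+x. ennreal (exp (\<kappa> * inner_prod p (resultant n x) v)) * indicator D x \<partial>P_null n p)" for v
  have F: "F v = F \<theta>" if v: "v \<in> unit_sphere p" for v
  proof -
    obtain A where A: "A \<in> lebesgue_rotations p" "rotate_vec p A \<theta> = v"
      using exists_rotation[OF p unit_sphere_PiE[OF \<theta>] unit_sphere_PiE[OF v]] \<theta> v
      by (auto simp: unit_sphere_inner)
    note S = lebesgue_rotations_SO[OF A(1)]
    have "F v = (\<integral>\<^sup>+x. ennreal (exp (\<kappa> * inner_prod p (resultant n (rotate_sample n p A x)) v))
        * indicator D (rotate_sample n p A x) \<partial>P_null n p)"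
      unfolding F_def by (rule nn_integral_P_null_rotate[OF A(1) p0, symmetric]) measurable
    also have "\<dots> = F \<theta>"
      unfolding F_def
      by (intro nn_integral_cong) (simp add: A(2)[symmetric] resultant_rotate[OF S] inv[OF S] indicator_def)
    finally show ?thesis .
  qed
  have m: "(\<lambda>(x, v). ennreal (exp (\<kappa> * inner_prod p (resultant n x) v)) * indicator D x)
      \<in> borel_measurable (P_null n p \<Otimes>\<^sub>M sphere_unif p)"
    using measurable_inner_resultant_pair[of p n] by (simp add: case_prod_beta)
  \<comment> \<open>A constant integrated over a probability measure. Afterwards \<open>F v\<close>
    replaces it, and Fubini leaves a Laplace transform of the uniform law for each fixed
    sample.\<close>
  have "F \<theta> = (\<integral>\<^sup>+v. F \<theta> \<partial>sphere_unif p)"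
    by (simp add: \<sigma>.emeasure_space_1[simplified])
  also have "\<dots> = (\<integral>\<^sup>+v. F v \<partial>sphere_unif p)"
    by (intro nn_integral_cong) (simp add: F)
  also have "\<dots> = (\<integral>\<^sup>+x. \<integral>\<^sup>+v. ennreal (exp (\<kappa> * inner_prod p (resultant n x) v)) * indicator D x \<partial>sphere_unif p \<partial>P_null n p)"
    unfolding F_def by (rule Fubini'[OF m])
  also have "\<dots> = (\<integral>\<^sup>+x. ennreal (bessel p 0 (\<kappa>\<^sup>2 * sq_resultant n p x / (2 * real p))) * indicator D x \<partial>P_null n p)"
  proof (rule nn_integral_cong)
    fix x
    define u where "u = (\<lambda>j. \<kappa> * resultant n x j)"
    have u: "\<kappa> * inner_prod p (resultant n x) v = inner_prod p v u" for v
      unfolding u_def by (simp add: inner_prod_commute[of p v] inner_prod_cmult_left)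
    have uu: "inner_prod p u u = \<kappa>\<^sup>2 * sq_resultant n p x"
      unfolding u_def sq_resultant_def by (simp add: inner_prod_def sum_distrib_left power2_eq_square mult_ac)
    have b: "has_bochner_integral (sphere_unif p) (\<lambda>v. exp (inner_prod p v u)) (bessel p 0 (inner_prod p u u / (2 * real p)))"
      by (rule sphere_exp_eq_bessel[OF p])
    have "(\<integral>\<^sup>+v. ennreal (exp (inner_prod p v u)) \<partial>sphere_unif p) = ennreal (bessel p 0 (inner_prod p u u / (2 * real p)))"
      using b by (subst nn_integral_eq_integral) (auto simp: has_bochner_integral_iff)
    thus "(\<integral>\<^sup>+v. ennreal (exp (\<kappa> * inner_prod p (resultant n x) v)) * indicator D x \<partial>sphere_unif p)
        = ennreal (bessel p 0 (\<kappa>\<^sup>2 * sq_resultant n p x / (2 * real p))) * indicator D x"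
      unfolding u uu by (subst nn_integral_multc) auto
  qed
  finally show ?thesis by (simp add: F_def)
qed

text \<open>The total area \<open>c\<close> cancels between the normalisation of
  \<open>sphere_unif\<close> and the integral in \<open>fvml\<close>. What remains is the Laplace
  transform at \<open>\<kappa> * \<theta>\<close>, whose squared length is
  \<open>\<kappa>^2\<close>.\<close>

lemma fvml_density:
  assumes p: "p \<ge> 2" and \<theta>: "\<theta> \<in> unit_sphere p"
  shows "fvml p \<theta> \<kappa> = density (sphere_unif p)
    (\<lambda>x. ennreal (exp (\<kappa> * inner_prod p x \<theta>) / bessel p 0 (\<kappa>\<^sup>2 / (2 * real p))))"
proof -
  define c where "c = measure (surface_measure p) (unit_sphere p)"
  define H where "H = bessel p 0 (\<kappa>\<^sup>2 / (2 * real p))"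
  have H: "H > 0" unfolding H_def by (rule bessel_pos) simp
  have c: "emeasure (surface_measure p) (unit_sphere p) = ennreal c" "c > 0"
  proof -
    have nz: "emeasure (surface_measure p) (unit_sphere p) \<noteq> 0" "emeasure (surface_measure p) (unit_sphere p) \<noteq> \<infinity>"
      using p by (intro emeasure_surface_nontrivial; simp)+
    thus "emeasure (surface_measure p) (unit_sphere p) = ennreal c"
      unfolding c_def by (intro emeasure_eq_ennreal_measure) auto
    with nz(1) show "c > 0" by (metis ennreal_eq_0_iff not_le)
  qed
  have S: "sphere_unif p = density (surface_measure p) (\<lambda>x. ennreal (1 / c))"
  proof -
    have "sphere_unif p = density (surface_measure p) (\<lambda>x. indicator (unit_sphere p) x / ennreal c)"
      unfolding sphere_unif_def uniform_measure_def c(1) ..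
    also have "\<dots> = density (surface_measure p) (\<lambda>x. ennreal (1 / c))"
    proof (rule density_cong)
      have "unit_sphere p \<in> sets (surface_measure p)" using sets.top[of "surface_measure p"] by simp
      thus "(\<lambda>x. indicator (unit_sphere p) x / ennreal c) \<in> borel_measurable (surface_measure p)" by simp
      show "AE x in surface_measure p. indicator (unit_sphere p) x / ennreal c = ennreal (1 / c)"
        using c(2) by (intro AE_I2) (simp add: divide_ennreal[symmetric])
    qed simp
    finally show ?thesis .
  qed
  have m: "(\<lambda>x. inner_prod p x \<theta>) \<in> borel_measurable (surface_measure p)"
    unfolding measurable_cong_sets[OF sets_surface_measure refl]
    by (intro measurable_restrict_space1 measurable_inner_prod)
  have "has_bochner_integral (sphere_unif p) (\<lambda>x. exp (inner_prod p x (\<lambda>j. \<kappa> * \<theta> j)))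
      (bessel p 0 (inner_prod p (\<lambda>j. \<kappa> * \<theta> j) (\<lambda>j. \<kappa> * \<theta> j) / (2 * real p)))"
    by (rule sphere_exp_eq_bessel[OF p])
  moreover have "inner_prod p (\<lambda>j. \<kappa> * \<theta> j) (\<lambda>j. \<kappa> * \<theta> j) = \<kappa>\<^sup>2"
    by (simp add: inner_prod_cmult_left inner_prod_cmult_right unit_sphere_inner[OF \<theta>] power2_eq_square)
  moreover have "inner_prod p x (\<lambda>j. \<kappa> * \<theta> j) = \<kappa> * inner_prod p x \<theta>" for x
    by (rule inner_prod_cmult_right)
  ultimately have "(\<integral>x. exp (\<kappa> * inner_prod p x \<theta>) \<partial>sphere_unif p) = H"
    by (simp add: has_bochner_integral_iff H_def)
  hence "(\<integral>x. exp (\<kappa> * inner_prod p x \<theta>) \<partial>surface_measure p) = c * H"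
    unfolding S using c m by (subst (asm) integral_density) (auto simp: field_simps)
  hence "fvml p \<theta> \<kappa> = density (surface_measure p) (\<lambda>x. ennreal (exp (\<kappa> * inner_prod p x \<theta>) / (c * H)))"
    unfolding fvml_def by simp
  also have "\<dots> = density (density (surface_measure p) (\<lambda>x. ennreal (1 / c))) (\<lambda>x. ennreal (exp (\<kappa> * inner_prod p x \<theta>) / H))"
    using m H c(2) by (subst density_density_eq) (auto intro!: density_cong simp: ennreal_mult[symmetric])
  finally show ?thesis unfolding S[symmetric] H_def .
qed

lemma PiM_density:
  fixes g :: "'b \<Rightarrow> ennreal"
  assumes "prob_space M" and g [measurable]: "g \<in> borel_measurable M" and "sigma_finite_measure (density M g)" "finite I"
  shows "Pi\<^sub>M I (\<lambda>_. density M g) = density (Pi\<^sub>M I (\<lambda>_. M)) (\<lambda>x. \<Prod>i\<in>I. g (x i))"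
proof (rule sym, rule product_sigma_finite.PiM_eqI)
  interpret M: prob_space M by fact
  interpret PM: product_sigma_finite "\<lambda>_. M" by standard
  show "product_sigma_finite (\<lambda>_. density M g)" using assms(3) by (simp add: product_sigma_finite_def)
  show "sets (density (Pi\<^sub>M I (\<lambda>_. M)) (\<lambda>x. \<Prod>i\<in>I. g (x i))) = sets (Pi\<^sub>M I (\<lambda>_. density M g))"
    unfolding sets_density by (intro sets_PiM_cong) auto
  fix A assume "\<And>i. i \<in> I \<Longrightarrow> A i \<in> sets (density M g)"
  hence A [measurable]: "\<And>i. i \<in> I \<Longrightarrow> A i \<in> sets M" by simp
  have "emeasure (density (Pi\<^sub>M I (\<lambda>_. M)) (\<lambda>x. \<Prod>i\<in>I. g (x i))) (Pi\<^sub>E I A)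
      = (\<integral>\<^sup>+x. (\<Prod>i\<in>I. g (x i)) * indicator (Pi\<^sub>E I A) x \<partial>Pi\<^sub>M I (\<lambda>_. M))"
    using assms(4) A by (intro emeasure_density sets_PiM_I_finite) auto
  also have "\<dots> = (\<integral>\<^sup>+x. (\<Prod>i\<in>I. g (x i) * indicator (A i) (x i)) \<partial>Pi\<^sub>M I (\<lambda>_. M))"
  proof (rule nn_integral_cong)
    fix x assume "x \<in> space (Pi\<^sub>M I (\<lambda>_. M))"
    hence "indicator (Pi\<^sub>E I A) x = (\<Prod>i\<in>I. indicator (A i) (x i) :: ennreal)"
      using assms(4) by (auto simp: indicator_def space_PiM PiE_iff)
    thus "(\<Prod>i\<in>I. g (x i)) * indicator (Pi\<^sub>E I A) x = (\<Prod>i\<in>I. g (x i) * indicator (A i) (x i))"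
      by (simp add: prod.distrib)
  qed
  also have "\<dots> = (\<Prod>i\<in>I. \<integral>\<^sup>+y. g y * indicator (A i) y \<partial>M)"
    using assms(4) A by (intro PM.product_nn_integral_prod) auto
  also have "\<dots> = (\<Prod>i\<in>I. emeasure (density M g) (A i))"
    using A by (intro prod.cong refl) (simp add: emeasure_density)
  finally show "emeasure (density (Pi\<^sub>M I (\<lambda>_. M)) (\<lambda>x. \<Prod>i\<in>I. g (x i))) (Pi\<^sub>E I A) = (\<Prod>i\<in>I. emeasure (density M g) (A i))" .
qed (use assms in auto)

text \<open>The exponents of the individual tilts add up, so the sample enters through its resultant
  only.\<close>

lemma P_fvml_density:
  assumes p: "p \<ge> 2" and \<theta>: "\<theta> \<in> unit_sphere p"
  shows "P_fvml n p \<theta> \<kappa> = density (P_null n p)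
    (\<lambda>x. ennreal (exp (\<kappa> * inner_prod p (resultant n x) \<theta>) / bessel p 0 (\<kappa>\<^sup>2 / (2 * real p)) ^ n))"
proof -
  define H where "H = bessel p 0 (\<kappa>\<^sup>2 / (2 * real p))"
  have H: "H > 0" unfolding H_def by (rule bessel_pos) simp
  define g where "g x = ennreal (exp (\<kappa> * inner_prod p x \<theta>) / H)" for x
  have g [measurable]: "g \<in> borel_measurable (sphere_unif p)" unfolding g_def by measurable
  have P: "prob_space (sphere_unif p)" using p by (intro prob_space_sphere_unif) simp
  have sf: "sigma_finite_measure (density (sphere_unif p) g)"
    using P by (subst sigma_finite_measure.sigma_finite_iff_density_finite')
      (auto simp: g_def prob_space_imp_sigma_finite)
  have "P_fvml n p \<theta> \<kappa> = density (P_null n p) (\<lambda>x. \<Prod>i\<in>{1..n}. g (x i))"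
    unfolding P_fvml_def fvml_density[OF p \<theta>] H_def[symmetric] g_def[symmetric] P_null_def
    by (rule PiM_density[OF P g sf]) simp
  also have "(\<lambda>x. \<Prod>i\<in>{1..n}. g (x i)) = (\<lambda>x. ennreal (exp (\<kappa> * inner_prod p (resultant n x) \<theta>) / H ^ n))"
  proof
    fix x :: "nat \<Rightarrow> nat \<Rightarrow> real"
    have "(\<Prod>i\<in>{1..n}. g (x i)) = ennreal (\<Prod>i\<in>{1..n}. exp (\<kappa> * inner_prod p (x i) \<theta>) / H)"
      unfolding g_def using H by (intro prod_ennreal) auto
    also have "(\<Prod>i\<in>{1..n}. exp (\<kappa> * inner_prod p (x i) \<theta>) / H) = exp (\<kappa> * inner_prod p (resultant n x) \<theta>) / H ^ n"
      by (simp add: prod_dividef exp_sum[symmetric] inner_prod_resultant sum_distrib_left)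
    finally show "(\<Prod>i\<in>{1..n}. g (x i)) = ennreal (exp (\<kappa> * inner_prod p (resultant n x) \<theta>) / H ^ n)" .
  qed
  finally show ?thesis unfolding H_def .
qed

section \<open>The likelihood ratio of the maximal invariant\<close>

lemma space_statistic_space [simp]: "space (statistic_space M T) = T ` space M"
  unfolding statistic_space_def by (rule space_measure_of) auto

lemma sets_statistic_spaceI:
  "B \<subseteq> T ` space M \<Longrightarrow> T -` B \<inter> space M \<in> sets M \<Longrightarrow> B \<in> sets (statistic_space M T)"
  unfolding statistic_space_def by (subst sets_measure_of) (auto intro: sigma_sets.Basic)

lemma measurable_statistic: "T \<in> M \<rightarrow>\<^sub>M statistic_space M T"
  unfolding statistic_space_def by (rule measurable_measure_of) auto

lemma statistic_space_cong:
  assumes "sets M = sets N"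
  shows "statistic_space M T = statistic_space N T"
  unfolding statistic_space_def assms sets_eq_imp_space_eq[OF assms] ..

text \<open>\<open>statistic_space\<close> makes every \<open>T\<close> measurable by construction,
  and \<open>RN_deriv\<close> is always Borel.\<close>

lemma measurable_likelihood_ratio:
  "likelihood_ratio M N T \<in> borel_measurable M"
proof -
  have "(\<lambda>t. RN_deriv (image_law M T) (image_law N T) t) \<in> borel_measurable (statistic_space M T)"
    using borel_measurable_RN_deriv[of "image_law M T" "image_law N T"] by (simp add: image_law_def)
  from measurable_compose[OF measurable_statistic this]
  show ?thesis unfolding likelihood_ratio_def[abs_def] by measurable
qed

text \<open>The claimed ratio is rotation invariant, so it factors through \<open>T\<close>. The
  factor is shown to be a density of one image law with respect to the other, and uniqueness of the
  Radon-Nikodym derivative gives equality almost everywhere.\<close>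

lemma likelihood_ratio_fvml:
  assumes p: "p \<ge> 2" and \<theta>: "\<theta> \<in> unit_sphere p"
    and T: "maximal_invariant (SO p) (rotate_sample n p) ({1..n} \<rightarrow>\<^sub>E unit_sphere p) T"
  shows "AE x in P_null n p. likelihood_ratio (P_null n p) (P_fvml n p \<theta> \<kappa>) T x
    = bessel p 0 (\<kappa>\<^sup>2 * sq_resultant n p x / (2 * real p)) / bessel p 0 (\<kappa>\<^sup>2 / (2 * real p)) ^ n"
proof -
  have p0: "p > 0" using p by simp
  interpret P: prob_space "P_null n p" by (rule prob_space_P_null[OF p0])
  define M where "M = P_null n p"
  define H where "H = bessel p 0 (\<kappa>\<^sup>2 / (2 * real p)) ^ n"
  have H: "H > 0" unfolding H_def by (intro zero_less_power bessel_pos) simp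
  define q where "q x = bessel p 0 (\<kappa>\<^sup>2 * sq_resultant n p x / (2 * real p)) / H" for x
  have q0: "q x \<ge> 0" for x
    unfolding q_def using H sq_resultant_nonneg[of n p x]
    by (intro divide_nonneg_nonneg less_imp_le[OF bessel_pos]) auto
  have mb: "bessel p 0 \<in> borel_measurable borel"
    by (intro borel_measurable_continuous_onI DERIV_continuous_on[where D = "bessel p (Suc 0)"])
       (auto intro: has_field_derivative_at_within[OF DERIV_bessel])
  have q [measurable]: "q \<in> borel_measurable M"
    unfolding q_def M_def by (intro borel_measurable_divide measurable_compose[OF _ mb]) measurable
  have sp: "space M = {1..n} \<rightarrow>\<^sub>E unit_sphere p" by (simp add: M_def space_P_null)
  have Tinv: "T (rotate_sample n p A x) = T x" if "A \<in> SO p" "x \<in> space M" for A x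
    using T that by (simp add: maximal_invariant_def sp)
  \<comment> \<open>Maximality of \<open>T\<close> is used here: equal values force the two samples
    to be rotations of each other.\<close>
  have qT: "q x = q y" if "x \<in> space M" "y \<in> space M" "T x = T y" for x y
  proof -
    from T that obtain A where "A \<in> SO p" "y = rotate_sample n p A x"
      unfolding maximal_invariant_def sp by blast
    thus ?thesis by (simp add: q_def sq_resultant_rotate)
  qed
  \<comment> \<open>The value at an arbitrary sample in the fibre of \<open>t\<close>; by
    \<open>qT\<close> the choice is immaterial.\<close>
  define r where "r t = q (SOME x. x \<in> space M \<and> T x = t)" for t
  have rT: "r (T x) = q x" if "x \<in> space M" for x
  proof -
    have "(SOME y. y \<in> space M \<and> T y = T x) \<in> space M \<and> T (SOME y. y \<in> space M \<and> T y = T x) = T x"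
      by (rule someI[of _ x]) (use that in auto)
    thus ?thesis unfolding r_def using qT that by blast
  qed
  define Q where "Q = statistic_space M T"
  have r: "r \<in> borel_measurable Q"
  proof (rule measurableI)
    fix C :: "real set" assume C: "C \<in> sets borel"
    \<comment> \<open>A set belongs to \<open>Q\<close> as soon as its preimage under
      \<open>T\<close> is measurable, so measurability of \<open>r\<close> reduces to that of
      \<open>q\<close>.\<close>
    have "T -` (r -` C \<inter> T ` space M) \<inter> space M = q -` C \<inter> space M"
      by (auto simp: rT[symmetric])
    moreover have "q -` C \<inter> space M \<in> sets M" using C by measurable
    ultimately show "r -` C \<inter> space Q \<in> sets Q"
      unfolding Q_def by (auto intro!: sets_statistic_spaceI)
  qed simp
  have sN: "sets (P_fvml n p \<theta> \<kappa>) = sets M"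
    unfolding P_fvml_density[OF p \<theta>] M_def by simp
  \<comment> \<open>\<open>image_law\<close> builds its target from the measure at hand. Both
    hypotheses have the same measurable sets, so the two images live on the same space
    \<open>Q\<close>.\<close>
  have imN: "image_law (P_fvml n p \<theta> \<kappa>) T = distr (P_fvml n p \<theta> \<kappa>) Q T"
    unfolding image_law_def Q_def by (simp add: statistic_space_cong[OF sN])
  have TM: "T \<in> M \<rightarrow>\<^sub>M Q" unfolding Q_def by (rule measurable_statistic)
  have TN: "T \<in> P_fvml n p \<theta> \<kappa> \<rightarrow>\<^sub>M Q"
    using TM measurable_cong_sets[OF sN refl] by blast
  interpret I: prob_space "image_law M T"
    unfolding image_law_def M_def by (intro P.prob_space_distr measurable_statistic)
  have "density (image_law M T) (\<lambda>t. ennreal (r t)) = image_law (P_fvml n p \<theta> \<kappa>) T"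
  proof (rule measure_eqI)
    show "sets (density (image_law M T) (\<lambda>t. ennreal (r t))) = sets (image_law (P_fvml n p \<theta> \<kappa>) T)"
      by (simp add: imN) (simp add: image_law_def Q_def)
    fix B assume "B \<in> sets (density (image_law M T) (\<lambda>t. ennreal (r t)))"
    hence B: "B \<in> sets Q" by (simp add: image_law_def Q_def)
    define D where "D = T -` B \<inter> space M"
    have D: "D \<in> sets M" unfolding D_def by (rule measurable_sets[OF TM B])
    note [measurable] = D[unfolded M_def]
    \<comment> \<open>The invariance half of \<open>maximal_invariant\<close>: events expressed
      through \<open>T\<close> are unchanged by rotations, as
      \<open>nn_integral_invariant_tilt\<close> demands.\<close>
    have inv: "rotate_sample n p A x \<in> D \<longleftrightarrow> x \<in> D" if "A \<in> SO p" "x \<in> space M" for A x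
      using that rotate_sample_space[of A p x n] by (simp add: D_def Tinv) (simp add: M_def)
    have mq: "(\<lambda>x. ennreal (bessel p 0 (\<kappa>\<^sup>2 * sq_resultant n p x / (2 * real p)))) \<in> borel_measurable M"
      unfolding M_def by (intro measurable_compose[OF measurable_compose[OF _ mb] measurable_ennreal]) measurable
    have "emeasure (density (image_law M T) (\<lambda>t. ennreal (r t))) B = (\<integral>\<^sup>+t. ennreal (r t) * indicator B t \<partial>image_law M T)"
      using r B by (intro emeasure_density) (auto simp: image_law_def Q_def)
    also have "\<dots> = (\<integral>\<^sup>+x. ennreal (r (T x)) * indicator B (T x) \<partial>M)"
      unfolding image_law_def Q_def[symmetric] using TM r B
      by (intro nn_integral_distr) auto
    also have "\<dots> = (\<integral>\<^sup>+x. ennreal (1 / H) * (ennreal (bessel p 0 (\<kappa>\<^sup>2 * sq_resultant n p x / (2 * real p))) * indicator D x) \<partial>M)"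
      using H q0 sq_resultant_nonneg[of n p]
      by (intro nn_integral_cong)
         (auto simp: rT D_def indicator_def q_def ennreal_mult[symmetric] less_imp_le[OF bessel_pos])
    also have "\<dots> = ennreal (1 / H) * (\<integral>\<^sup>+x. ennreal (bessel p 0 (\<kappa>\<^sup>2 * sq_resultant n p x / (2 * real p))) * indicator D x \<partial>M)"
      using mq D by (intro nn_integral_cmult) auto
    also have "(\<integral>\<^sup>+x. ennreal (bessel p 0 (\<kappa>\<^sup>2 * sq_resultant n p x / (2 * real p))) * indicator D x \<partial>M)
        = (\<integral>\<^sup>+x. ennreal (exp (\<kappa> * inner_prod p (resultant n x) \<theta>)) * indicator D x \<partial>M)"
      unfolding M_def
      by (rule nn_integral_invariant_tilt[OF p _ \<theta>, symmetric]) (use D inv in \<open>auto simp: M_def\<close>)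
    also have "ennreal (1 / H) * \<dots> = (\<integral>\<^sup>+x. ennreal (1 / H) * (ennreal (exp (\<kappa> * inner_prod p (resultant n x) \<theta>)) * indicator D x) \<partial>M)"
      unfolding M_def by (intro nn_integral_cmult[symmetric]) measurable
    also have "\<dots> = (\<integral>\<^sup>+x. ennreal (exp (\<kappa> * inner_prod p (resultant n x) \<theta>) / H) * indicator D x \<partial>M)"
      using H by (intro nn_integral_cong) (auto simp: ennreal_mult[symmetric] indicator_def)
    also have "\<dots> = emeasure (P_fvml n p \<theta> \<kappa>) D"
      unfolding P_fvml_density[OF p \<theta>] H_def[symmetric] M_def[symmetric]
      using D by (intro emeasure_density[symmetric]) (auto simp: M_def)
    also have "\<dots> = emeasure (image_law (P_fvml n p \<theta> \<kappa>) T) B"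
      unfolding imN D_def using TN B sets_eq_imp_space_eq[OF sN] by (simp add: emeasure_distr)
    finally show "emeasure (density (image_law M T) (\<lambda>t. ennreal (r t))) B = emeasure (image_law (P_fvml n p \<theta> \<kappa>) T) B" .
  qed
  hence "AE t in image_law M T. ennreal (r t) = RN_deriv (image_law M T) (image_law (P_fvml n p \<theta> \<kappa>) T) t"
    using r by (intro I.RN_deriv_unique) (auto simp: image_law_def Q_def)
  hence "AE x in M. ennreal (r (T x)) = RN_deriv (image_law M T) (image_law (P_fvml n p \<theta> \<kappa>) T) (T x)"
    unfolding image_law_def[of M] by (rule AE_distrD[OF measurable_statistic])
  hence "AE x in M. likelihood_ratio M (P_fvml n p \<theta> \<kappa>) T x = q x"
    using AE_space
  proof eventually_elim
    case (elim x)
    hence "likelihood_ratio M (P_fvml n p \<theta> \<kappa>) T x = enn2real (ennreal (q x))"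
      by (simp add: likelihood_ratio_def rT)
    thus ?case using q0 by simp
  qed
  thus ?thesis unfolding M_def q_def H_def .
qed

section \<open>Asymptotic normality\<close>

lemma cos_taylor_4: "\<bar>cos (x::real) - (1 - x\<^sup>2 / 2)\<bar> \<le> x ^ 4 / 24"
proof -
  obtain t where t: "cos x = (\<Sum>m<4. cos_coeff m * x ^ m) + cos (t + 1 / 2 * real 4 * pi) / fact 4 * x ^ 4"
    using Maclaurin_cos_expansion[of x 4] by blast
  have "(\<Sum>m<4. cos_coeff m * x ^ m) = 1 - x\<^sup>2 / 2"
    by (simp add: lessThan_nat_numeral cos_coeff_def fact_numeral)
  hence "\<bar>cos x - (1 - x\<^sup>2 / 2)\<bar> = \<bar>cos (t + 1 / 2 * real 4 * pi)\<bar> * x ^ 4 / fact 4"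
    using t by (simp add: abs_mult)
  also have "\<dots> \<le> 1 * x ^ 4 / fact 4"
    by (intro divide_right_mono mult_right_mono abs_cos_le_one) auto
  also have "\<dots> = x ^ 4 / 24" by (simp add: fact_numeral)
  finally show ?thesis .
qed

lemma exp_minus_taylor_2:
  assumes "q \<ge> 0"
  shows "\<bar>(1 - q) - exp (- q)\<bar> \<le> q\<^sup>2 / (2::real)"
proof -
  have "1 - q \<le> exp (- q)" using exp_ge_add_one_self[of "- q"] by simp
  moreover have "exp (- q) \<le> 1 - q + q\<^sup>2 / 2"
  proof -
    define F where "F x = 1 - x + x\<^sup>2 / 2 - exp (- x)" for x :: real
    have "F 0 \<le> F q"
    proof (rule DERIV_nonneg_imp_nondecreasing[OF assms])
      fix x :: real
      have "(F has_real_derivative (- 1 + x + exp (- x))) (at x)"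
        unfolding F_def by (auto intro!: derivative_eq_intros)
      thus "\<exists>y. (F has_real_derivative y) (at x) \<and> 0 \<le> y"
        using exp_ge_add_one_self[of "- x"] by (intro exI conjI) auto
    qed
    thus ?thesis by (simp add: F_def)
  qed
  ultimately show ?thesis by simp
qed

text \<open>The sine part vanishes because \<open>u\<close> and \<open>- u\<close> give the same
  law, so the transform is real. Its error beyond the quadratic term is governed by the fourth
  moment, and \<open>3 / 24\<close> yields the constant \<open>1 / 8\<close>.\<close>

lemma sphere_char_expansion:
  fixes c :: real
  assumes p: "p \<ge> 2"
  shows "(\<integral>y. iexp (c * inner_prod p y u) \<partial>sphere_unif p) = complex_of_real (\<integral>y. cos (c * inner_prod p y u) \<partial>sphere_unif p)"
    and "\<bar>(\<integral>y. cos (c * inner_prod p y u) \<partial>sphere_unif p) - (1 - c\<^sup>2 * inner_prod p u u / (2 * real p))\<bar>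
      \<le> c ^ 4 * (inner_prod p u u)\<^sup>2 / (8 * (real p)\<^sup>2)"
proof -
  interpret prob_space "sphere_unif p" using p by (intro prob_space_sphere_unif) auto
  have ic: "integrable (sphere_unif p) (\<lambda>y. cos (c * inner_prod p y u))"
    and isn: "integrable (sphere_unif p) (\<lambda>y. sin (c * inner_prod p y u))"
    by (intro integrable_const_bound[of _ 1]; simp)+
  have "(\<integral>y. sin (c * inner_prod p y u) \<partial>sphere_unif p) = (\<integral>y. sin (c * inner_prod p y (\<lambda>j. - u j)) \<partial>sphere_unif p)"
    by (rule integral_sphere_inner_cong[OF p, of "\<lambda>t. sin (c * t)"]) (auto simp: inner_prod_def)
  hence s0: "(\<integral>y. sin (c * inner_prod p y u) \<partial>sphere_unif p) = 0"
    by (simp add: inner_prod_uminus)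
  have "(\<integral>y. iexp (c * inner_prod p y u) \<partial>sphere_unif p)
      = (\<integral>y. complex_of_real (cos (c * inner_prod p y u)) + \<i> * complex_of_real (sin (c * inner_prod p y u)) \<partial>sphere_unif p)"
    by (intro Bochner_Integration.integral_cong refl, simp only: cis_conv_exp[symmetric]) (simp add: complex_eq_iff)
  also have "\<dots> = complex_of_real (\<integral>y. cos (c * inner_prod p y u) \<partial>sphere_unif p)"
    using ic isn by (subst Bochner_Integration.integral_add) (auto simp: s0)
  finally show "(\<integral>y. iexp (c * inner_prod p y u) \<partial>sphere_unif p) = complex_of_real (\<integral>y. cos (c * inner_prod p y u) \<partial>sphere_unif p)" .
  have m2: "has_bochner_integral (sphere_unif p) (\<lambda>y. (inner_prod p y u)\<^sup>2) (inner_prod p u u / real p)"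
    using integral_sphere_even_power[OF p, of u 1] by (simp add: sphere_moment_def)
  have m4: "has_bochner_integral (sphere_unif p) (\<lambda>y. (inner_prod p y u) ^ 4) ((inner_prod p u u)\<^sup>2 * sphere_moment p 2)"
    using integral_sphere_even_power[OF p, of u 2] by simp
  have "sphere_moment p 2 = 3 / (real p * (real p + 2))"
    by (simp add: sphere_moment_def eval_nat_numeral)
  also have "\<dots> \<le> 3 / (real p)\<^sup>2"
    using p by (intro divide_left_mono) (auto simp: power2_eq_square)
  finally have sm: "sphere_moment p 2 \<le> 3 / (real p)\<^sup>2" .
  have i1: "integrable (sphere_unif p) (\<lambda>y. 1 - (c * inner_prod p y u)\<^sup>2 / 2)"
    using m2 by (auto simp: has_bochner_integral_iff power_mult_distrib)
  have "(\<integral>y. cos (c * inner_prod p y u) \<partial>sphere_unif p) - (1 - c\<^sup>2 * inner_prod p u u / (2 * real p))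
      = (\<integral>y. cos (c * inner_prod p y u) - (1 - (c * inner_prod p y u)\<^sup>2 / 2) \<partial>sphere_unif p)"
    using ic i1 m2
    by (simp add: has_bochner_integral_iff power_mult_distrib prob_space[simplified])
  also have "\<bar>\<dots>\<bar> \<le> (\<integral>y. \<bar>cos (c * inner_prod p y u) - (1 - (c * inner_prod p y u)\<^sup>2 / 2)\<bar> \<partial>sphere_unif p)"
    by (rule integral_abs_bound)
  also have "\<dots> \<le> (\<integral>y. (c * inner_prod p y u) ^ 4 / 24 \<partial>sphere_unif p)"
    using m4 by (intro integral_mono integrable_abs Bochner_Integration.integrable_diff[OF ic i1] cos_taylor_4)
      (auto simp: has_bochner_integral_iff power_mult_distrib)
  also have "\<dots> = c ^ 4 / 24 * ((inner_prod p u u)\<^sup>2 * sphere_moment p 2)"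
    using m4 by (simp add: has_bochner_integral_iff power_mult_distrib)
  also have "\<dots> \<le> c ^ 4 / 24 * ((inner_prod p u u)\<^sup>2 * (3 / (real p)\<^sup>2))"
    by (intro mult_left_mono sm) auto
  also have "\<dots> = c ^ 4 * (inner_prod p u u)\<^sup>2 / (8 * (real p)\<^sup>2)" by simp
  finally show "\<bar>(\<integral>y. cos (c * inner_prod p y u) \<partial>sphere_unif p) - (1 - c\<^sup>2 * inner_prod p u u / (2 * real p))\<bar>
      \<le> c ^ 4 * (inner_prod p u u)\<^sup>2 / (8 * (real p)\<^sup>2)" .
qed

lemma sq_resultant_abs_mean_le:
  assumes p: "p \<ge> 2" and n: "m \<le> n" "n > 0"
  shows "(\<integral>x. \<bar>sq_resultant m p x - real m\<bar> \<partial>P_null m p) \<le> 3 * real n / (2 * sqrt (real p))"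
proof -
  have p0: "p > 0" using p by simp
  interpret prob_space "P_null m p" by (rule prob_space_P_null[OF p0])
  \<comment> \<open>The weight of the arithmetic-geometric inequality \<open>amgm\<close>, chosen to
    balance its two terms: the variance is at most \<open>2 * n^2 / p\<close>, so they are
    \<open>2 * n / sqrt p\<close> and \<open>n / sqrt p\<close>.\<close>
  define \<eta> where "\<eta> = sqrt (real p) / real n"
  have \<eta>: "\<eta> > 0" using p n by (simp add: \<eta>_def)
  have i: "integrable (P_null m p) (\<lambda>x. (sq_resultant m p x - real m) ^ k)" for k
    by (rule sq_resultant_moment_integrable[OF p0])
  have amgm: "\<bar>d\<bar> \<le> (\<eta> * d\<^sup>2 + 1 / \<eta>) / 2" for d
  proof -
    have "0 \<le> (\<eta> * \<bar>d\<bar> - 1)\<^sup>2" by simp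
    hence "2 * \<bar>d\<bar> * \<eta> \<le> \<eta> * (\<eta> * d\<^sup>2) + 1" by (simp add: power2_eq_square algebra_simps)
    thus ?thesis using \<eta> by (simp add: field_simps)
  qed
  have "(\<integral>x. \<bar>sq_resultant m p x - real m\<bar> \<partial>P_null m p)
      \<le> (\<integral>x. (\<eta> * (sq_resultant m p x - real m)\<^sup>2 + 1 / \<eta>) / 2 \<partial>P_null m p)"
    using i[of 1] i[of 2] amgm by (intro integral_mono) auto
  also have "\<dots> = (\<eta> * (2 * real m * (real m - 1) / real p) + 1 / \<eta>) / 2"
    using i[of 2] by (simp add: sq_resultant_variance[OF p] prob_space)
  also have "\<dots> \<le> (\<eta> * (2 * (real n)\<^sup>2 / real p) + 1 / \<eta>) / 2"
  proof -
    have "real m * (real m - 1) \<le> real n * real n"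
      using n by (intro order_trans[OF mult_left_mono[of "real m - 1" "real m"] mult_mono]) auto
    thus ?thesis
      using \<eta> by (intro divide_right_mono add_right_mono mult_left_mono) (auto simp: power2_eq_square)
  qed
  also have "\<dots> = 3 * real n / (2 * sqrt (real p))"
  proof -
    define r where "r = sqrt (real p)"
    have r: "real p = r * r" "r > 0" using p by (auto simp: r_def)
    show ?thesis unfolding \<eta>_def r_def[symmetric] unfolding r(1) using r(2) n
      by (simp add: field_simps power2_eq_square)
  qed
  finally show ?thesis .
qed

lemma sq_resultant_second_moment_le:
  assumes p: "p \<ge> 2"
  shows "(\<integral>x. (sq_resultant m p x)\<^sup>2 \<partial>P_null m p) \<le> 3 * (real m)\<^sup>2"
proof -
  have p0: "p > 0" using p by simp
  interpret prob_space "P_null m p" by (rule prob_space_P_null[OF p0])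
  have i: "integrable (P_null m p) (\<lambda>x. (sq_resultant m p x - c) ^ k)" for k c
    by (rule sq_resultant_moment_integrable[OF p0])
  have "(\<integral>x. (sq_resultant m p x)\<^sup>2 \<partial>P_null m p)
      = (\<integral>x. (sq_resultant m p x - real m)\<^sup>2 + (2 * real m * (sq_resultant m p x - real m) + (real m)\<^sup>2) \<partial>P_null m p)"
    by (intro Bochner_Integration.integral_cong refl) (simp add: power2_eq_square algebra_simps)
  also have "\<dots> = 2 * real m * (real m - 1) / real p + (real m)\<^sup>2"
    using i[of "real m" 1] i[of "real m" 2]
    by (simp add: sq_resultant_variance[OF p] sq_resultant_mean[OF p] prob_space del: Bochner_Integration.integral_diff)
  also have "2 * real m * (real m - 1) / real p \<le> 2 * real m * real m / 1"
    using p by (intro frac_le mult_left_mono) auto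
  finally show ?thesis by (simp add: power2_eq_square)
qed

text \<open>\<open>\<rho> - m\<close> is left unscaled, so that one frequency \<open>s\<close>
  serves all sizes \<open>m \<le> n\<close> in the recursion.\<close>

definition centered_char :: "nat \<Rightarrow> nat \<Rightarrow> real \<Rightarrow> complex" where
  "centered_char p m s = (\<integral>x. iexp (s * (sq_resultant m p x - real m)) \<partial>P_null m p)"

text \<open>Given the first \<open>m\<close> vectors, the increment contributes the real factor
  \<open>C x\<close>, close to \<open>1 - b * \<rho>\<close>. The factor \<open>E x\<close> already
  accumulated has modulus one, so the error is at most the mean distance from \<open>C x\<close> to
  \<open>exp (- (b * m))\<close>.\<close>

lemma centered_char_step:
  fixes s :: real
  assumes p: "p \<ge> 2" and n: "m \<le> n" "n > 0"
  defines "b \<equiv> 2 * s\<^sup>2 / real p"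
  shows "cmod (centered_char p (Suc m) s - complex_of_real (exp (- (b * real m))) * centered_char p m s)
    \<le> 2 * b\<^sup>2 * (real n)\<^sup>2 + 3 * b * real n / (2 * sqrt (real p))"
proof -
  have p0: "p > 0" using p by simp
  interpret P: prob_space "P_null m p" by (rule prob_space_P_null[OF p0])
  have b: "b \<ge> 0" by (simp add: b_def)
  define C where "C x = (\<integral>y. cos ((2 * s) * inner_prod p y (resultant m x)) \<partial>sphere_unif p)" for x
  define E where "E x = iexp (s * (sq_resultant m p x - real m))" for x
  \<comment> \<open>Three errors: the Taylor remainder of the cosine, the replacement of the random
    \<open>\<rho>\<close> by \<open>m\<close>, and that of \<open>1 - b * m\<close> by an
    exponential.\<close>
  have bd: "\<bar>C x - exp (- (b * real m))\<bar>
      \<le> b\<^sup>2 / 2 * (sq_resultant m p x)\<^sup>2 + b * \<bar>sq_resultant m p x - real m\<bar> + b\<^sup>2 * (real m)\<^sup>2 / 2" for x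
  proof -
    have h1: "\<bar>C x - (1 - b * sq_resultant m p x)\<bar> \<le> b\<^sup>2 / 2 * (sq_resultant m p x)\<^sup>2"
      using sphere_char_expansion(2)[OF p, of "2 * s" "resultant m x"]
      unfolding C_def b_def sq_resultant_def[symmetric] by (simp add: power_mult_distrib power_divide mult_ac)
    have "(1 - b * sq_resultant m p x) - (1 - b * real m) = - (b * (sq_resultant m p x - real m))"
      by (simp add: algebra_simps)
    hence h2: "\<bar>(1 - b * sq_resultant m p x) - (1 - b * real m)\<bar> = b * \<bar>sq_resultant m p x - real m\<bar>"
      using b by (simp add: abs_mult)
    have h3: "\<bar>(1 - b * real m) - exp (- (b * real m))\<bar> \<le> b\<^sup>2 * (real m)\<^sup>2 / 2"
      using exp_minus_taylor_2[of "b * real m"] b by (simp add: power_mult_distrib)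
    have tri: "\<bar>c - e\<bar> \<le> \<bar>c - a\<bar> + \<bar>a - a'\<bar> + \<bar>a' - e\<bar>" for a a' c e :: real by linarith
    show ?thesis
      by (rule order_trans[OF tri add_mono[OF add_mono[OF h1 eq_refl[OF h2]] h3]])
  qed
  have mC: "C \<in> borel_measurable (P_null m p)"
  proof -
    interpret S: prob_space "sphere_unif p" by (rule prob_space_sphere_unif[OF p0])
    have "(\<lambda>(x, y). inner_prod p y (resultant m x)) = (\<lambda>(x, y). inner_prod p (resultant m x) y)"
      by (auto simp: fun_eq_iff intro: inner_prod_commute)
    hence [measurable]: "(\<lambda>(x, y). inner_prod p y (resultant m x)) \<in> borel_measurable (P_null m p \<Otimes>\<^sub>M sphere_unif p)"
      using measurable_inner_resultant_pair[of p m] by simp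
    have "(\<lambda>(x, y). cos ((2 * s) * inner_prod p y (resultant m x)))
        = (\<lambda>z. cos ((2 * s) * (case z of (x, y) \<Rightarrow> inner_prod p y (resultant m x))))"
      by auto
    also have "\<dots> \<in> borel_measurable (P_null m p \<Otimes>\<^sub>M sphere_unif p)" by measurable
    finally have "(\<lambda>(x, y). cos ((2 * s) * inner_prod p y (resultant m x))) \<in> borel_measurable (P_null m p \<Otimes>\<^sub>M sphere_unif p)" .
    thus ?thesis unfolding C_def[abs_def] by (rule S.borel_measurable_lebesgue_integral)
  qed
  have iE: "integrable (P_null m p) E"
    unfolding E_def by (rule integrable_P_null_bounded[OF p0, of _ _ 1]) (auto simp: norm_exp_i_times)
  have iEC: "integrable (P_null m p) (\<lambda>x. E x * complex_of_real (C x))"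
  proof (rule integrable_P_null_bounded[OF p0, of _ _ 1])
    show "(\<lambda>x. E x * complex_of_real (C x)) \<in> borel_measurable (P_null m p)"
      using mC unfolding E_def by measurable
    fix x
    interpret S: prob_space "sphere_unif p" by (rule prob_space_sphere_unif[OF p0])
    have "\<bar>C x\<bar> \<le> (\<integral>y. \<bar>cos ((2 * s) * inner_prod p y (resultant m x))\<bar> \<partial>sphere_unif p)"
      unfolding C_def by (rule integral_abs_bound)
    also have "\<dots> \<le> (\<integral>y. 1 \<partial>sphere_unif p)"
      by (intro integral_mono S.integrable_const_bound[of _ 1]) auto
    finally show "norm (E x * complex_of_real (C x)) \<le> 1"
      by (simp add: E_def norm_mult norm_exp_i_times S.prob_space[simplified])
  qed
  have "centered_char p (Suc m) s
      = (\<integral>x. \<integral>y. iexp (s * (sq_resultant (Suc m) p (x(Suc m := y)) - real (Suc m))) \<partial>sphere_unif p \<partial>P_null m p)"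
    unfolding centered_char_def
    by (rule integral_P_null_Suc[OF p0], rule integrable_P_null_bounded[OF p0, of _ _ 1]) (auto simp: norm_exp_i_times)
  also have "\<dots> = (\<integral>x. E x * complex_of_real (C x) \<partial>P_null m p)"
  proof (intro Bochner_Integration.integral_cong refl)
    fix x assume "x \<in> space (P_null m p)"
    have "(\<integral>y. iexp (s * (sq_resultant (Suc m) p (x(Suc m := y)) - real (Suc m))) \<partial>sphere_unif p)
        = (\<integral>y. E x * iexp ((2 * s) * inner_prod p y (resultant m x)) \<partial>sphere_unif p)"
    proof (intro Bochner_Integration.integral_cong refl)
      fix y assume "y \<in> space (sphere_unif p)"
      hence "s * (sq_resultant (Suc m) p (x(Suc m := y)) - real (Suc m))
          = s * (sq_resultant m p x - real m) + (2 * s) * inner_prod p y (resultant m x)"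
        by (simp add: sq_resultant_Suc algebra_simps)
      thus "iexp (s * (sq_resultant (Suc m) p (x(Suc m := y)) - real (Suc m)))
          = E x * iexp ((2 * s) * inner_prod p y (resultant m x))"
        unfolding E_def by (simp only: of_real_add distrib_left exp_add)
    qed
    also have "\<dots> = E x * complex_of_real (C x)"
      unfolding C_def sphere_char_expansion(1)[OF p, symmetric] by (rule integral_mult_right_zero)
    finally show "(\<integral>y. iexp (s * (sq_resultant (Suc m) p (x(Suc m := y)) - real (Suc m))) \<partial>sphere_unif p)
      = E x * complex_of_real (C x)" .
  qed
  finally have "centered_char p (Suc m) s - complex_of_real (exp (- (b * real m))) * centered_char p m s
      = (\<integral>x. E x * complex_of_real (C x) \<partial>P_null m p) - (\<integral>x. complex_of_real (exp (- (b * real m))) * E x \<partial>P_null m p)"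
    by (simp add: centered_char_def E_def)
  also have "\<dots> = (\<integral>x. E x * complex_of_real (C x) - complex_of_real (exp (- (b * real m))) * E x \<partial>P_null m p)"
    using iE iEC by (intro Bochner_Integration.integral_diff[symmetric]) auto
  also have "cmod \<dots> \<le> (\<integral>x. cmod (E x * complex_of_real (C x) - complex_of_real (exp (- (b * real m))) * E x) \<partial>P_null m p)"
    by (rule integral_norm_bound)
  also have "\<dots> \<le> (\<integral>x. b\<^sup>2 / 2 * (sq_resultant m p x)\<^sup>2 + b * \<bar>sq_resultant m p x - real m\<bar> + b\<^sup>2 * (real m)\<^sup>2 / 2 \<partial>P_null m p)"
  proof (rule integral_mono)
    show "integrable (P_null m p) (\<lambda>x. cmod (E x * complex_of_real (C x) - complex_of_real (exp (- (b * real m))) * E x))"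
      using iE iEC by (intro integrable_norm Bochner_Integration.integrable_diff) auto
    show "integrable (P_null m p) (\<lambda>x. b\<^sup>2 / 2 * (sq_resultant m p x)\<^sup>2 + b * \<bar>sq_resultant m p x - real m\<bar> + b\<^sup>2 * (real m)\<^sup>2 / 2)"
      using sq_resultant_moment_integrable[OF p0, of m 0 2] sq_resultant_moment_integrable[OF p0, of m "real m" 1] by simp
    fix x
    have "E x * complex_of_real (C x) - complex_of_real (exp (- (b * real m))) * E x
        = E x * complex_of_real (C x - exp (- (b * real m)))"
      by (simp add: algebra_simps)
    hence "cmod (E x * complex_of_real (C x) - complex_of_real (exp (- (b * real m))) * E x)
        = \<bar>C x - exp (- (b * real m))\<bar>"
      by (simp only: norm_mult norm_of_real) (simp add: E_def norm_exp_i_times)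
    thus "cmod (E x * complex_of_real (C x) - complex_of_real (exp (- (b * real m))) * E x)
        \<le> b\<^sup>2 / 2 * (sq_resultant m p x)\<^sup>2 + b * \<bar>sq_resultant m p x - real m\<bar> + b\<^sup>2 * (real m)\<^sup>2 / 2"
      using bd by simp
  qed
  also have "\<dots> = b\<^sup>2 / 2 * (\<integral>x. (sq_resultant m p x)\<^sup>2 \<partial>P_null m p)
      + b * (\<integral>x. \<bar>sq_resultant m p x - real m\<bar> \<partial>P_null m p) + b\<^sup>2 * (real m)\<^sup>2 / 2"
    using sq_resultant_moment_integrable[OF p0, of m 0 2] sq_resultant_moment_integrable[OF p0, of m "real m" 1]
    by (simp add: P.prob_space)
  \<comment> \<open>All bounds are made uniform in \<open>m \<le> n\<close>. The quadratic
    contributions \<open>3 / 2\<close> and \<open>1 / 2\<close> add up to the constant 2.\<close>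
  also have "\<dots> \<le> b\<^sup>2 / 2 * (3 * (real n)\<^sup>2) + b * (3 * real n / (2 * sqrt (real p))) + b\<^sup>2 * (real n)\<^sup>2 / 2"
  proof (intro add_mono mult_left_mono divide_right_mono)
    show sq: "(real m)\<^sup>2 \<le> (real n)\<^sup>2" using n by (intro power_mono) auto
    show "(\<integral>x. (sq_resultant m p x)\<^sup>2 \<partial>P_null m p) \<le> 3 * (real n)\<^sup>2"
      using sq_resultant_second_moment_le[OF p, of m] sq by linarith
    show "(\<integral>x. \<bar>sq_resultant m p x - real m\<bar> \<partial>P_null m p) \<le> 3 * real n / (2 * sqrt (real p))"
      by (rule sq_resultant_abs_mean_le[OF p n])
  qed (use b in auto)
  also have "\<dots> = 2 * b\<^sup>2 * (real n)\<^sup>2 + 3 * b * real n / (2 * sqrt (real p))" by simp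
  finally show ?thesis .
qed


text \<open>The factors \<open>exp (- (b * j))\<close> for \<open>j < k\<close> multiply to
  \<open>exp (- (b * k * (k - 1) / 2))\<close>. Each is at most one in modulus, so earlier errors
  are not amplified and the total is \<open>k\<close> times the error of one step.\<close>

lemma centered_char_approx:
  fixes s :: real
  assumes p: "p \<ge> 2" and n: "n > 0"
  defines "b \<equiv> 2 * s\<^sup>2 / real p"
  shows "k \<le> n \<Longrightarrow> cmod (centered_char p k s - complex_of_real (exp (- (b * (real k * (real k - 1) / 2)))))
    \<le> real k * (2 * b\<^sup>2 * (real n)\<^sup>2 + 3 * b * real n / (2 * sqrt (real p)))"
proof (induction k)
  case 0
  interpret prob_space "P_null 0 p" using p by (intro prob_space_P_null) auto
  show ?case
    by (simp add: centered_char_def sq_resultant_def resultant_def inner_prod_def prob_space)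
next
  case (Suc k)
  define \<epsilon> where "\<epsilon> = 2 * b\<^sup>2 * (real n)\<^sup>2 + 3 * b * real n / (2 * sqrt (real p))"
  define e where "e = complex_of_real (exp (- (b * real k)))"
  define z where "z = complex_of_real (exp (- (b * (real k * (real k - 1) / 2))))"
  have b: "b \<ge> 0" by (simp add: b_def)
  have ez: "complex_of_real (exp (- (b * (real (Suc k) * (real (Suc k) - 1) / 2)))) = e * z"
    unfolding e_def z_def of_real_mult[symmetric] exp_add[symmetric] by (simp add: field_simps)
  have "cmod (centered_char p (Suc k) s - e * z)
      \<le> cmod (centered_char p (Suc k) s - e * centered_char p k s) + cmod (e * (centered_char p k s - z))"
    using norm_triangle_ineq[of "centered_char p (Suc k) s - e * centered_char p k s" "e * (centered_char p k s - z)"]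
    by (simp add: algebra_simps)
  also have "cmod (centered_char p (Suc k) s - e * centered_char p k s) \<le> \<epsilon>"
    unfolding e_def \<epsilon>_def b_def using Suc.prems n by (intro centered_char_step[OF p]) auto
  also have "cmod (e * (centered_char p k s - z)) \<le> 1 * (real k * \<epsilon>)"
    unfolding norm_mult using Suc b by (intro mult_mono) (auto simp: e_def z_def \<epsilon>_def)
  finally show ?case
    unfolding ez \<epsilon>_def[symmetric] by (simp add: algebra_simps)
qed

section \<open>Passage to the normal limit\<close>

lemma char_Delta:
  assumes "n > 0" "p > 0"
  shows "char (distr (P_null n p) borel (Delta n p)) t = centered_char p n (t * sqrt (real p) / (2 * real n))"
proof -
  have "char (distr (P_null n p) borel (Delta n p)) t = (\<integral>x. iexp (t * Delta n p x) \<partial>P_null n p)"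
    unfolding char_def by (subst integral_distr) auto
  also have "\<dots> = centered_char p n (t * sqrt (real p) / (2 * real n))"
    unfolding centered_char_def
  proof (intro Bochner_Integration.integral_cong refl)
    fix x
    have "t * Delta n p x = t * sqrt (real p) / (2 * real n) * (sq_resultant n p x - real n)"
      using assms by (simp add: Delta_eq field_simps)
    thus "iexp (t * Delta n p x) = iexp (t * sqrt (real p) / (2 * real n) * (sq_resultant n p x - real n))"
      by (simp only:)
  qed
  finally show ?thesis .
qed

lemma char_normal:
  assumes \<sigma>: "\<sigma> > 0"
  shows "char (density lborel (normal_density 0 \<sigma>)) t = complex_of_real (exp (- (\<sigma> * t)\<^sup>2 / 2))"
proof -
  have "distributed std_normal_distribution lborel (\<lambda>x. x) std_normal_density"
    by (auto simp: distributed_def distr_id2)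
  from prob_space.normal_density_affine[OF _ this, of \<sigma> 0] \<sigma>
  have "distributed std_normal_distribution lborel (\<lambda>x. \<sigma> * x) (normal_density 0 \<sigma>)"
    by (simp add: prob_space_normal_density)
  hence "density lborel (normal_density 0 \<sigma>) = distr std_normal_distribution lborel (\<lambda>x. \<sigma> * x)"
    by (simp add: distributed_def)
  hence "char (density lborel (normal_density 0 \<sigma>)) t = (\<integral>x. iexp (t * x) \<partial>distr std_normal_distribution lborel (\<lambda>x. \<sigma> * x))"
    by (simp add: char_def)
  also have "\<dots> = (\<integral>x. iexp (t * (\<sigma> * x)) \<partial>std_normal_distribution)"
    by (rule integral_distr) auto
  also have "\<dots> = char std_normal_distribution (\<sigma> * t)"
    unfolding char_def by (intro Bochner_Integration.integral_cong refl) (simp add: mult_ac)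
  finally show ?thesis by (simp add: char_std_normal_distribution)
qed

lemma weak_conv_Delta:
  fixes p :: "nat \<Rightarrow> nat"
  assumes p_pos: "\<And>n. p n > 0" and p_lim: "filterlim p at_top sequentially"
  shows "weak_conv_m (\<lambda>n. distr (P_null n (p n)) borel (Delta n (p n)))
    (density lborel (normal_density 0 (sqrt (1/2))))"
proof (rule levy_continuity)
  show "real_distribution (distr (P_null n (p n)) borel (Delta n (p n)))" for n
    by (intro prob_space.real_distribution_distr prob_space_P_null p_pos) simp
  show "real_distribution (density lborel (normal_density 0 (sqrt (1/2))))"
    by (auto simp: real_distribution_def real_distribution_axioms_def prob_space_normal_density)
  fix t :: real
  have pr: "filterlim (\<lambda>n. sqrt (real (p n))) at_top sequentially"
    by (intro filterlim_compose[OF sqrt_at_top] filterlim_compose[OF filterlim_real_sequentially] p_lim)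
  have ev: "\<forall>\<^sub>F n in sequentially. p n \<ge> 2 \<and> n > 0"
    using p_lim[unfolded filterlim_at_top, rule_format, of 2] eventually_gt_at_top[of 0] by eventually_elim auto
  \<comment> \<open>The Gaussian factor at finite \<open>n\<close>, with \<open>n * (n - 1)\<close>
    not yet replaced by \<open>n^2\<close>; the correction \<open>1 / n\<close> is removed in a
    separate limit.\<close>
  define L where "L n = complex_of_real (exp (- (t\<^sup>2 / 4 * (1 - 1 / real n))))" for n
  have bound: "\<forall>\<^sub>F n in sequentially. norm (char (distr (P_null n (p n)) borel (Delta n (p n))) t - L n)
      \<le> t ^ 4 / 2 * (1 / real n) + 3 * t\<^sup>2 / 4 * (1 / sqrt (real (p n)))"
    using ev
  proof eventually_elim
    case (elim n)
    define q where "q = sqrt (real (p n))"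
    have q: "real (p n) = q * q" "q > 0" using elim by (auto simp: q_def)
    define s where "s = t * q / (2 * real n)"
    define b where "b = 2 * s\<^sup>2 / real (p n)"
    \<comment> \<open>The dimension cancels: the frequency \<open>t * sqrt p / (2 * n)\<close> makes
      \<open>b\<close> depend on \<open>t\<close> and \<open>n\<close> alone.\<close>
    have b: "b = t\<^sup>2 / (2 * (real n)\<^sup>2)"
      unfolding b_def s_def q(1) using q(2) by (simp add: power_divide power_mult_distrib power2_eq_square)
    have "b * (real n * (real n - 1) / 2) = t\<^sup>2 / 4 * (1 - 1 / real n)"
      unfolding b using elim by (simp add: field_simps power2_eq_square)
    hence L: "L n = complex_of_real (exp (- (b * (real n * (real n - 1) / 2))))" by (simp add: L_def)
    have "norm (centered_char (p n) n s - L n)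
        \<le> real n * (2 * b\<^sup>2 * (real n)\<^sup>2 + 3 * b * real n / (2 * sqrt (real (p n))))"
      unfolding L b_def using elim by (intro centered_char_approx) auto
    also have "\<dots> = t ^ 4 / 2 * (1 / real n) + 3 * t\<^sup>2 / 4 * (1 / q)"
      unfolding b q_def[symmetric] using elim q(2) by (simp add: field_simps power2_eq_square power4_eq_xxxx)
    finally show ?case
      using elim by (simp add: char_Delta s_def q_def)
  qed
  have i1: "(\<lambda>n. 1 / real n) \<longlonglongrightarrow> 0" by (rule lim_1_over_n)
  have i2: "(\<lambda>n. 1 / sqrt (real (p n))) \<longlonglongrightarrow> 0"
    using tendsto_inverse_0_at_top[OF pr] by (simp add: inverse_eq_divide)
  have "(\<lambda>n. t ^ 4 / 2 * (1 / real n) + 3 * t\<^sup>2 / 4 * (1 / sqrt (real (p n)))) \<longlonglongrightarrow> t ^ 4 / 2 * 0 + 3 * t\<^sup>2 / 4 * 0"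
    by (intro tendsto_intros i1 i2)
  hence diff: "(\<lambda>n. char (distr (P_null n (p n)) borel (Delta n (p n))) t - L n) \<longlonglongrightarrow> 0"
    by (intro Lim_null_comparison[OF bound]) simp
  have "L \<longlonglongrightarrow> complex_of_real (exp (- (t\<^sup>2 / 4 * (1 - 0))))"
    unfolding L_def by (intro tendsto_intros i1)
  also have "complex_of_real (exp (- (t\<^sup>2 / 4 * (1 - 0)))) = char (density lborel (normal_density 0 (sqrt (1/2)))) t"
    by (subst char_normal) (auto simp: power_mult_distrib real_sqrt_divide power_divide)
  finally show "(\<lambda>n. char (distr (P_null n (p n)) borel (Delta n (p n))) t) \<longlonglongrightarrow> char (density lborel (normal_density 0 (sqrt (1/2)))) t"
    using tendsto_add[OF diff, of L] by fastforce
qed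

section \<open>The asymptotic expansion\<close>

text \<open>The deterministic core, for \<open>\<rho> = n * r\<close> with \<open>r\<close> near 1.
  In the notation of the proof, \<open>Y - n * y\<close> is the \<open>Delta\<close> term,
  \<open>Y^2 / p\<close> gives \<open>\<tau>^4 / 4\<close> up to the error in \<open>r^2\<close>,
  and \<open>n * y^2 / p\<close> is only \<open>\<tau>^4 / (4 * n)\<close>.\<close>

lemma log_bessel_ratio_expansion:
  fixes \<tau> \<kappa> r :: real
  assumes p: "p > 0" and n: "n > 0" and \<tau>: "\<tau> > 0"
    and \<kappa>: "\<kappa> = \<tau> * real p powr (3/4) / sqrt (real n)"
    and r: "\<bar>r - 1\<bar> \<le> \<delta>" "\<delta> \<le> 1"
  shows "\<bar>ln (bessel p 0 (\<kappa>\<^sup>2 * (real n * r) / (2 * real p)) / bessel p 0 (\<kappa>\<^sup>2 / (2 * real p)) ^ n)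
      - (\<tau>\<^sup>2 * (sqrt (real p) / 2 * (r - 1)) - \<tau> ^ 4 / 4)\<bar>
    \<le> 3 / 4 * \<tau> ^ 4 * \<delta> + \<tau> ^ 4 * (1 / (4 * real n)) + 4 * \<tau> ^ 4 * (1 / real p) + 6 * \<tau> ^ 6 * (1 / sqrt (real p))"
proof -
  define w where "w = sqrt (real p)"
  have w: "real p = w * w" "w > 0" using p by (auto simp: w_def)
  have "(real p powr (3/4))\<^sup>2 = real p powr (3/2)"
    by (simp add: power2_eq_square powr_add[symmetric])
  also have "\<dots> = real p powr 1 * real p powr (1/2)"
    by (simp only: powr_add[symmetric]) simp
  also have "\<dots> = real p * w" using p by (simp add: w_def powr_half_sqrt)
  finally have \<kappa>2: "\<kappa>\<^sup>2 = \<tau>\<^sup>2 * (real p * w) / real n"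
    unfolding \<kappa> by (simp add: power_divide power_mult_distrib)
  define y where "y = \<tau>\<^sup>2 * w / (2 * real n)"
  define Y where "Y = \<tau>\<^sup>2 * w / 2 * r"
  have y: "\<kappa>\<^sup>2 / (2 * real p) = y" "\<kappa>\<^sup>2 * (real n * r) / (2 * real p) = Y"
    unfolding \<kappa>2 y_def Y_def using p n by (simp_all add: field_simps)
  have r02: "0 \<le> r" "r \<le> 2" using r by auto
  have pos: "y \<ge> 0" "Y \<ge> 0" using w r02 by (auto simp: y_def Y_def)
  \<comment> \<open>A common upper bound for \<open>Y\<close>, where \<open>r \<le> 2\<close>
    enters, and for \<open>y\<close>, so that a single \<open>B\<close> covers both
    remainders.\<close>
  define Z where "Z = \<tau>\<^sup>2 * w"
  have Z: "Z \<ge> 0" using w by (simp add: Z_def)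
  define e where "e z = ln (bessel p 0 z) - (z - z\<^sup>2 / real p)" for z
  have e: "0 \<le> e z" "e z \<le> (2 * z\<^sup>2 + 3 * z ^ 3) / (real p)\<^sup>2" if "z \<ge> 0" for z
    using ln_bessel_lower[OF that p] ln_bessel_upper[OF that p] by (auto simp: e_def)
  define B where "B = (2 * Z\<^sup>2 + 3 * Z ^ 3) / (real p)\<^sup>2"
  have "Y \<le> Z" using mult_left_mono[OF r02(2), of "\<tau>\<^sup>2 * w / 2"] w unfolding Y_def Z_def by simp
  hence "(2 * Y\<^sup>2 + 3 * Y ^ 3) / (real p)\<^sup>2 \<le> B"
    unfolding B_def using pos by (intro divide_right_mono add_mono mult_left_mono power_mono) auto
  hence eY: "0 \<le> e Y" "e Y \<le> B" using e[OF pos(2)] by auto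
  have yZ: "y = Z / (2 * real n)" by (simp add: y_def Z_def)
  \<comment> \<open>One power of \<open>y = Z / (2 * n)\<close> absorbs the factor \<open>n\<close>
    coming from the \<open>n\<close>-th power in the denominator.\<close>
  have ny: "real n * y ^ Suc k \<le> Z ^ Suc k" for k
  proof -
    have "real n * y ^ Suc k = (real n * y) * y ^ k" by simp
    also have "\<dots> \<le> Z * Z ^ k"
    proof (intro mult_mono power_mono)
      show "real n * y \<le> Z" unfolding yZ using n Z by simp
      have "Z / (2 * real n) \<le> Z / 1" using n Z by (intro divide_left_mono) auto
      thus "y \<le> Z" unfolding yZ by simp
    qed (use pos Z in auto)
    finally show ?thesis by simp
  qed
  have "real n * e y \<le> real n * ((2 * y\<^sup>2 + 3 * y ^ 3) / (real p)\<^sup>2)"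
    using e[OF pos(1)] by (intro mult_left_mono) auto
  also have "\<dots> = (2 * (real n * y ^ Suc 1) + 3 * (real n * y ^ Suc 2)) / (real p)\<^sup>2"
    by (simp add: field_simps eval_nat_numeral)
  also have "\<dots> \<le> (2 * Z ^ Suc 1 + 3 * Z ^ Suc 2) / (real p)\<^sup>2"
    by (intro divide_right_mono add_mono mult_left_mono ny) auto
  also have "\<dots> = B" by (simp add: B_def eval_nat_numeral)
  finally have ey: "0 \<le> real n * e y" "real n * e y \<le> B" using e[OF pos(1)] by auto
  have B: "B = 2 * \<tau> ^ 4 * (1 / real p) + 3 * \<tau> ^ 6 * (1 / w)"
    unfolding B_def Z_def w(1) using w(2) by (simp add: field_simps eval_nat_numeral)
  have bp: "bessel p 0 y > 0" "bessel p 0 Y > 0" using pos by (auto intro: bessel_pos)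
  have "ln (bessel p 0 Y / bessel p 0 y ^ n) = ln (bessel p 0 Y) - real n * ln (bessel p 0 y)"
    using bp by (simp add: ln_div ln_realpow)
  also have "\<dots> = (Y - real n * y) - Y\<^sup>2 / real p + real n * y\<^sup>2 / real p + e Y - real n * e y"
    by (simp add: e_def algebra_simps)
  also have "Y - real n * y = \<tau>\<^sup>2 * (w / 2 * (r - 1))"
    unfolding Y_def y_def using n by (simp add: field_simps)
  also have "Y\<^sup>2 / real p = \<tau> ^ 4 / 4 * r\<^sup>2"
    unfolding Y_def w(1) using w(2) by (simp add: field_simps eval_nat_numeral)
  also have "real n * y\<^sup>2 / real p = \<tau> ^ 4 * (1 / (4 * real n))"
    unfolding y_def w(1) using w(2) n by (simp add: field_simps eval_nat_numeral)
  finally have eq: "ln (bessel p 0 Y / bessel p 0 y ^ n) - (\<tau>\<^sup>2 * (w / 2 * (r - 1)) - \<tau> ^ 4 / 4)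
      = \<tau> ^ 4 / 4 * (1 - r\<^sup>2) + \<tau> ^ 4 * (1 / (4 * real n)) + e Y - real n * e y"
    by (simp add: algebra_simps diff_divide_distrib)
  \<comment> \<open>Factor \<open>1 - r^2\<close>; \<open>r \<le> 2\<close> bounds the second factor
    by 3, which gives the coefficient \<open>3 / 4\<close> of \<open>\<delta>\<close>.\<close>
  have "\<bar>1 - r\<^sup>2\<bar> = \<bar>r - 1\<bar> * \<bar>1 + r\<bar>"
    by (simp add: abs_mult[symmetric] power2_eq_square algebra_simps)
  also have "\<dots> \<le> \<delta> * 3" using r r02 by (intro mult_mono) auto
  finally have "\<bar>\<tau> ^ 4 / 4 * (1 - r\<^sup>2)\<bar> \<le> \<tau> ^ 4 / 4 * (\<delta> * 3)"
    unfolding abs_mult by (intro mult_mono) auto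
  hence "\<bar>\<tau> ^ 4 / 4 * (1 - r\<^sup>2)\<bar> \<le> 3 / 4 * \<tau> ^ 4 * \<delta>"
    by (simp add: mult_ac)
  hence d: "- (3 / 4 * \<tau> ^ 4 * \<delta>) \<le> \<tau> ^ 4 / 4 * (1 - r\<^sup>2)" "\<tau> ^ 4 / 4 * (1 - r\<^sup>2) \<le> 3 / 4 * \<tau> ^ 4 * \<delta>"
    unfolding abs_le_iff by linarith+
  have m: "0 \<le> \<tau> ^ 4 * (1 / (4 * real n))" by simp
  have B0: "0 \<le> B" using eY by linarith
  have "\<bar>\<tau> ^ 4 / 4 * (1 - r\<^sup>2) + \<tau> ^ 4 * (1 / (4 * real n)) + e Y - real n * e y\<bar>
      \<le> 3 / 4 * \<tau> ^ 4 * \<delta> + \<tau> ^ 4 * (1 / (4 * real n)) + 2 * B"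
    using d m eY ey B0 by (intro abs_leI) linarith+
  thus ?thesis unfolding y eq[folded w_def] w_def[symmetric] B by simp
qed

lemma sq_resultant_concentration:
  assumes p: "p \<ge> 2" and n: "n > 0" and \<delta>: "\<delta> > 0"
  shows "measure (P_null n p) {x \<in> space (P_null n p). \<delta> \<le> \<bar>sq_resultant n p x / real n - 1\<bar>}
    \<le> 2 / \<delta>\<^sup>2 * (1 / real p)"
proof -
  have p0: "p > 0" using p by simp
  interpret P: prob_space "P_null n p" by (rule prob_space_P_null[OF p0])
  have "\<delta> \<le> \<bar>sq_resultant n p x / real n - 1\<bar> \<longleftrightarrow> \<delta> * real n \<le> \<bar>sq_resultant n p x - real n\<bar>" for x
  proof -
    have "\<bar>sq_resultant n p x / real n - 1\<bar> = \<bar>(sq_resultant n p x - real n) / real n\<bar>"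
      using n by (simp add: diff_divide_distrib)
    thus ?thesis using n by (simp add: abs_divide pos_le_divide_eq)
  qed
  hence "measure (P_null n p) {x \<in> space (P_null n p). \<delta> \<le> \<bar>sq_resultant n p x / real n - 1\<bar>}
      = measure (P_null n p) {x \<in> space (P_null n p). \<delta> * real n \<le> \<bar>sq_resultant n p x - P.expectation (sq_resultant n p)\<bar>}"
    by (simp add: sq_resultant_mean'[OF p])
  also have "\<dots> \<le> P.variance (sq_resultant n p) / (\<delta> * real n)\<^sup>2"
    using sq_resultant_moment_integrable[OF p0, of n 0 2] \<delta> n
    by (intro P.Chebyshev_inequality) auto
  also have "\<dots> = 2 * real n * (real n - 1) / real p / (\<delta> * real n)\<^sup>2"
    by (simp add: sq_resultant_mean'[OF p] sq_resultant_variance[OF p])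
  also have "\<dots> \<le> 2 * real n * real n / real p / (\<delta> * real n)\<^sup>2"
    by (intro divide_right_mono mult_left_mono) auto
  also have "\<dots> = 2 / \<delta>\<^sup>2 * (1 / real p)"
    using n \<delta> p by (simp add: field_simps power2_eq_square)
  finally show ?thesis .
qed

lemma log_likelihood_ratio_expansion:
  fixes p :: "nat \<Rightarrow> nat" and \<tau> \<kappa> :: "nat \<Rightarrow> real"
    and T :: "nat \<Rightarrow> (nat \<Rightarrow> nat \<Rightarrow> real) \<Rightarrow> 't"
  assumes p_pos: "\<And>n. p n > 0"
    and p_lim: "filterlim p at_top sequentially"
    and tau_pos: "\<And>n. \<tau> n > 0"
    and tau_bigo: "\<tau> \<in> O(\<lambda>_. 1)"
    and kappa: "\<And>n. \<kappa> n = \<tau> n * real (p n) powr (3/4) / sqrt (real n)"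
    and theta: "\<And>n. \<theta> n \<in> unit_sphere (p n)"
    and T: "\<And>n. maximal_invariant (SO (p n)) (rotate_sample n (p n))
                    ({1..n} \<rightarrow>\<^sub>E unit_sphere (p n)) (T n)"
  shows "small_o_P (\<lambda>n. P_null n (p n))
           (\<lambda>n x. ln (likelihood_ratio (P_null n (p n)) (P_fvml n (p n) (\<theta> n) (\<kappa> n)) (T n) x)
                  - ((\<tau> n)\<^sup>2 * Delta n (p n) x - (\<tau> n) ^ 4 / 4))"
  unfolding small_o_P_def
proof (intro conjI allI impI)
  let ?LR = "\<lambda>n. likelihood_ratio (P_null n (p n)) (P_fvml n (p n) (\<theta> n) (\<kappa> n)) (T n)"
  let ?Y = "\<lambda>n x. ln (?LR n x) - ((\<tau> n)\<^sup>2 * Delta n (p n) x - (\<tau> n) ^ 4 / 4)"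
  have mLR [measurable]: "?LR n \<in> borel_measurable (P_null n (p n))" for n
    by (rule measurable_likelihood_ratio)
  show mY [measurable]: "?Y n \<in> borel_measurable (P_null n (p n))" for n
    by measurable
  fix \<epsilon> :: real assume \<epsilon>: "\<epsilon> > 0"
  obtain K where K: "K > 0" "\<forall>\<^sub>F n in sequentially. \<tau> n \<le> K"
  proof -
    from tau_bigo obtain c where c: "c > 0" "\<forall>\<^sub>F n in sequentially. norm (\<tau> n) \<le> c * norm (1::real)"
      by (elim landau_o.bigE)
    from c(2) have "\<forall>\<^sub>F n in sequentially. \<tau> n \<le> c" by (rule eventually_mono) simp
    thus ?thesis by (rule that[OF c(1)])
  qed
  \<comment> \<open>Keeps the \<open>\<delta>\<close> term below \<open>3 / 8 * \<epsilon>\<close>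
    as long as \<open>\<tau> \<le> K\<close>; the minimum with 1 meets the condition
    \<open>\<delta> \<le> 1\<close> of the expansion.\<close>
  define \<delta> where "\<delta> = min 1 (\<epsilon> / (2 * K ^ 4))"
  have \<delta>: "\<delta> > 0" "\<delta> \<le> 1" "3 / 4 * K ^ 4 * \<delta> \<le> 3 / 8 * \<epsilon>"
  proof -
    have "3 / 4 * K ^ 4 * \<delta> \<le> 3 / 4 * K ^ 4 * (\<epsilon> / (2 * K ^ 4))"
      unfolding \<delta>_def using K by (intro mult_left_mono) auto
    thus "3 / 4 * K ^ 4 * \<delta> \<le> 3 / 8 * \<epsilon>" using K by simp
  qed (use K \<epsilon> in \<open>auto simp: \<delta>_def\<close>)
  have rp: "filterlim (\<lambda>n. real (p n)) at_top sequentially"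
    by (intro filterlim_compose[OF filterlim_real_sequentially] p_lim)
  have i1: "(\<lambda>n. 1 / real (p n)) \<longlonglongrightarrow> 0"
    using tendsto_inverse_0_at_top[OF rp] by (simp add: inverse_eq_divide)
  have i2: "(\<lambda>n. 1 / sqrt (real (p n))) \<longlonglongrightarrow> 0"
    using tendsto_inverse_0_at_top[OF filterlim_compose[OF sqrt_at_top rp]] by (simp add: inverse_eq_divide)
  have i3: "(\<lambda>n. 1 / (4 * real n)) \<longlonglongrightarrow> 0"
    using tendsto_mult_right_zero[OF lim_1_over_n, of "1/4"] by simp
  have "(\<lambda>n. 3 / 8 * \<epsilon> + K ^ 4 * (1 / (4 * real n)) + 4 * K ^ 4 * (1 / real (p n)) + 6 * K ^ 6 * (1 / sqrt (real (p n))))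
      \<longlonglongrightarrow> 3 / 8 * \<epsilon> + K ^ 4 * 0 + 4 * K ^ 4 * 0 + 6 * K ^ 6 * 0"
    by (intro tendsto_intros i1 i2 i3)
  hence small: "\<forall>\<^sub>F n in sequentially.
      3 / 8 * \<epsilon> + K ^ 4 * (1 / (4 * real n)) + 4 * K ^ 4 * (1 / real (p n)) + 6 * K ^ 6 * (1 / sqrt (real (p n))) < \<epsilon>"
    using \<epsilon> by (elim order_tendstoD(2)) simp
  \<comment> \<open>\<open>SO 1\<close> is trivial and does not exchange the two points of the
    sphere, so transitivity starts at dimension 2, which \<open>p n\<close> eventually
    reaches.\<close>
  have ev: "\<forall>\<^sub>F n in sequentially. p n \<ge> 2 \<and> n > 0"
    using p_lim[unfolded filterlim_at_top, rule_format, of 2] eventually_gt_at_top[of 0] by eventually_elim auto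
  have "\<forall>\<^sub>F n in sequentially.
      norm (measure (P_null n (p n)) {x \<in> space (P_null n (p n)). \<bar>?Y n x\<bar> > \<epsilon>}) \<le> 2 / \<delta>\<^sup>2 * (1 / real (p n))"
    using small ev K(2)
  proof eventually_elim
    case (elim n)
    interpret P: prob_space "P_null n (p n)" by (rule prob_space_P_null[OF p_pos])
    let ?B = "{x \<in> space (P_null n (p n)). \<delta> \<le> \<bar>sq_resultant n (p n) x / real n - 1\<bar>}"
    have p2: "p n \<ge> 2" and n0: "n > 0" using elim by auto
    \<comment> \<open>The ratio is identified only almost everywhere, so the bad event lies in the
      Chebyshev event \<open>?B\<close> up to a null set; \<open>finite_measure_mono_AE\<close>
      tolerates this.\<close>
    have "AE x in P_null n (p n). x \<in> {x \<in> space (P_null n (p n)). \<bar>?Y n x\<bar> > \<epsilon>} \<longrightarrow> x \<in> ?B"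
      using likelihood_ratio_fvml[OF p2 theta T, of "\<kappa> n"]
    proof eventually_elim
      fix x assume LR: "?LR n x = bessel (p n) 0 ((\<kappa> n)\<^sup>2 * sq_resultant n (p n) x / (2 * real (p n)))
          / bessel (p n) 0 ((\<kappa> n)\<^sup>2 / (2 * real (p n))) ^ n"
      define r where "r = sq_resultant n (p n) x / real n"
      have sr: "sq_resultant n (p n) x = real n * r" using n0 by (simp add: r_def)
      have D: "Delta n (p n) x = sqrt (real (p n)) / 2 * (r - 1)"
        using n0 p_pos by (simp add: Delta_eq r_def)
      have "\<bar>?Y n x\<bar> \<le> \<epsilon>" if "\<bar>r - 1\<bar> \<le> \<delta>"
      proof -
        have "\<bar>?Y n x\<bar> \<le> 3 / 4 * \<tau> n ^ 4 * \<delta> + \<tau> n ^ 4 * (1 / (4 * real n))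
            + 4 * \<tau> n ^ 4 * (1 / real (p n)) + 6 * \<tau> n ^ 6 * (1 / sqrt (real (p n)))"
          unfolding LR sr D
          by (rule log_bessel_ratio_expansion[OF p_pos n0 tau_pos kappa that \<delta>(2)])
        also have "\<dots> \<le> 3 / 4 * K ^ 4 * \<delta> + K ^ 4 * (1 / (4 * real n))
            + 4 * K ^ 4 * (1 / real (p n)) + 6 * K ^ 6 * (1 / sqrt (real (p n)))"
          using elim(3) less_imp_le[OF tau_pos[of n]] \<delta>(1)
          by (intro add_mono mult_mono power_mono order_refl) auto
        also have "\<dots> \<le> \<epsilon>" using elim(1) \<delta>(3) by linarith
        finally show ?thesis .
      qed
      thus "x \<in> {x \<in> space (P_null n (p n)). \<bar>?Y n x\<bar> > \<epsilon>} \<longrightarrow> x \<in> ?B"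
        by (cases "\<bar>r - 1\<bar> \<le> \<delta>") (auto simp: r_def[symmetric])
    qed
    hence "measure (P_null n (p n)) {x \<in> space (P_null n (p n)). \<bar>?Y n x\<bar> > \<epsilon>} \<le> measure (P_null n (p n)) ?B"
      by (rule P.finite_measure_mono_AE) measurable
    also have "\<dots> \<le> 2 / \<delta>\<^sup>2 * (1 / real (p n))"
      by (rule sq_resultant_concentration[OF p2 n0 \<delta>(1)])
    finally show ?case by simp
  qed
  moreover have "(\<lambda>n. 2 / \<delta>\<^sup>2 * (1 / real (p n))) \<longlonglongrightarrow> 0"
    by (rule tendsto_mult_right_zero[OF i1])
  ultimately show "(\<lambda>n. measure (P_null n (p n)) {x \<in> space (P_null n (p n)). \<bar>?Y n x\<bar> > \<epsilon>}) \<longlonglongrightarrow> 0"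
    by (rule Lim_null_comparison)
qed

theorem theorem4p2:
  fixes p :: "nat \<Rightarrow> nat" and \<tau> \<kappa> :: "nat \<Rightarrow> real"
    and \<theta> :: "nat \<Rightarrow> nat \<Rightarrow> real"
    and T :: "nat \<Rightarrow> (nat \<Rightarrow> nat \<Rightarrow> real) \<Rightarrow> 't"
  assumes p_pos: "\<And>n. p n > 0"
    and p_lim: "filterlim p at_top sequentially"
    and tau_pos: "\<And>n. \<tau> n > 0"
    and tau_bigo: "\<tau> \<in> O(\<lambda>_. 1)"
    and tau_not_smallo: "\<tau> \<notin> o(\<lambda>_. 1)"
    and kappa: "\<And>n. \<kappa> n = \<tau> n * real (p n) powr (3/4) / sqrt (real n)"
    and theta: "\<And>n. \<theta> n \<in> unit_sphere (p n)"
    and T: "\<And>n. maximal_invariant (SO (p n)) (rotate_sample n (p n))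
                    ({1..n} \<rightarrow>\<^sub>E unit_sphere (p n)) (T n)"
  shows "small_o_P (\<lambda>n. P_null n (p n))
           (\<lambda>n x. ln (likelihood_ratio (P_null n (p n)) (P_fvml n (p n) (\<theta> n) (\<kappa> n)) (T n) x)
                  - ((\<tau> n)\<^sup>2 * Delta n (p n) x - (\<tau> n) ^ 4 / 4))
         \<and> weak_conv_m (\<lambda>n. distr (P_null n (p n)) borel (Delta n (p n)))
                       (density lborel (normal_density 0 (sqrt (1/2))))"
  using log_likelihood_ratio_expansion[OF p_pos p_lim tau_pos tau_bigo kappa theta T]
    weak_conv_Delta[OF p_pos p_lim] by (rule conjI)

end
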